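(* Let $n,k\in\mathbb{N}$ with $n\ge k$. For any function $\varphi:\mathcal{M}(n,k)\to\mathbb{R}$, $$\int_{\mathcal{M}(n,k)}\varphi(X)\,dX=\int_{\mathcal{P}(k)}\int_{\mathcal{O}(n,k)}\varphi(OP)\,D_{n,k}\,(\det P)^{n-k}\prod_{i<j}(\lambda_i+\lambda_j)\,dO\,dP,$$ where $dX=\prod_{i,j}dX_{ij}$, $dP=\prod_{i\le j}dP_{ij}$, $dO$ is the homogeneous probability measure on $\mathcal{O}(n,k)$, $\lambda_1\ge\cdots\ge\lambda_k>0$ are the eigenvalues of $P$, and $D_{n,k}$ is a constant.
   Context: $\mathcal{M}(n,k)$ is the set of all real $n\times k$ matrices, identified with $\mathbb{R}^{nk}$. $\mathcal{O}(n,k)=\{O\in\mathcal{M}(n,k): O^TO=1_k\}$, where $1_k$ is the $k\times k$ identity matrix. $\mathcal{P}(k)$ is the set of real symmetric positive-definite $k\times k$ matrices, regarded as an open subset of $\mathbb{R}^{k(k+1)/2}$ via the entries $P_{ij}$, $i\le j$. The homogeneous probability measure on $\mathcal{O}(n,k)$ is the unique probability measure on $\mathcal{O}(n,k)$ invariant under left multiplication by every real orthogonal $n\times n$ matrix. The subscripts of $D_{n,k}$ indicate its dependence on $n$ and $k$. *)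

theory Defs
  imports "HOL-Probability.Probability" "HOL-Computational_Algebra.Computational_Algebra"
begin

text \<open>
  A real \<open>n \<times> k\<close> matrix is an element of \<open>real^'k^'n\<close> (\<open>'n\<close> indexes the rows). On this Euclidean
  space \<open>lebesgue\<close> is the completed product of the Lebesgue measures of all entries.
\<close>

definition stiefel :: "(real^'k^'n) set" where
  "stiefel = {Q. transpose Q ** Q = mat 1}"

definition pos_def_mats :: "(real^'k^'k) set" where
  "pos_def_mats = {P. transpose P = P \<and> (\<forall>x. x \<noteq> 0 \<longrightarrow> 0 < x \<bullet> (P *v x))}"

definition homogeneous_prob :: "(real^'k^'n) measure \<Rightarrow> bool" where
  "homogeneous_prob \<mu> \<longleftrightarrow>
     prob_space \<mu> \<and> sets \<mu> = sets (restrict_space borel stiefel) \<and>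
     (\<forall>U :: real^'n^'n. orthogonal_matrix U \<longrightarrow> distr \<mu> \<mu> (\<lambda>Q. U ** Q) = \<mu>)"

text \<open>The completion makes null-set modifications of integrands harmless.\<close>

definition homogeneous_measure :: "(real^'k^'n) measure" where
  "homogeneous_measure = completion (THE \<mu>. homogeneous_prob \<mu>)"

definition sym_mat_of :: "('k::{finite,linorder} \<times> 'k \<Rightarrow> real) \<Rightarrow> real^'k::{finite,linorder}^'k::{finite,linorder}" where
  "sym_mat_of p = (\<chi> i j. p (min i j, max i j))"

text \<open>
  The measure \<open>\<Prod>\<^bsub>i\<le>j\<^esub> dP\<^bsub>ij\<^esub>\<close>, completed: Lebesgue measure in the upper-triangular entries,
  transported to matrices. It lives on the symmetric matrices, a null set of \<open>lebesgue\<close>.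
\<close>

definition sym_lebesgue :: "(real^'k::{finite,linorder}^'k::{finite,linorder}) measure" where
  "sym_lebesgue = completion (distr (\<Pi>\<^sub>M ij\<in>{(i, j). i \<le> j}. lborel) borel sym_mat_of)"

definition char_polynomial :: "real^'k^'k \<Rightarrow> real poly" where
  "char_polynomial A = det (\<chi> i j. (if i = j then [:0, 1:] else 0) - [:A $ i $ j:])"

text \<open>
  The real eigenvalues, repeated according to multiplicity, in decreasing order; list positions
  start at \<open>0\<close>. For a symmetric matrix the length is \<open>CARD('k)\<close>.
\<close>

definition eigenvalue_list :: "real^'k^'k \<Rightarrow> real list" where
  "eigenvalue_list A = rev (sorted_list_of_multiset (proots (char_polynomial A)))"

end

theory Submission
  imports Defs
begin

text \<open>
  Almost every \<open>n \<times> k\<close> matrix \<open>X\<close> has full rank, and then \<open>X = Q P\<close> with unique \<open>Q\<close> in the Stiefel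
  manifold and \<open>P\<close> positive definite, namely \<open>P = (X\<^sup>T X)\<^sup>1\<^sup>/\<^sup>2\<close>. The formula says that in these
  coordinates Lebesgue measure is a product, of the homogeneous measure in \<open>Q\<close> and of a measure in \<open>P\<close>
  with the stated density.

  The product structure comes from the invariance of Lebesgue measure under \<open>X \<mapsto> U X\<close> for orthogonal \<open>U\<close>: the
  integrand may be averaged over the Haar measure of the orthogonal group, and since that group acts
  transitively on the Stiefel manifold, the average of \<open>\<phi> (U Q P)\<close> over \<open>U\<close> is the integral of \<open>\<phi> (R P)\<close>
  over the homogeneous measure in \<open>R\<close> (\<open>nn_integral_polar_average\<close>). The same averaging shows that the
  homogeneous measure exists and is unique (\<open>homogeneous_prob_unique\<close>). Haar measure itself is the law
  of the orthogonal polar factor of a random square matrix.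

  The density of \<open>P\<close> is found through the Gram matrix \<open>S = X\<^sup>T X = P\<^sup>2\<close>. Replacing \<open>X\<close> by \<open>X A\<close> scales
  Lebesgue measure by \<open>\<bar>det A\<bar>\<^sup>n\<close>, and \<open>S \<mapsto> A\<^sup>T S A\<close> scales the measure \<open>dS\<close> on symmetric matrices by
  \<open>\<bar>det A\<bar>\<^sup>k\<^sup>+\<^sup>1\<close>. After division by the matching power of \<open>det S\<close>, the image of Lebesgue measure under
  \<open>X \<mapsto> X\<^sup>T X\<close> and the measure \<open>dS\<close> are therefore two measures on the positive definite cone that are
  invariant under \<open>GL(k)\<close>. The action is transitive, so they are proportional, and \<open>S\<close> has a density
  proportional to \<open>det S\<close> to the power \<open>(n - k - 1) / 2\<close> (\<open>gram_distribution\<close>).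

  The derivative of \<open>P \<mapsto> P\<^sup>2\<close> is \<open>H \<mapsto> P H + H P\<close>. In an eigenbasis of \<open>P\<close> it multiplies the entry
  \<open>(i, j)\<close> by \<open>\<lambda>\<^sub>i + \<lambda>\<^sub>j\<close>, so its determinant on symmetric matrices is
  \<open>\<Prod>\<^bsub>i\<le>j\<^esub> (\<lambda>\<^sub>i + \<lambda>\<^sub>j) = 2\<^sup>k det P \<Prod>\<^bsub>i<j\<^esub> (\<lambda>\<^sub>i + \<lambda>\<^sub>j)\<close>. Multiplied by
  \<open>det P\<close> to the power \<open>n - k - 1\<close>, this is the density of the theorem.

  All this amounts to one identity of Borel measures, \<open>lborel_polar\<close>: Lebesgue measure is the image of a
  product measure under \<open>(P, Q) \<mapsto> Q P\<close>. The theorems of Tonelli and Fubini for that product give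
  both halves of the statement for Borel integrands. A Lebesgue measurable integrand is Borel off a
  null set, and the preimage of a null set is null in the product.
\<close>

no_notation fps_nth (infixl \<open>$\<close> 75)

section \<open>Symmetric matrices and the polar decomposition\<close>

definition diagm :: "real^'n \<Rightarrow> real^'n^'n" where
  "diagm d = (\<chi> i j. if i = j then d $ i else 0)"

lemma symmetric_inner_swap:
  fixes A :: "real^'n^'n"
  assumes "transpose A = A"
  shows "x \<bullet> (A *v y) = (A *v x) \<bullet> y"
  by (metis assms dot_lmul_matrix transpose_matrix_vector)

text \<open>
  A maximiser \<open>v\<close> of \<open>x \<bullet> A x\<close> on the unit sphere of \<open>S\<close>, with maximum \<open>c\<close>, is an eigenvector: the form
  \<open>c (x \<bullet> x) - x \<bullet> A x\<close> is nonnegative on \<open>S\<close> and vanishes at \<open>v\<close>, so its first-order term at \<open>v\<close> vanishes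
  in every direction of \<open>S\<close>, in particular in the direction \<open>w = c v - A v\<close>, where it is \<open>2 (w \<bullet> w)\<close>.
\<close>

lemma symmetric_eigenvector_exists:
  fixes A :: "real^'n^'n"
  assumes sym: "transpose A = A" and S: "subspace S" and inv: "\<And>x. x \<in> S \<Longrightarrow> A *v x \<in> S"
    and ne: "S \<noteq> {0}"
  shows "\<exists>v\<in>S. \<exists>c. norm v = 1 \<and> A *v v = c *\<^sub>R v"
proof -
  obtain y where y: "y \<in> S" "y \<noteq> 0" using ne S subspace_0 by blast
  let ?K = "S \<inter> sphere 0 1"
  have "compact ?K" using S by (simp add: closed_subspace closed_Int_compact)
  moreover have "(1 / norm y) *\<^sub>R y \<in> ?K" using y S by (simp add: subspace_scale)
  then have "?K \<noteq> {}" by blast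
  moreover have "continuous_on ?K (\<lambda>x. x \<bullet> (A *v x))"
    by (intro continuous_intros linear_continuous_on) (simp add: linear_linear)
  ultimately obtain v where v: "v \<in> ?K" and mx: "\<And>x. x \<in> ?K \<Longrightarrow> x \<bullet> (A *v x) \<le> v \<bullet> (A *v v)"
    using continuous_attains_sup[of ?K "\<lambda>x. x \<bullet> (A *v x)"] by blast
  define c where "c = v \<bullet> (A *v v)"
  have vS: "v \<in> S" and nv: "norm v = 1" using v by auto
  have q: "x \<bullet> (A *v x) \<le> c * (x \<bullet> x)" if "x \<in> S" for x
  proof (cases "x = 0")
    case False
    have "(1 / norm x) *\<^sub>R x \<in> ?K" using that False S by (simp add: subspace_scale)
    from mx[OF this] have "(1 / norm x) * ((1/norm x) * (x \<bullet> (A *v x))) \<le> c"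
      by (simp add: c_def matrix_vector_mult_scaleR)
    then show ?thesis using False
      by (simp add: field_simps dot_square_norm power2_eq_square)
  qed simp
  define w where "w = c *\<^sub>R v - A *v v"
  have wS: "w \<in> S" unfolding w_def using vS inv S by (simp add: subspace_diff subspace_scale)
  define a where "a = c * (w \<bullet> w) - w \<bullet> (A *v w)"
  have vv: "v \<bullet> v = 1" using nv by (simp add: dot_square_norm)
  have quad: "0 \<le> 2 * t * (w \<bullet> w) + t^2 * a" for t
  proof -
    have "v + t *\<^sub>R w \<in> S" using vS wS S by (simp add: subspace_add subspace_scale)
    from q[OF this] have "0 \<le> c * ((v + t *\<^sub>R w) \<bullet> (v + t *\<^sub>R w)) - (v + t *\<^sub>R w) \<bullet> (A *v (v + t *\<^sub>R w))"
      by simp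
    also have "\<dots> = 2 * t * (w \<bullet> (c *\<^sub>R v - A *v v)) + t^2 * a"
      using symmetric_inner_swap[OF sym, of v w] vv
      by (simp add: a_def algebra_simps inner_simps matrix_vector_right_distrib matrix_vector_mult_scaleR
          power2_eq_square c_def[symmetric] inner_commute)
    finally show ?thesis by (simp add: w_def)
  qed
  have "w \<bullet> w = 0"
  proof (rule ccontr)
    assume "w \<bullet> w \<noteq> 0"
    then have pos: "w \<bullet> w > 0" by simp
    \<comment> \<open>a step this short makes the linear term outweigh the quadratic one\<close>
    define m where "m = \<bar>a\<bar> + 1"
    define t where "t = - (w \<bullet> w) / m"
    have m: "m > 0" "a < m" by (auto simp: m_def)
    have "2 * t * (w \<bullet> w) + t^2 * a = ((w \<bullet> w)^2 / m^2) * (a - 2 * m)"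
      using m by (simp add: t_def field_simps power2_eq_square)
    also have "\<dots> < 0" using m pos by (intro mult_pos_neg) auto
    finally show False using quad[of t] by simp
  qed
  then have "A *v v = c *\<^sub>R v" by (simp add: w_def)
  with vS nv show ?thesis by blast
qed

text \<open>
  Split off an eigenvector \<open>v\<close>. Self-adjointness makes the orthogonal complement of \<open>v\<close> in \<open>S\<close> invariant
  again, and its dimension is smaller.
\<close>

lemma symmetric_eigenbasis:
  fixes A :: "real^'n^'n"
  assumes sym: "transpose A = A"
  shows "subspace S \<Longrightarrow> (\<And>x. x \<in> S \<Longrightarrow> A *v x \<in> S) \<Longrightarrow>
    \<exists>B. finite B \<and> pairwise orthogonal B \<and> (\<forall>v\<in>B. norm v = 1 \<and> (\<exists>c. A *v v = c *\<^sub>R v)) \<and> span B = S"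
proof (induction "dim S" arbitrary: S rule: less_induct)
  case less
  show ?case
  proof (cases "S = {0}")
    case True
    then show ?thesis by (intro exI[of _ "{}"]) auto
  next
    case False
    obtain v c where v: "v \<in> S" "norm v = 1" "A *v v = c *\<^sub>R v"
      using symmetric_eigenvector_exists[OF sym less(2,3) False] by blast
    define T where "T = S \<inter> {x. orthogonal v x}"
    have T: "subspace T" unfolding T_def
      by (intro subspace_inter less(2) subspace_orthogonal_to_vector)
    have vv: "v \<bullet> v = 1" using v(2) by (simp add: dot_square_norm)
    have "v \<notin> T" using vv by (auto simp: T_def orthogonal_def)
    then have "T \<subset> S" using v(1) by (auto simp: T_def)
    then have dT: "dim T < dim S" using T less(2) by (metis dim_psubset span_eq_iff)
    have iT: "A *v x \<in> T" if "x \<in> T" for x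
      using that less(3) v(3) symmetric_inner_swap[OF sym, of v x] by (auto simp: T_def orthogonal_def)
    from less(1)[OF dT T iT] obtain B where B: "finite B" "pairwise orthogonal B"
      "\<forall>v\<in>B. norm v = 1 \<and> (\<exists>c. A *v v = c *\<^sub>R v)" "span B = T" by blast
    have BT: "B \<subseteq> T" using B(4) span_superset by blast
    have "pairwise orthogonal (insert v B)"
      using B(2) BT by (intro pairwise_orthogonal_insert) (auto simp: T_def)
    moreover have "span (insert v B) = S"
    proof
      show "span (insert v B) \<subseteq> S"
        using BT v(1) less(2) by (intro span_minimal) (auto simp: T_def)
      show "S \<subseteq> span (insert v B)"
      proof
        fix x assume x: "x \<in> S"
        have "x - (x \<bullet> v) *\<^sub>R v \<in> T"
          using x v(1) less(2) vv by (auto simp: T_def orthogonal_def inner_simps inner_commute subspace_diff subspace_scale)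
        then have "x - (x \<bullet> v) *\<^sub>R v \<in> span B" using B(4) by simp
        then show "x \<in> span (insert v B)" using span_breakdown_eq by blast
      qed
    qed
    ultimately show ?thesis using B v by (intro exI[of _ "insert v B"]) auto
  qed
qed

lemma orthogonal_matrix_inverse:
  assumes "orthogonal_matrix (U::real^'n^'n)"
  shows "U ** transpose U = mat 1" "transpose U ** U = mat 1"
  using assms by (auto simp: orthogonal_matrix_def)

theorem spectral_decomposition:
  fixes A :: "real^'n^'n"
  assumes sym: "transpose A = A"
  obtains U d where "orthogonal_matrix U" "A = U ** diagm d ** transpose U"
proof -
  obtain B where B: "finite B" "pairwise orthogonal B"
      "\<forall>v\<in>B. norm v = 1 \<and> (\<exists>c. A *v v = c *\<^sub>R v)" "span B = UNIV"
    using symmetric_eigenbasis[OF sym, of UNIV] by auto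
  have "0 \<notin> B" using B(3) by auto
  then have "independent B" using B(2) pairwise_orthogonal_independent by blast
  then have "card B = CARD('n)" using B(4) by (metis dim_UNIV DIM_cart DIM_real dim_eq_card dim_span mult.right_neutral)
  then obtain e where e: "bij_betw e (UNIV::'n set) B"
    using B(1) by (metis finite_same_card_bij finite_class.finite_UNIV)
  obtain ev where ev: "\<forall>v\<in>B. A *v v = ev v *\<^sub>R v" using B(3) by metis
  define U :: "real^'n^'n" where "U = (\<chi> i j. e j $ i)"
  define d :: "real^'n" where "d = (\<chi> j. ev (e j))"
  have eB: "e j \<in> B" for j using e by (auto simp: bij_betw_def)
  have inj: "e i = e j \<longleftrightarrow> i = j" for i j using e by (auto simp: bij_betw_def inj_on_def)
  have ee: "e i \<bullet> e j = (if i = j then 1 else 0)" for i j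
    using B(2,3) eB inj by (auto simp: pairwise_def orthogonal_def dot_square_norm)
  have UU: "transpose U ** U = mat 1"
    by (simp add: vec_eq_iff matrix_matrix_mult_def transpose_def U_def mat_def ee[unfolded inner_vec_def inner_real_def])
  then have U: "orthogonal_matrix U" by (simp add: orthogonal_matrix)
  have "A ** U = U ** diagm d"
  proof -
    have "(A ** U) $ i $ j = (U ** diagm d) $ i $ j" for i j
    proof -
      have "(A ** U) $ i $ j = (A *v e j) $ i"
        by (simp add: matrix_matrix_mult_def matrix_vector_mult_def U_def)
      also have "\<dots> = ev (e j) * e j $ i" using ev eB by simp
      also have "\<dots> = (U ** diagm d) $ i $ j"
        by (simp add: matrix_matrix_mult_def U_def diagm_def d_def if_distrib[of "(*) _"] cong: if_cong)
      finally show ?thesis .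
    qed
    then show ?thesis by (simp add: vec_eq_iff)
  qed
  then have "A = U ** diagm d ** transpose U"
    using orthogonal_matrix_inverse[OF U] by (metis matrix_mul_assoc matrix_mul_rid)
  with U show thesis using that by blast
qed

lemma det_diagm: "det (diagm d) = (\<Prod>i\<in>UNIV. d $ i)"
  by (subst det_diagonal) (auto simp: diagm_def)

lemma diagm_mult: "diagm c ** diagm d = diagm (\<chi> i. c $ i * d $ i)"
  by (simp add: vec_eq_iff matrix_matrix_mult_def diagm_def if_distrib[of "\<lambda>x. x * _"] cong: if_cong)

lemma transpose_diagm [simp]: "transpose (diagm d) = diagm d"
  by (auto simp: vec_eq_iff transpose_def diagm_def)

lemma diagm_mult_vec: "diagm d *v x = (\<chi> i. d $ i * x $ i)"
  by (simp add: vec_eq_iff matrix_vector_mult_def diagm_def if_distrib[of "\<lambda>x. x * _"] cong: if_cong)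

lemma det_orthogonal_conj:
  assumes "orthogonal_matrix (U::real^'n^'n)"
  shows "det (U ** A ** transpose U) = det A"
proof -
  have "det U * det U = 1"
    using orthogonal_matrix_inverse(1)[OF assms] by (metis det_I det_mul det_transpose)
  then show ?thesis by (simp add: det_mul algebra_simps)
qed

lemma det_nonzero_mult_vec: "det (A::real^'n^'n) \<noteq> 0 \<Longrightarrow> A *v x = 0 \<Longrightarrow> x = 0"
  using invertible_det_nz[of A] matrix_left_invertible_ker[of A] unfolding invertible_def by blast

lemma det_nonzero_orthogonal: "orthogonal_matrix (U::real^'n^'n) \<Longrightarrow> det U \<noteq> 0"
  using det_orthogonal_matrix by fastforce

lemma transpose_conj_symmetric:
  "transpose S = S \<Longrightarrow> transpose (transpose A ** S ** A) = transpose A ** S ** (A::real^'n^'m)"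
  by (simp add: matrix_transpose_mul matrix_mul_assoc)

lemma inner_conj: "x \<bullet> ((transpose A ** S ** A) *v x) = (A *v x) \<bullet> (S *v (A *v (x::real^'n)))"
  by (metis dot_lmul_matrix matrix_vector_mul_assoc transpose_matrix_vector transpose_transpose)

lemma pos_def_conj:
  assumes "S \<in> pos_def_mats" "\<And>x. A *v x = 0 \<Longrightarrow> x = 0"
  shows "transpose A ** S ** A \<in> pos_def_mats"
  using assms unfolding pos_def_mats_def by (auto simp: transpose_conj_symmetric inner_conj)

lemma mat_1_pos_def: "mat 1 \<in> pos_def_mats"
  by (simp add: pos_def_mats_def transpose_mat)

lemma gram_pos_def:
  assumes "\<And>x. X *v x = 0 \<Longrightarrow> x = 0"
  shows "transpose X ** (X::real^'k^'n) \<in> pos_def_mats"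
  using pos_def_conj[OF mat_1_pos_def assms] by (simp add: matrix_mul_rid)

lemma gram_pos_def_square:
  "det (A::real^'k^'k) \<noteq> 0 \<Longrightarrow> transpose A ** A \<in> pos_def_mats"
  using gram_pos_def det_nonzero_mult_vec by blast

lemma diagm_pos_def: "(\<And>i. 0 < d $ i) \<Longrightarrow> diagm d \<in> pos_def_mats"
proof -
  assume d: "\<And>i. 0 < d $ i"
  have "0 < x \<bullet> (diagm d *v x)" if x0: "x \<noteq> 0" for x
  proof -
    obtain i where i: "x $ i \<noteq> 0" using x0 by (metis vec_eq_iff zero_index)
    have "x \<bullet> (diagm d *v x) = (\<Sum>i\<in>UNIV. d $ i * (x $ i)^2)"
      by (simp add: diagm_mult_vec inner_vec_def power2_eq_square algebra_simps)
    also have "\<dots> > 0"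
      using d i by (intro sum_pos2[of _ i]) (auto simp: less_imp_le)
    finally show ?thesis .
  qed
  then show ?thesis by (simp add: pos_def_mats_def)
qed

lemma pos_def_orthogonal_conj:
  assumes "orthogonal_matrix (U::real^'n^'n)" "S \<in> pos_def_mats"
  shows "U ** S ** transpose U \<in> pos_def_mats"
  using pos_def_conj[OF assms(2), of "transpose U"] det_nonzero_mult_vec[of "transpose U"]
    det_nonzero_orthogonal[OF assms(1)] by simp

lemma pos_def_spectral:
  assumes P: "P \<in> pos_def_mats"
  obtains U d where "orthogonal_matrix (U::real^'n^'n)" "P = U ** diagm d ** transpose U" "\<And>i. 0 < d $ i"
proof -
  have "transpose P = P" using P by (simp add: pos_def_mats_def)
  then obtain U d where U: "orthogonal_matrix U" and Pd: "P = U ** diagm d ** transpose U"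
    using spectral_decomposition by blast
  have "transpose U ** P ** U = transpose U ** U ** diagm d ** (transpose U ** U)"
    by (simp add: Pd matrix_mul_assoc)
  also have "\<dots> = diagm d" using orthogonal_matrix_inverse[OF U] by (simp add: matrix_mul_lid matrix_mul_rid)
  finally have "diagm d \<in> pos_def_mats"
    using pos_def_orthogonal_conj[OF _ P, of "transpose U"] U by simp
  then have pd: "\<And>x. x \<noteq> 0 \<Longrightarrow> 0 < x \<bullet> (diagm d *v x)" by (simp add: pos_def_mats_def)
  have "0 < d $ i" for i
  proof -
    have "axis i 1 \<noteq> (0::real^'n)" by (simp add: axis_eq_0_iff)
    from pd[OF this] show ?thesis
      by (simp add: diagm_mult_vec inner_axis')
  qed
  with U Pd show thesis using that by blast
qed

lemma pos_def_det_pos: "P \<in> pos_def_mats \<Longrightarrow> 0 < det P"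
  by (erule pos_def_spectral) (simp add: det_orthogonal_conj det_diagm prod_pos)

lemma pos_def_sqrt_exists:
  assumes "S \<in> pos_def_mats"
  obtains P where "P \<in> pos_def_mats" "P ** P = (S::real^'n^'n)"
proof -
  obtain U d where U: "orthogonal_matrix U" "S = U ** diagm d ** transpose U" "\<And>i. 0 < d $ i"
    using pos_def_spectral[OF assms] by blast
  define P where "P = U ** diagm (\<chi> i. sqrt (d $ i)) ** transpose U"
  have "P \<in> pos_def_mats"
    unfolding P_def using U(3) by (intro pos_def_orthogonal_conj U(1) diagm_pos_def) simp
  moreover have "P ** P = U ** diagm (\<chi> i. sqrt (d $ i)) ** (transpose U ** U) ** diagm (\<chi> i. sqrt (d $ i)) ** transpose U"
    by (simp add: P_def matrix_mul_assoc)
  then have "P ** P = U ** (diagm (\<chi> i. sqrt (d $ i)) ** diagm (\<chi> i. sqrt (d $ i))) ** transpose U"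
    using orthogonal_matrix_inverse[OF U(1)] by (simp add: matrix_mul_rid matrix_mul_assoc)
  then have "P ** P = S"
    using U(3) by (simp add: diagm_mult U(2) less_imp_le)
  ultimately show thesis using that by blast
qed

lemma matrix_diff_ldistrib: "A ** (B - C) = A ** B - A ** (C::real^'k^'n)"
  by (simp add: vec_eq_iff matrix_matrix_mult_def right_diff_distrib sum_subtractf)

lemma matrix_diff_rdistrib: "(B - C) ** A = B ** A - (C::real^'k^'n) ** A"
  by (simp add: vec_eq_iff matrix_matrix_mult_def left_diff_distrib sum_subtractf)

text \<open>
  From \<open>P\<^sup>2 - R\<^sup>2 = P (P - R) + (P - R) R\<close>, an eigenvector \<open>x\<close> of \<open>P - R\<close> with eigenvalue \<open>t\<close> satisfies
  \<open>0 = t (x \<bullet> P x + x \<bullet> R x)\<close>, hence \<open>t = 0\<close>. A symmetric matrix all of whose eigenvalues vanish is zero.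
\<close>

lemma pos_def_square_inj:
  assumes P: "P \<in> pos_def_mats" and R: "R \<in> pos_def_mats" and eq: "P ** P = R ** (R::real^'n^'n)"
  shows "P = R"
proof -
  have sP: "transpose P = P" and sR: "transpose R = R" using P R by (auto simp: pos_def_mats_def)
  then have "transpose (P - R) = P - R" by (simp add: transpose_def vec_eq_iff)
  then obtain U d where U: "orthogonal_matrix U" "P - R = U ** diagm d ** transpose U"
    using spectral_decomposition by blast
  have "d $ i = 0" for i
  proof -
    define x where "x = U *v axis i 1"
    have "transpose U *v x = axis i 1"
      using orthogonal_matrix_inverse[OF U(1)] by (simp add: x_def matrix_vector_mul_assoc)
    then have "(P - R) *v x = U *v (diagm d *v axis i 1)"
      by (simp add: U(2) flip: matrix_vector_mul_assoc)
    also have "diagm d *v axis i 1 = d $ i *\<^sub>R axis i 1"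
      by (simp add: diagm_mult_vec vec_eq_iff axis_def)
    finally have ev: "(P - R) *v x = d $ i *\<^sub>R x" by (simp add: x_def matrix_vector_mult_scaleR)
    have x0: "x \<noteq> 0"
    proof
      assume "x = 0"
      with \<open>transpose U *v x = axis i 1\<close> show False by (simp add: axis_eq_0_iff)
    qed
    have "0 = x \<bullet> ((P ** P - R ** R) *v x)" using eq by simp
    also have "P ** P - R ** R = P ** (P - R) + (P - R) ** R"
      by (simp add: matrix_diff_ldistrib matrix_diff_rdistrib)
    also have "x \<bullet> (\<dots> *v x) = x \<bullet> (P *v ((P - R) *v x)) + x \<bullet> ((P - R) *v (R *v x))"
      by (simp add: matrix_vector_mult_add_rdistrib inner_simps matrix_vector_mul_assoc)
    also have "\<dots> = d $ i * (x \<bullet> (P *v x)) + ((P - R) *v x) \<bullet> (R *v x)"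
      unfolding ev using symmetric_inner_swap[OF \<open>transpose (P - R) = P - R\<close>, of x "R *v x"] ev
      by (simp add: matrix_vector_mult_scaleR)
    also have "\<dots> = d $ i * (x \<bullet> (P *v x) + x \<bullet> (R *v x))" unfolding ev by (simp add: algebra_simps)
    finally have "d $ i * (x \<bullet> (P *v x) + x \<bullet> (R *v x)) = 0" by simp
    moreover have "x \<bullet> (P *v x) + x \<bullet> (R *v x) > 0" using P R x0 by (intro add_pos_pos) (simp_all add: pos_def_mats_def)
    ultimately show ?thesis by simp
  qed
  then have "diagm d = 0" by (simp add: diagm_def vec_eq_iff)
  then show ?thesis using U(2) by simp
qed

lemma matrix_inverse_exists:
  assumes "det (A::real^'n^'n) \<noteq> 0" obtains B where "A ** B = mat 1" "B ** A = mat 1"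
  using assms invertible_det_nz[of A] by (auto simp: invertible_def)

lemma stiefel_gram: "Q \<in> stiefel \<Longrightarrow> transpose P = P \<Longrightarrow> transpose (Q ** P) ** (Q ** P) = P ** (P::real^'k^'k)"
proof -
  assume Q: "Q \<in> stiefel" and P: "transpose P = P"
  have "transpose (Q ** P) ** (Q ** P) = P ** (transpose Q ** Q) ** P"
    by (simp add: matrix_transpose_mul P matrix_mul_assoc)
  then show ?thesis using Q by (simp add: stiefel_def matrix_mul_rid)
qed

text \<open>
  With \<open>P\<close> the square root of \<open>X\<^sup>T X\<close>, the columns of \<open>X P\<^sup>-\<^sup>1\<close> are orthonormal.
\<close>

lemma polar_decomposition_exists:
  assumes "transpose X ** X \<in> pos_def_mats"
  obtains Q P where "Q \<in> stiefel" "P \<in> pos_def_mats" "X = Q ** (P::real^'k^'k)"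
proof -
  obtain P where P: "P \<in> pos_def_mats" "P ** P = transpose X ** X"
    using pos_def_sqrt_exists[OF assms] by blast
  have "det P \<noteq> 0" using pos_def_det_pos[OF P(1)] by simp
  then obtain R where R: "P ** R = mat 1" "R ** P = mat 1" by (rule matrix_inverse_exists)
  have sP: "transpose P = P" using P by (simp add: pos_def_mats_def)
  have sR: "transpose R ** P = mat 1" using R sP by (metis matrix_transpose_mul transpose_mat)
  have "transpose (X ** R) ** (X ** R) = transpose R ** (transpose X ** X) ** R"
    by (simp add: matrix_transpose_mul matrix_mul_assoc)
  also have "\<dots> = (transpose R ** P) ** (P ** R)" by (simp add: P(2)[symmetric] matrix_mul_assoc)
  also have "\<dots> = mat 1" using R sR by (simp add: matrix_mul_lid)
  finally have "X ** R \<in> stiefel" by (simp add: stiefel_def)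
  moreover have "X = (X ** R) ** P" using R by (simp add: matrix_mul_rid flip: matrix_mul_assoc)
  ultimately show thesis using that P(1) by blast
qed

lemma polar_decomposition_unique:
  assumes "Q \<in> stiefel" "P \<in> pos_def_mats" "Q' \<in> stiefel" "P' \<in> pos_def_mats" "Q ** P = Q' ** (P'::real^'k^'k)"
  shows "Q = Q'" "P = P'"
proof -
  have s: "transpose P = P" "transpose P' = P'" using assms by (auto simp: pos_def_mats_def)
  then have "P ** P = P' ** P'" using stiefel_gram[OF assms(1) s(1)] stiefel_gram[OF assms(3) s(2)] assms(5) by simp
  then show P: "P = P'" using pos_def_square_inj assms by blast
  have "det P \<noteq> 0" using pos_def_det_pos[OF assms(2)] by simp
  then obtain R where R: "P ** R = mat 1" "R ** P = mat 1" by (rule matrix_inverse_exists)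
  have "(Q ** P) ** R = (Q' ** P) ** R" using assms(5) P by simp
  then show "Q = Q'" using R(1) by (simp add: matrix_mul_rid flip: matrix_mul_assoc)
qed

text \<open>
  The polar decomposition followed by a diagonalisation of the positive definite factor. It reduces the
  computation of volume factors to orthogonal and to diagonal matrices.
\<close>

lemma singular_value_decomposition:
  assumes "det (A::real^'n^'n) \<noteq> 0"
  obtains U V d where "orthogonal_matrix U" "orthogonal_matrix V" "A = U ** diagm d ** V"
    "\<And>i. 0 < d $ i" "\<bar>det A\<bar> = (\<Prod>i\<in>UNIV. d $ i)"
proof -
  obtain Q P where QP: "Q \<in> stiefel" "P \<in> pos_def_mats" "A = Q ** P"
    using polar_decomposition_exists gram_pos_def_square[OF assms] by blast
  obtain U d where U: "orthogonal_matrix U" "P = U ** diagm d ** transpose U" "\<And>i. 0 < d $ i"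
    using pos_def_spectral[OF QP(2)] by blast
  have Q: "orthogonal_matrix Q" using QP(1) by (simp add: stiefel_def orthogonal_matrix)
  have dQ: "\<bar>det Q\<bar> = 1" using det_orthogonal_matrix[OF Q] by auto
  show thesis
  proof (rule that)
    show "orthogonal_matrix (Q ** U)" using Q U(1) by (rule orthogonal_matrix_mul)
    show "orthogonal_matrix (transpose U)" using U(1) by simp
    show "A = Q ** U ** diagm d ** transpose U" by (simp add: QP(3) U(2) matrix_mul_assoc)
    show "0 < d $ i" for i by (rule U)
    have "det P = (\<Prod>i\<in>UNIV. d $ i)" by (simp add: U(2) det_orthogonal_conj[OF U(1)] det_diagm)
    then show "\<bar>det A\<bar> = (\<Prod>i\<in>UNIV. d $ i)"
      using dQ pos_def_det_pos[OF QP(2)] by (simp add: QP(3) det_mul abs_mult)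
  qed
qed


section \<open>Measurable inverses\<close>

lemma borel_measurable_eqI:
  assumes "g \<in> borel_measurable M" "\<And>x. f x = g x"
  shows "f \<in> borel_measurable M"
proof -
  have "f = g" using assms(2) by (rule ext)
  then show ?thesis using assms(1) by simp
qed

text \<open>
  The preimage of a closed set \<open>F\<close> under the inverse map is \<open>g ` (C \<inter> F)\<close>, a countable union of compact
  sets. This yields the measurability of matrix inversion, of the polar factors and of the square root
  on the positive definite cone without any formula for them.
\<close>

lemma sigma_compact_inverse_measurable:
  fixes g :: "'a::t2_space \<Rightarrow> 'b::t2_space"
  assumes K: "\<And>i::nat. compact (K i)" "C = (\<Union>i. K i)"
    and cont: "continuous_on C g" and inj: "inj_on g C"
  shows "g ` C \<in> sets borel" (is ?A)
    and "(\<lambda>y. if y \<in> g ` C then the_inv_into C g y else c) \<in> borel_measurable borel" (is "?h \<in> _")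
proof -
  have img: "g ` (C \<inter> F) \<in> sets borel" if "closed F" for F
  proof -
    have "compact (g ` (K i \<inter> F))" for i
      using K cont that by (intro compact_continuous_image compact_Int_closed) (auto intro: continuous_on_subset)
    then have "(\<Union>i. g ` (K i \<inter> F)) \<in> sets borel"
      by (intro sets.countable_UN) (auto intro!: borel_closed compact_imp_closed)
    moreover have "g ` (C \<inter> F) = (\<Union>i. g ` (K i \<inter> F))" using K(2) by auto
    ultimately show ?thesis by simp
  qed
  show A: ?A using img[of UNIV] by simp
  show "?h \<in> borel_measurable borel"
  proof (rule borel_measurableI)
    fix S :: "'a set" assume "open S"
    then have 1: "g ` (C \<inter> - S) \<in> sets borel" by (intro img) auto
    have "?h -` S \<inter> space borel = (g ` C - g ` (C \<inter> - S)) \<union> (if c \<in> S then - g ` C else {})"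
      using inj by (auto simp: the_inv_into_f_f split: if_splits)
    also have "\<dots> \<in> sets borel" using A 1 by auto
    finally show "?h -` S \<inter> space borel \<in> sets borel" .
  qed
qed

lemma continuous_on_matrix_mult [continuous_intros]:
  fixes f :: "'a::topological_space \<Rightarrow> real^'k^'n" and g :: "'a \<Rightarrow> real^'m^'k"
  assumes "continuous_on S f" "continuous_on S g"
  shows "continuous_on S (\<lambda>x. f x ** g x)"
  unfolding matrix_matrix_mult_def by (intro continuous_intros assms)

lemma continuous_on_transpose [continuous_intros]:
  fixes f :: "'a::topological_space \<Rightarrow> real^'k^'n"
  assumes "continuous_on S f"
  shows "continuous_on S (\<lambda>x. transpose (f x))"
  unfolding transpose_def by (intro continuous_intros assms)

lemma continuous_on_det [continuous_intros]:
  fixes f :: "'a::topological_space \<Rightarrow> real^'n^'n"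
  assumes "continuous_on S f"
  shows "continuous_on S (\<lambda>x. det (f x))"
  unfolding det_def by (intro continuous_intros assms)

lemma continuous_on_matrix_vector_mult [continuous_intros]:
  fixes f :: "'a::topological_space \<Rightarrow> real^'k^'n"
  assumes "continuous_on S f" "continuous_on S g"
  shows "continuous_on S (\<lambda>x. f x *v g x)"
  unfolding matrix_vector_mult_def by (intro continuous_intros assms)

lemma measurable_matrix_mult [measurable]:
  fixes f :: "'a \<Rightarrow> real^'k^'n" and g :: "'a \<Rightarrow> real^'m^'k"
  assumes [measurable]: "f \<in> borel_measurable M" "g \<in> borel_measurable M"
  shows "(\<lambda>x. f x ** g x) \<in> borel_measurable M"
  by (rule borel_measurable_continuous_Pair[OF assms]) (auto intro!: continuous_intros continuous_on_fst continuous_on_snd)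

lemma measurable_transpose [measurable]:
  fixes f :: "'a \<Rightarrow> real^'k^'n"
  assumes [measurable]: "f \<in> borel_measurable M"
  shows "(\<lambda>x. transpose (f x)) \<in> borel_measurable M"
  by (rule measurable_compose[OF assms]) (auto intro!: borel_measurable_continuous_onI continuous_intros)

lemma measurable_det [measurable]:
  fixes f :: "'a \<Rightarrow> real^'n^'n"
  assumes [measurable]: "f \<in> borel_measurable M"
  shows "(\<lambda>x. det (f x)) \<in> borel_measurable M"
  by (rule measurable_compose[OF assms]) (auto intro!: borel_measurable_continuous_onI continuous_intros)

text \<open>
  The value at singular matrices is fixed so that inversion becomes a Borel function on the whole space.
\<close>

definition matrix_inverse :: "real^'n^'n \<Rightarrow> real^'n^'n" where
  "matrix_inverse A = (if det A \<noteq> 0 then THE B. A ** B = mat 1 else 0)"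

lemma right_inverse_unique: "A ** B = mat 1 \<Longrightarrow> A ** C = mat 1 \<Longrightarrow> B = (C::real^'n^'n)"
proof -
  assume B: "A ** B = mat 1" and C: "A ** C = mat 1"
  have "B ** (A ** C) = (B ** A) ** C" by (rule matrix_mul_assoc)
  then show "B = C" using B C matrix_left_right_inverse[of A B] by (simp add: matrix_mul_rid matrix_mul_lid)
qed

lemma matrix_inverse:
  assumes "det A \<noteq> 0"
  shows "A ** matrix_inverse A = mat 1" "matrix_inverse A ** A = mat 1"
proof -
  obtain B where B: "A ** B = mat 1" using matrix_inverse_exists[OF assms] by blast
  then have "matrix_inverse A = B" unfolding matrix_inverse_def using assms right_inverse_unique by auto
  with B show "A ** matrix_inverse A = mat 1" "matrix_inverse A ** A = mat 1"
    using matrix_left_right_inverse by auto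
qed

lemma closed_sigma_compact:
  fixes C :: "'a::euclidean_space set"
  assumes "closed C" shows "compact (C \<inter> cball 0 (real i))" "C = (\<Union>i::nat. C \<inter> cball 0 (real i))"
  using assms by (auto simp: closed_Int_compact dist_norm real_arch_simple)

lemma measurable_matrix_inverse [measurable]:
  "(matrix_inverse :: real^'n^'n \<Rightarrow> _) \<in> borel_measurable borel"
proof -
  define C where "C = {(A :: real^'n^'n, B). A ** B = (mat 1 :: real^'n^'n)}"
  have "closed C" unfolding C_def split_def
    by (intro closed_Collect_eq continuous_intros continuous_on_fst continuous_on_snd continuous_on_id)
  note K = closed_sigma_compact[OF this]
  have inj: "inj_on fst C" unfolding inj_on_def C_def using right_inverse_unique by auto
  have img: "fst ` C = {A. det A \<noteq> 0}"
  proof safe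
    fix A B assume "(A, B) \<in> C" then have "A ** B = mat 1" by (simp add: C_def)
    then have "det A * det B = 1" by (metis det_I det_mul)
    then show "det (fst (A, B)) = 0 \<Longrightarrow> False" by auto
  next
    fix A :: "real^'n^'n" assume "det A \<noteq> 0"
    then obtain B where "A ** B = mat 1" by (rule matrix_inverse_exists)
    then have "(A, B) \<in> C" by (simp add: C_def)
    then show "A \<in> fst ` C" by force
  qed
  have 1: "(\<lambda>y. if y \<in> fst ` C then the_inv_into C fst y else (0,0)) \<in> borel_measurable borel"
    by (rule sigma_compact_inverse_measurable(2)[OF K continuous_on_fst[OF continuous_on_id] inj])
  have eq: "matrix_inverse A = snd (if A \<in> fst ` C then the_inv_into C fst A else (0,0))" for A
  proof (cases "det A = 0")
    case False
    have "(A, matrix_inverse A) \<in> C" using matrix_inverse[OF False] by (simp add: C_def)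
    then have "the_inv_into C fst A = (A, matrix_inverse A)" using the_inv_into_f_f[OF inj] by fastforce
    then show ?thesis using False by (simp add: img)
  qed (simp add: img, simp add: matrix_inverse_def)
  have 2: "(\<lambda>y. snd (if y \<in> fst ` C then the_inv_into C fst y else (0,0))) \<in> borel_measurable borel"
    by (rule measurable_compose[OF 1]) (auto intro!: borel_measurable_continuous_onI continuous_intros)
  show ?thesis by (rule borel_measurable_eqI[OF 2 eq])
qed

lemma pos_def_lower_bound:
  assumes "P \<in> pos_def_mats"
  obtains e where "0 < e" "\<And>x. e * (x \<bullet> x) \<le> x \<bullet> (P *v (x::real^'n))"
proof -
  have "continuous_on (sphere 0 1) (\<lambda>x::real^'n. x \<bullet> (P *v x))" by (intro continuous_intros)
  moreover have "axis (undefined::'n) (1::real) \<in> sphere 0 1" by simp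
  ultimately obtain v where v: "v \<in> sphere 0 1" and mn: "\<And>x. x \<in> sphere 0 1 \<Longrightarrow> v \<bullet> (P *v v) \<le> x \<bullet> (P *v x)"
    using continuous_attains_inf[of "sphere 0 1" "\<lambda>x::real^'n. x \<bullet> (P *v x)"] by (metis compact_sphere empty_iff)
  show thesis
  proof (rule that)
    have "v \<noteq> 0" using v by auto
    then show "0 < v \<bullet> (P *v v)" using assms by (simp add: pos_def_mats_def)
    fix x :: "real^'n"
    show "v \<bullet> (P *v v) * (x \<bullet> x) \<le> x \<bullet> (P *v x)"
    proof (cases "x = 0")
      case False
      then have "(1 / norm x) *\<^sub>R x \<in> sphere 0 1" by simp
      from mn[OF this] False show ?thesis
        by (simp add: field_simps dot_square_norm power2_eq_square matrix_vector_mult_scaleR)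
    qed simp
  qed
qed

text \<open>
  Compact pieces that exhaust the positive definite cone: the index bounds the norm from above and the
  smallest eigenvalue from below.
\<close>

definition pos_def_piece :: "nat \<Rightarrow> (real^'n^'n) set" where
  "pos_def_piece m = {P. transpose P = P \<and> (\<forall>x. (x \<bullet> x) / (m + 1) \<le> x \<bullet> (P *v x))} \<inter> cball 0 m"

lemma pos_def_sigma_compact:
  "compact (pos_def_piece m :: (real^'n^'n) set)" "(pos_def_mats :: (real^'n^'n) set) = (\<Union>m. pos_def_piece m)"
proof -
  have "closed {P::real^'n^'n. transpose P = P \<and> (\<forall>x. (x \<bullet> x) / (real m + 1) \<le> x \<bullet> (P *v x))}"
    by (intro closed_Collect_conj closed_Collect_all closed_Collect_le closed_Collect_eq continuous_intros)
  then show "compact (pos_def_piece m :: (real^'n^'n) set)" unfolding pos_def_piece_def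
    by (intro closed_Int_compact) (auto simp: add.commute)
  show "(pos_def_mats :: (real^'n^'n) set) = (\<Union>m. pos_def_piece m)"
  proof safe
    fix P :: "real^'n^'n" assume P: "P \<in> pos_def_mats"
    then obtain e where e: "0 < e" "\<And>x. e * (x \<bullet> x) \<le> x \<bullet> (P *v x)" by (rule pos_def_lower_bound) auto
    obtain m :: nat where m: "max (1 / e) (norm P) < m" using reals_Archimedean2 by blast
    have "1 / (real m + 1) \<le> e" using m e(1) by (simp add: field_simps)
    then have "(x \<bullet> x) / (real m + 1) \<le> x \<bullet> (P *v x)" for x
      using e(2)[of x] mult_right_mono[of "1 / (real m + 1)" e "x \<bullet> x"] by simp
    then have "P \<in> pos_def_piece m" using P m by (simp add: pos_def_piece_def pos_def_mats_def add.commute)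
    then show "P \<in> (\<Union>m. pos_def_piece m)" by blast
  next
    fix P :: "real^'n^'n" and m assume P: "P \<in> pos_def_piece m"
    have "0 < x \<bullet> (P *v x)" if "x \<noteq> 0" for x
    proof -
      have "0 < (x \<bullet> x) / (real m + 1)" using that by simp
      also have "\<dots> \<le> x \<bullet> (P *v x)" using P by (simp add: pos_def_piece_def add.commute)
      finally show ?thesis .
    qed
    then show "P \<in> pos_def_mats" using P by (simp add: pos_def_piece_def pos_def_mats_def)
  qed
qed

lemma closed_stiefel: "closed (stiefel :: (real^'k^'n) set)"
  unfolding stiefel_def by (intro closed_Collect_eq continuous_intros)

lemma norm_matrix_sq: "(norm (X::real^'k^'n))\<^sup>2 = trace (transpose X ** X)"
  unfolding power2_norm_eq_inner inner_vec_def inner_real_def trace_def matrix_matrix_mult_def transpose_def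
  by simp (rule sum.swap)

lemma norm_transpose: "norm (transpose X) = norm (X::real^'k^'n)"
  unfolding norm_eq_sqrt_inner inner_vec_def inner_real_def transpose_def
  by simp (rule sum.swap)

lemma stiefel_gram': "Q \<in> stiefel \<Longrightarrow> transpose (Q ** X) ** (Q ** X) = transpose X ** (X::real^'m^'k)"
proof -
  assume Q: "Q \<in> stiefel"
  have "transpose (Q ** X) ** (Q ** X) = transpose X ** (transpose Q ** Q) ** X"
    by (simp add: matrix_transpose_mul matrix_mul_assoc)
  then show ?thesis using Q by (simp add: stiefel_def matrix_mul_rid)
qed

lemma norm_stiefel_mult: "Q \<in> stiefel \<Longrightarrow> norm (Q ** X) = norm (X::real^'m^'k)"
proof -
  assume "Q \<in> stiefel"
  then have "transpose (Q ** X) ** (Q ** X) = transpose X ** X"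
    by (rule stiefel_gram')
  then show ?thesis by (metis norm_matrix_sq norm_ge_zero power2_eq_imp_eq)
qed

lemma orthogonal_matrix_stiefel: "orthogonal_matrix U \<longleftrightarrow> U \<in> stiefel"
  by (simp add: orthogonal_matrix stiefel_def)

lemma norm_orthogonal_mult_left: "orthogonal_matrix U \<Longrightarrow> norm (U ** X) = norm (X::real^'m^'k)"
  by (simp add: orthogonal_matrix_stiefel norm_stiefel_mult)

lemma norm_orthogonal_mult_right: "orthogonal_matrix U \<Longrightarrow> norm (X ** U) = norm (X::real^'m^'k)"
  using norm_orthogonal_mult_left[of "transpose U" "transpose X"] norm_transpose[of "X ** U"]
  by (simp add: matrix_transpose_mul norm_transpose)

lemma bounded_stiefel: "bounded (stiefel :: (real^'k^'n) set)"
proof -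
  have "norm Q = norm (mat 1 :: real^'k^'k)" if "Q \<in> stiefel" for Q :: "real^'k^'n"
    using norm_stiefel_mult[OF that, of "mat 1"] by (simp add: matrix_mul_rid)
  then show ?thesis by (metis boundedI order_refl)
qed

lemma compact_stiefel: "compact (stiefel :: (real^'k^'n) set)"
  using closed_stiefel bounded_stiefel compact_eq_bounded_closed by blast

lemma pos_def_borel [measurable]: "(pos_def_mats :: (real^'n^'n) set) \<in> sets borel"
  unfolding pos_def_sigma_compact(2)
  by (intro sets.countable_UN) (auto intro!: borel_closed compact_imp_closed pos_def_sigma_compact(1))

definition full_rank_mats :: "(real^'k^'n) set" where
  "full_rank_mats = {X. transpose X ** X \<in> pos_def_mats}"

lemma full_rank_borel [measurable]: "(full_rank_mats :: (real^'k^'n) set) \<in> sets borel"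
proof -
  have "{X \<in> space borel. transpose X ** X \<in> (pos_def_mats :: (real^'k^'k) set)} \<in> sets borel" by measurable
  then show ?thesis by (simp add: full_rank_mats_def)
qed

definition polar_pair :: "real^'k^'n \<Rightarrow> (real^'k^'n) \<times> (real^'k^'k)" where
  "polar_pair X = (if X \<in> full_rank_mats then THE (Q, P). Q \<in> stiefel \<and> P \<in> pos_def_mats \<and> Q ** P = X else (0, 0))"

lemma polar_in_full_rank:
  "Q \<in> stiefel \<Longrightarrow> P \<in> pos_def_mats \<Longrightarrow> Q ** P \<in> full_rank_mats"
proof -
  assume Q: "Q \<in> stiefel" and P: "P \<in> pos_def_mats"
  then have s: "transpose P = P" by (simp add: pos_def_mats_def)
  have "det P \<noteq> 0" using pos_def_det_pos[OF P] by simp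
  then have "transpose P ** P \<in> pos_def_mats" by (rule gram_pos_def_square)
  then show ?thesis using stiefel_gram[OF Q s] s by (simp add: full_rank_mats_def)
qed

lemma polar_pair_eq:
  assumes "Q \<in> stiefel" "P \<in> pos_def_mats"
  shows "polar_pair (Q ** P) = (Q, P)"
proof -
  have "(THE (Q', P'). Q' \<in> stiefel \<and> P' \<in> pos_def_mats \<and> Q' ** P' = Q ** P) = (Q, P)"
    by (rule the_equality) (use assms polar_decomposition_unique[OF _ _ assms] in \<open>auto split: prod.splits\<close>)
  then show ?thesis using polar_in_full_rank[OF assms] by (simp add: polar_pair_def)
qed

lemma polar_pair:
  assumes "X \<in> full_rank_mats"
  shows "fst (polar_pair X) \<in> stiefel" "snd (polar_pair X) \<in> pos_def_mats"
    "fst (polar_pair X) ** snd (polar_pair X) = X"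
proof -
  obtain Q P where "Q \<in> stiefel" "P \<in> pos_def_mats" "X = Q ** P"
    using polar_decomposition_exists assms by (auto simp: full_rank_mats_def)
  then show "fst (polar_pair X) \<in> stiefel" "snd (polar_pair X) \<in> pos_def_mats"
    "fst (polar_pair X) ** snd (polar_pair X) = X" by (auto simp: polar_pair_eq)
qed

lemma polar_pair_measurable [measurable]:
  "(polar_pair :: real^'k^'n \<Rightarrow> _) \<in> borel_measurable borel"
proof -
  let ?C = "(stiefel :: (real^'k^'n) set) \<times> (pos_def_mats :: (real^'k^'k) set)"
  let ?g = "\<lambda>(Q::real^'k^'n, P::real^'k^'k). Q ** P"
  let ?K = "\<lambda>m. (stiefel :: (real^'k^'n) set) \<times> (pos_def_piece m :: (real^'k^'k) set)"
  have K: "compact (?K m)" for m by (intro compact_Times compact_stiefel pos_def_sigma_compact)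
  have C: "?C = (\<Union>m. ?K m)" by (auto simp: pos_def_sigma_compact(2))
  have cont: "continuous_on ?C ?g" unfolding split_def
    by (intro continuous_intros continuous_on_fst continuous_on_snd continuous_on_id)
  have inj: "inj_on ?g ?C" by (auto simp: inj_on_def dest: polar_decomposition_unique)
  have img: "?g ` ?C = full_rank_mats"
    using polar_in_full_rank by (auto simp: image_iff) (metis polar_pair)
  have eq: "polar_pair X = (if X \<in> ?g ` ?C then the_inv_into ?C ?g X else (0,0))" for X
  proof (cases "X \<in> full_rank_mats")
    case True
    have "the_inv_into ?C ?g (?g (polar_pair X)) = polar_pair X"
      by (rule the_inv_into_f_f[OF inj]) (use polar_pair[OF True] in \<open>auto simp: mem_Times_iff\<close>)
    then show ?thesis using True polar_pair[OF True] by (simp only: img) (simp add: split_def)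
  qed (simp only: img, simp add: polar_pair_def)
  have 2: "(\<lambda>X. if X \<in> ?g ` ?C then the_inv_into ?C ?g X else (0,0)) \<in> borel_measurable borel"
    by (rule sigma_compact_inverse_measurable(2)[OF K C cont inj])
  show ?thesis by (rule borel_measurable_eqI[OF 2 eq])
qed

definition pos_def_sqrt :: "real^'n^'n \<Rightarrow> real^'n^'n" where
  "pos_def_sqrt S = (if S \<in> pos_def_mats then THE P. P \<in> pos_def_mats \<and> P ** P = S else 0)"

lemma pos_def_square: "P \<in> pos_def_mats \<Longrightarrow> P ** P \<in> pos_def_mats"
  using gram_pos_def_square[of P] pos_def_det_pos[of P] by (simp add: pos_def_mats_def)

lemma pos_def_sqrt_eq:
  assumes "P \<in> pos_def_mats"
  shows "pos_def_sqrt (P ** P) = P"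
proof -
  have "(THE P'. P' \<in> pos_def_mats \<and> P' ** P' = P ** P) = P"
    by (rule the_equality) (use assms pos_def_square_inj[OF _ assms] in auto)
  then show ?thesis using pos_def_square[OF assms] by (simp add: pos_def_sqrt_def)
qed

lemma pos_def_sqrt:
  assumes "S \<in> pos_def_mats"
  shows "pos_def_sqrt S \<in> pos_def_mats" "pos_def_sqrt S ** pos_def_sqrt S = S"
proof -
  obtain P where "P \<in> pos_def_mats" "P ** P = S" using pos_def_sqrt_exists[OF assms] by blast
  then show "pos_def_sqrt S \<in> pos_def_mats" "pos_def_sqrt S ** pos_def_sqrt S = S"
    by (auto simp: pos_def_sqrt_eq)
qed

lemma pos_def_sqrt_measurable [measurable]: "(pos_def_sqrt :: real^'n^'n \<Rightarrow> _) \<in> borel_measurable borel"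
proof -
  let ?g = "\<lambda>P::real^'n^'n. P ** P"
  have cont: "continuous_on pos_def_mats ?g" by (intro continuous_intros)
  have inj: "inj_on ?g pos_def_mats" by (auto simp: inj_on_def dest: pos_def_square_inj)
  have img: "?g ` pos_def_mats = pos_def_mats"
    using pos_def_square by (auto simp: image_iff) (metis pos_def_sqrt)
  have eq: "pos_def_sqrt S = (if S \<in> ?g ` pos_def_mats then the_inv_into pos_def_mats ?g S else 0)" for S
  proof (cases "S \<in> pos_def_mats")
    case True
    have "the_inv_into pos_def_mats ?g (?g (pos_def_sqrt S)) = pos_def_sqrt S"
      by (rule the_inv_into_f_f[OF inj]) (rule pos_def_sqrt(1)[OF True])
    then show ?thesis using True by (simp add: img pos_def_sqrt(2))
  qed (simp only: img, simp add: pos_def_sqrt_def)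
  have 2: "(\<lambda>S. if S \<in> ?g ` pos_def_mats then the_inv_into pos_def_mats ?g S else 0) \<in> borel_measurable borel"
    by (rule sigma_compact_inverse_measurable(2)[OF pos_def_sigma_compact cont inj])
  show ?thesis by (rule borel_measurable_eqI[OF 2 eq])
qed

section \<open>Invariant integrals and volume scaling\<close>

text \<open>
  The uniqueness argument for invariant measures on a homogeneous space. The function
  \<open>f (T a s) * h s\<close> is integrated in both orders: integration over \<open>a\<close> first turns the factor \<open>f\<close> into a
  constant, and if invariance has moved the action to \<open>h\<close>, integration over \<open>a\<close> turns \<open>h\<close> into a constant.
  Here \<open>T' a\<close> acts as the inverse of \<open>T a\<close>. Two invariant measures \<open>M\<close> give the same ratio of the integrals
  of \<open>f\<close> and \<open>h\<close>, since \<open>cf\<close> and \<open>ch\<close> depend on the group side only.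
\<close>

lemma invariant_integrals_proportional:
  fixes f h :: "'s \<Rightarrow> ennreal" and T T' :: "'g \<Rightarrow> 's \<Rightarrow> 's"
  assumes sf: "sigma_finite_measure G" "sigma_finite_measure M"
    and meas: "f \<in> borel_measurable M" "h \<in> borel_measurable M"
      "(\<lambda>(a, s). f (T a s)) \<in> borel_measurable (G \<Otimes>\<^sub>M M)"
      "(\<lambda>(a, s). h (T' a s)) \<in> borel_measurable (G \<Otimes>\<^sub>M M)"
    and inv: "AE a in G. (\<integral>\<^sup>+s. f (T a s) * h s \<partial>M) = (\<integral>\<^sup>+s. f s * h (T' a s) \<partial>M)"
    and f: "AE s in M. (\<integral>\<^sup>+a. f (T a s) \<partial>G) = cf"
    and h: "AE s in M. (\<integral>\<^sup>+a. h (T' a s) \<partial>G) = ch"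
  shows "cf * (\<integral>\<^sup>+s. h s \<partial>M) = ch * (\<integral>\<^sup>+s. f s \<partial>M)"
proof -
  interpret pair_sigma_finite G M using sf by (simp add: pair_sigma_finite_def)
  note [measurable] = meas
  have m1: "(\<lambda>a. f (T a s)) \<in> borel_measurable G" if "s \<in> space M" for s
    using measurable_compose[OF measurable_Pair2'[OF that] meas(3)] by simp
  have m2: "(\<lambda>a. h (T' a s)) \<in> borel_measurable G" if "s \<in> space M" for s
    using measurable_compose[OF measurable_Pair2'[OF that] meas(4)] by simp
  have m3: "(\<lambda>(a, s). f (T a s) * h s) \<in> borel_measurable (G \<Otimes>\<^sub>M M)"
    using meas(3) by (simp add: split_def)
  have m4: "(\<lambda>(a, s). f s * h (T' a s)) \<in> borel_measurable (G \<Otimes>\<^sub>M M)"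
    using meas(4) by (simp add: split_def)
  have "cf * (\<integral>\<^sup>+s. h s \<partial>M) = (\<integral>\<^sup>+s. cf * h s \<partial>M)" by (simp add: nn_integral_cmult)
  also have "\<dots> = (\<integral>\<^sup>+s. (\<integral>\<^sup>+a. f (T a s) * h s \<partial>G) \<partial>M)"
    using f by (intro nn_integral_cong_AE) (auto elim!: eventually_mono simp: nn_integral_multc m1 AE_space
        dest: eventually_conj[OF AE_space])
  also have "\<dots> = (\<integral>\<^sup>+a. (\<integral>\<^sup>+s. f (T a s) * h s \<partial>M) \<partial>G)"
    by (rule Fubini') (rule m3)
  also have "\<dots> = (\<integral>\<^sup>+a. (\<integral>\<^sup>+s. f s * h (T' a s) \<partial>M) \<partial>G)"
    by (rule nn_integral_cong_AE[OF inv])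
  also have "\<dots> = (\<integral>\<^sup>+s. (\<integral>\<^sup>+a. f s * h (T' a s) \<partial>G) \<partial>M)"
    by (rule Fubini'[symmetric]) (rule m4)
  also have "\<dots> = (\<integral>\<^sup>+s. f s * ch \<partial>M)"
    using h by (intro nn_integral_cong_AE) (auto elim!: eventually_mono simp: nn_integral_cmult m2
        dest: eventually_conj[OF AE_space])
  also have "\<dots> = ch * (\<integral>\<^sup>+s. f s \<partial>M)" by (subst nn_integral_multc) (auto simp: mult.commute)
  finally show ?thesis .
qed

text \<open>
  For a linear bijection \<open>L\<close> of a Euclidean space, \<open>c\<close> is \<open>\<bar>det L\<bar>\<close>. As an identity of integrals the notion
  composes well and also covers maps of symmetric matrices, for which no determinant is at hand.
\<close>

definition scales :: "'a measure \<Rightarrow> ('a \<Rightarrow> 'a) \<Rightarrow> real \<Rightarrow> bool" where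
  "scales M L c \<longleftrightarrow> L \<in> M \<rightarrow>\<^sub>M M \<and> 0 < c \<and>
     (\<forall>h\<in>borel_measurable M. ennreal c * (\<integral>\<^sup>+x. h (L x) \<partial>M) = (\<integral>\<^sup>+x. h x \<partial>M))"

lemma scalesD:
  assumes "scales M L c"
  shows "L \<in> M \<rightarrow>\<^sub>M M" "0 < c"
    "h \<in> borel_measurable M \<Longrightarrow> ennreal c * (\<integral>\<^sup>+x. h (L x) \<partial>M) = (\<integral>\<^sup>+x. h x \<partial>M)"
  using assms by (auto simp: scales_def)

lemma scales_compose:
  assumes L: "scales M L c" and K: "scales M K d"
  shows "scales M (\<lambda>x. L (K x)) (c * d)"
  unfolding scales_def
proof (intro conjI ballI)
  show "(\<lambda>x. L (K x)) \<in> M \<rightarrow>\<^sub>M M" using scalesD(1)[OF L] scalesD(1)[OF K] by measurable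
  show "0 < c * d" using scalesD(2)[OF L] scalesD(2)[OF K] by simp
  fix h :: "'a \<Rightarrow> ennreal" assume h: "h \<in> borel_measurable M"
  then have hL: "(\<lambda>x. h (L x)) \<in> borel_measurable M" using scalesD(1)[OF L] by measurable
  show "ennreal (c * d) * (\<integral>\<^sup>+x. h (L (K x)) \<partial>M) = (\<integral>\<^sup>+x. h x \<partial>M)"
    using scalesD(3)[OF L h] scalesD(3)[OF K hL] scalesD(2)[OF L]
    by (simp add: ennreal_mult' mult.assoc)
qed

lemma ennreal_mult_cancel_right_pos:
  fixes x :: ennreal assumes "x * e = e" "e \<noteq> 0" "e \<noteq> \<top>" shows "x = 1"
  using assms ennreal_mult_cancel_left[of e x 1] by (simp add: mult.commute)

lemma scales_invariant_set:
  assumes L: "scales M L c" and E: "E \<in> sets M" "emeasure M E \<noteq> 0" "emeasure M E \<noteq> \<infinity>"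
    and inv: "\<And>x. x \<in> space M \<Longrightarrow> L x \<in> E \<longleftrightarrow> x \<in> E"
  shows "c = 1"
proof -
  have "ennreal c * (\<integral>\<^sup>+x. indicator E (L x) \<partial>M) = (\<integral>\<^sup>+x. indicator E x \<partial>M)"
    using E by (intro scalesD(3)[OF L]) auto
  moreover have "(\<integral>\<^sup>+x. indicator E (L x) \<partial>M) = (\<integral>\<^sup>+x. indicator E x \<partial>M)"
    using inv by (intro nn_integral_cong) (simp add: indicator_def)
  ultimately have "ennreal c * emeasure M E = emeasure M E" using E by simp
  then have "ennreal c = 1" using E by (intro ennreal_mult_cancel_right_pos) auto
  then show ?thesis by simp
qed

lemma nn_integral_lborel_shift:
  fixes h :: "'a::euclidean_space \<Rightarrow> ennreal"
  assumes [measurable]: "h \<in> borel_measurable borel"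
  shows "(\<integral>\<^sup>+x. h (x + a) \<partial>lborel) = (\<integral>\<^sup>+x. h x \<partial>lborel)"
proof -
  have "(\<integral>\<^sup>+x. h x \<partial>lborel) = (\<integral>\<^sup>+x. h x \<partial>distr lborel borel ((+) a))"
    by (simp add: lborel_distr_plus)
  also have "\<dots> = (\<integral>\<^sup>+x. h (x + a) \<partial>lborel)"
    by (subst nn_integral_distr) (auto simp: add.commute)
  finally show ?thesis ..
qed

lemma nn_integral_lborel_reflect:
  fixes h :: "'a::euclidean_space \<Rightarrow> ennreal"
  assumes [measurable]: "h \<in> borel_measurable borel"
  shows "(\<integral>\<^sup>+x. h (a - x) \<partial>lborel) = (\<integral>\<^sup>+x. h x \<partial>lborel)"
proof -
  have "lborel = distr lborel borel (\<lambda>x::'a. 0 + (-1) *\<^sub>R x)"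
    by (subst lborel_affine[of "-1" 0]) (simp_all add: density_1)
  then have "(\<integral>\<^sup>+x. h (a + x) \<partial>lborel) = (\<integral>\<^sup>+x. h (a + x) \<partial>distr lborel borel (\<lambda>x::'a. 0 + (-1) *\<^sub>R x))"
    by simp
  also have "\<dots> = (\<integral>\<^sup>+x. h (a - x) \<partial>lborel)"
    by (subst nn_integral_distr) auto
  finally show ?thesis using nn_integral_lborel_shift[OF assms, of a] by (simp add: add.commute)
qed

lemma emeasure_lborel_open_pos:
  fixes S :: "'a::euclidean_space set"
  assumes "open S" "S \<noteq> {}" shows "emeasure lborel S \<noteq> 0"
proof
  assume "emeasure lborel S = 0"
  then have "S \<in> null_sets lborel" using assms by auto
  then have "negligible S" by (simp add: negligible_iff_null_sets null_sets_completionI)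
  then show False using open_not_negligible assms by blast
qed

text \<open>
  Both \<open>h \<mapsto> \<integral>h(x) dx\<close> and \<open>h \<mapsto> \<integral>h(L x) dx\<close> are invariant under translations, hence
  proportional; the translation of \<open>L x\<close> by \<open>a\<close> is the translation of \<open>x\<close> by \<open>K a\<close>, where \<open>K\<close> is the inverse of
  \<open>L\<close>. The unit ball and its preimage determine the constant.
\<close>

lemma scales_linear_exists:
  fixes L :: "'a::euclidean_space \<Rightarrow> 'a"
  assumes lin: "linear L" and inj: "inj L"
  obtains c where "scales lborel L c"
proof -
  obtain K where K: "linear K" "\<And>x. L (K x) = x" "\<And>x. K (L x) = x"
    using linear_injective_isomorphism[OF lin inj] by blast
  have [measurable]: "L \<in> borel_measurable borel" "K \<in> borel_measurable borel"
    using lin K(1) by (auto intro!: borel_measurable_continuous_onI linear_continuous_on simp: linear_linear)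
  have LK: "L (x + K a) = L x + a" "L (x - K a) = L x - a" for x a
    using lin K(2) by (simp_all add: linear_add linear_diff)
  have main: "(\<integral>\<^sup>+a. f a \<partial>lborel) * (\<integral>\<^sup>+x. h (L x) \<partial>lborel) = (\<integral>\<^sup>+a. h a \<partial>lborel) * (\<integral>\<^sup>+x. f (L x) \<partial>lborel)"
    if [measurable]: "f \<in> borel_measurable borel" "h \<in> borel_measurable borel" for f h :: "'a \<Rightarrow> ennreal"
  proof (rule invariant_integrals_proportional[where T="\<lambda>a x. x + K a" and T'="\<lambda>a x. x - K a" and G=lborel])
    show "AE a in lborel. (\<integral>\<^sup>+s. f (L (s + K a)) * h (L s) \<partial>lborel) = (\<integral>\<^sup>+s. f (L s) * h (L (s - K a)) \<partial>lborel)"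
    proof (rule AE_I2)
      fix a
      show "(\<integral>\<^sup>+s. f (L (s + K a)) * h (L s) \<partial>lborel) = (\<integral>\<^sup>+s. f (L s) * h (L (s - K a)) \<partial>lborel)"
        using nn_integral_lborel_shift[of "\<lambda>s. f (L s) * h (L (s - K a))" "K a"] by simp
    qed
    show "AE s in lborel. (\<integral>\<^sup>+a. f (L (s + K a)) \<partial>lborel) = (\<integral>\<^sup>+a. f a \<partial>lborel)"
      by (simp add: LK add.commute[of "L _"] nn_integral_lborel_shift)
    show "AE s in lborel. (\<integral>\<^sup>+a. h (L (s - K a)) \<partial>lborel) = (\<integral>\<^sup>+a. h a \<partial>lborel)"
      using nn_integral_lborel_reflect[of h] by (simp add: LK)
  qed (auto simp: sigma_finite_lborel)
  let ?B = "ball (0::'a) 1"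
  have B: "emeasure lborel ?B \<noteq> 0" "emeasure lborel ?B \<noteq> \<infinity>"
    using emeasure_lborel_open_pos[of ?B] emeasure_bounded_finite[of ?B] by auto
  have "L -` ?B = K ` ?B" using K(2,3) by (auto simp: image_iff intro!: bexI[of _ "L _"])
  moreover have "bounded (K ` ?B)"
    using K(1) by (intro bounded_linear_image) (auto simp: linear_linear)
  moreover have "open (L -` ?B)"
    using lin by (intro open_vimage) (auto simp: linear_continuous_on linear_linear)
  moreover have "0 \<in> L -` ?B" using lin by (simp add: linear_0)
  ultimately have LB: "emeasure lborel (L -` ?B) \<noteq> 0" "emeasure lborel (L -` ?B) \<noteq> \<infinity>"
    using emeasure_lborel_open_pos[of "L -` ?B"] emeasure_bounded_finite[of "L -` ?B"] by auto
  define b where "b = measure lborel ?B"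
  define l where "l = measure lborel (L -` ?B)"
  have eb: "emeasure lborel ?B = ennreal b" "emeasure lborel (L -` ?B) = ennreal l"
    using B LB by (auto simp: b_def l_def emeasure_eq_ennreal_measure)
  then have pos: "0 < b" "0 < l" using B LB by (auto simp: b_def l_def zero_less_measure_iff)
  have "scales lborel L (b / l)"
    unfolding scales_def
  proof (intro conjI ballI)
    fix h :: "'a \<Rightarrow> ennreal" assume "h \<in> borel_measurable lborel"
    then have [measurable]: "h \<in> borel_measurable borel" by simp
    have "(\<integral>\<^sup>+x. indicator ?B (L x) \<partial>lborel) = (\<integral>\<^sup>+x. indicator (L -` ?B) x \<partial>lborel)"
      by (intro nn_integral_cong) (auto simp: indicator_def)
    also have "\<dots> = emeasure lborel (L -` ?B)"
      using measurable_sets[of L borel borel ?B] by (intro nn_integral_indicator) simp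
    finally have "ennreal b * (\<integral>\<^sup>+x. h (L x) \<partial>lborel) = ennreal l * (\<integral>\<^sup>+x. h x \<partial>lborel)"
      using main[of "indicator ?B" h, OF borel_measurable_indicator] eb by (simp add: mult.commute)
    then have "ennreal (1/l) * (ennreal b * (\<integral>\<^sup>+x. h (L x) \<partial>lborel)) = ennreal (1/l) * (ennreal l * (\<integral>\<^sup>+x. h x \<partial>lborel))"
      by simp
    then show "ennreal (b / l) * (\<integral>\<^sup>+x. h (L x) \<partial>lborel) = (\<integral>\<^sup>+x. h x \<partial>lborel)"
      using pos by (simp add: mult.assoc[symmetric] ennreal_mult[symmetric])
  qed (use pos in auto)
  then show thesis by (rule that)
qed

lemma scales_isometry:
  fixes L :: "'a::euclidean_space \<Rightarrow> 'a"
  assumes "linear L" "\<And>x. norm (L x) = norm x"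
  shows "scales lborel L 1"
proof -
  have "inj L" using assms by (metis linear_injective_0 norm_eq_zero)
  then obtain c where c: "scales lborel L c" using scales_linear_exists assms(1) by blast
  have "c = 1"
    by (rule scales_invariant_set[OF c, of "ball 0 1"])
       (use emeasure_lborel_open_pos[of "ball (0::'a) 1"] emeasure_bounded_finite[of "ball (0::'a) 1"] assms(2) in auto)
  with c show ?thesis by simp
qed

lemma linear_matrix_mult_right: "linear (\<lambda>X::real^'k^'n. X ** (A::real^'m^'k))"
  by (rule linearI) (simp_all add: vec_eq_iff matrix_matrix_mult_def sum.distrib sum_distrib_left algebra_simps)

lemma linear_matrix_mult_left: "linear (\<lambda>X::real^'k^'n. (A::real^'n^'m) ** X)"
  by (rule linearI) (simp_all add: vec_eq_iff matrix_matrix_mult_def sum.distrib sum_distrib_left algebra_simps)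

lemma linear_transpose: "linear (transpose :: real^'k^'n \<Rightarrow> real^'n^'k)"
  by (rule linearI) (simp_all add: vec_eq_iff transpose_def)

lemma scales_diagonal:
  fixes c :: "'a::euclidean_space \<Rightarrow> real"
  assumes c: "\<And>b. b \<in> Basis \<Longrightarrow> 0 < c b"
  shows "scales lborel (\<lambda>x. \<Sum>b\<in>Basis. (c b * (x \<bullet> b)) *\<^sub>R b) (\<Prod>b\<in>Basis. c b)"
  unfolding scales_def
proof (intro conjI ballI)
  let ?T = "\<lambda>x::'a. \<Sum>b\<in>Basis. (c b * (x \<bullet> b)) *\<^sub>R b"
  show "0 < (\<Prod>b\<in>Basis. c b)" using c by (simp add: prod_pos)
  have [measurable]: "?T \<in> borel_measurable borel" by simp
  then show "?T \<in> lborel \<rightarrow>\<^sub>M lborel" by simp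
  have "(\<Prod>b\<in>Basis. \<bar>c b\<bar>) = (\<Prod>b\<in>Basis. c b)" using c by (intro prod.cong) (auto simp: less_imp_le)
  moreover have "c b \<noteq> 0" if "b \<in> Basis" for b using c[OF that] by simp
  ultimately have lb: "lborel = density (distr lborel borel ?T) (\<lambda>_. ennreal (\<Prod>b\<in>Basis. c b))"
    using lborel_affine_euclidean[of c 0] by simp
  fix h :: "'a \<Rightarrow> ennreal" assume "h \<in> borel_measurable lborel"
  then have [measurable]: "h \<in> borel_measurable borel" by simp
  show "ennreal (\<Prod>b\<in>Basis. c b) * (\<integral>\<^sup>+x. h (?T x) \<partial>lborel) = (\<integral>\<^sup>+x. h x \<partial>lborel)"
    by (subst (2) lb) (simp add: nn_integral_density nn_integral_distr nn_integral_cmult)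
qed

lemma scales_mult_diagm:
  fixes d :: "real^'k"
  assumes d: "\<And>i. 0 < d $ i"
  shows "scales lborel (\<lambda>X::real^'k^'n. X ** diagm d) ((\<Prod>i\<in>UNIV. d $ i) ^ CARD('n))"
proof -
  \<comment> \<open>at the matrix unit with entry 1 in row i and column j this is the entry d $ j\<close>
  define c :: "real^'k^'n \<Rightarrow> real" where "c b = (\<Sum>i\<in>UNIV. \<Sum>j\<in>UNIV. d $ j * b $ i $ j)" for b
  have cb: "c (axis i (axis j 1)) = d $ j" for i j
  proof -
    have "c (axis i (axis j 1)) = (\<Sum>i'\<in>UNIV. if i' = i then (\<Sum>j'\<in>UNIV. d $ j' * (if j' = j then 1 else 0)) else 0)"
      unfolding c_def by (intro sum.cong refl) (auto simp: axis_def intro!: sum.cong sum.neutral)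
    then show ?thesis by (simp add: if_distrib[of "(*) _"] cong: if_cong)
  qed
  have bas: "(Basis :: (real^'k^'n) set) = (\<lambda>(i, j). axis i (axis j 1)) ` (UNIV \<times> UNIV)"
    by (auto simp: Basis_vec_def Basis_real_def image_iff)
  have inj: "inj_on (\<lambda>(i, j). axis i (axis j 1) :: real^'k^'n) (UNIV \<times> UNIV)"
    by (auto simp: inj_on_def axis_eq_axis)
  have prod: "(\<Prod>j\<in>Basis. c j) = (\<Prod>i\<in>UNIV. d $ i) ^ CARD('n)"
    unfolding bas
  proof (subst prod.reindex[OF inj])
    have "(\<Prod>x\<in>UNIV \<times> UNIV. c (case x of (i, j) \<Rightarrow> axis i (axis j 1))) = (\<Prod>(i::'n, j)\<in>UNIV \<times> UNIV. d $ j)"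
      by (intro prod.cong) (auto simp: cb)
    also have "\<dots> = (\<Prod>i\<in>(UNIV::'n set). \<Prod>j\<in>UNIV. d $ j)"
      by (rule prod.cartesian_product[symmetric])
    finally show "prod (c \<circ> (\<lambda>(i, j). axis i (axis j 1))) (UNIV \<times> UNIV) = (\<Prod>i\<in>UNIV. d $ i) ^ CARD('n)"
      by (simp add: comp_def)
  qed
  have T: "(\<Sum>j\<in>Basis. (c j * (X \<bullet> j)) *\<^sub>R j) = X ** diagm d" for X :: "real^'k^'n"
  proof -
    have "(\<Sum>j\<in>Basis. (c j * (X \<bullet> j)) *\<^sub>R j) = (\<Sum>(i,j)\<in>UNIV \<times> UNIV. (d $ j * X $ i $ j) *\<^sub>R axis i (axis j 1))"
      unfolding bas by (subst sum.reindex[OF inj]) (simp add: split_def cb inner_axis)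
    also have "\<dots> = (\<Sum>i\<in>UNIV. \<Sum>j\<in>UNIV. (d $ j * X $ i $ j) *\<^sub>R axis i (axis j 1))"
      by (rule sum.cartesian_product[symmetric])
    also have "\<dots> = X ** diagm d"
    proof -
      have "(\<Sum>i\<in>UNIV. \<Sum>j\<in>UNIV. (d $ j * X $ i $ j) *\<^sub>R (axis i (axis j 1) :: real^'k^'n)) $ a $ b
          = (\<Sum>i\<in>UNIV. if a = i then (\<Sum>j\<in>UNIV. if b = j then d $ j * X $ i $ j else 0) else 0)" for a b
        unfolding sum_component by (intro sum.cong refl) (auto simp: axis_def if_distrib[of "(*) _"] cong: if_cong)
      moreover have "(X ** diagm d) $ a $ b = (\<Sum>j\<in>UNIV. if b = j then d $ j * X $ a $ j else 0)" for a b
        by (simp add: matrix_matrix_mult_def diagm_def if_distrib[of "(*) _"] mult.commute cong: if_cong)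
      ultimately show ?thesis by (simp add: vec_eq_iff)
    qed
    finally show ?thesis by simp
  qed
  have "0 < c b" if "b \<in> Basis" for b using d that by (auto simp: bas cb)
  from scales_diagonal[of c, OF this] show ?thesis by (simp only: T prod)
qed

text \<open>
  Multiplication by the orthogonal factors of a singular value decomposition preserves the norm, so only
  the diagonal factor changes volume.
\<close>

lemma scales_mult_right:
  assumes "det (A::real^'k^'k) \<noteq> 0"
  shows "scales lborel (\<lambda>X::real^'k^'n. X ** A) (\<bar>det A\<bar> ^ CARD('n))"
proof -
  obtain U V d where U: "orthogonal_matrix U" "orthogonal_matrix V" "A = U ** diagm d ** V"
    "\<And>i. 0 < d $ i" "\<bar>det A\<bar> = (\<Prod>i\<in>UNIV. d $ i)"
    using singular_value_decomposition[OF assms] by blast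
  have iso: "scales lborel (\<lambda>X::real^'k^'n. X ** W) 1" if "orthogonal_matrix W" for W
    using that by (intro scales_isometry linear_matrix_mult_right norm_orthogonal_mult_right)
  show ?thesis
    using scales_compose[OF iso[OF U(2)] scales_compose[OF scales_mult_diagm[OF U(4), where 'n='n] iso[OF U(1)]]] U(5)
    by (simp add: U(3) matrix_mul_assoc)
qed

lemma scales_mult_left:
  assumes "det (A::real^'k^'k) \<noteq> 0"
  shows "scales lborel (\<lambda>X::real^'k^'k. A ** X) (\<bar>det A\<bar> ^ CARD('k))"
proof -
  have T: "scales lborel (transpose :: real^'k^'k \<Rightarrow> _) 1"
    by (intro scales_isometry linear_transpose norm_transpose)
  have "scales lborel (\<lambda>X::real^'k^'k. X ** transpose A) (\<bar>det A\<bar> ^ CARD('k))"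
    using scales_mult_right[of "transpose A"] assms by simp
  from scales_compose[OF T scales_compose[OF this T]] show ?thesis
    by (simp add: matrix_transpose_mul)
qed

lemma scales_orthogonal_left:
  "orthogonal_matrix U \<Longrightarrow> scales lborel (\<lambda>X::real^'k^'n. U ** X) 1"
  by (intro scales_isometry linear_matrix_mult_left norm_orthogonal_mult_left)

section \<open>The homogeneous measure on the Stiefel manifold\<close>

lemma poly_det: "poly (det A) t = det (\<chi> i j. poly (A $ i $ j) t)"
  for A :: "real poly^'n^'n"
proof -
  have "poly (of_int (sign p)) t = of_int (sign p)" for p :: "'n \<Rightarrow> 'n"
    by (simp add: sign_def)
  then show ?thesis by (simp add: det_def poly_sum poly_prod)
qed

lemma poly_char_polynomial: "poly (char_polynomial A) t = det (mat t - A)"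
proof -
  have "(\<chi> i j. poly ((\<chi> i j. (if i = j then [:0, 1:] else 0) - [:A $ i $ j:]) $ i $ j) t) = mat t - A"
    by (simp add: vec_eq_iff mat_def)
  then show ?thesis unfolding char_polynomial_def poly_det by simp
qed

lemma det_zero_kernel:
  assumes "det (A::real^'n^'n) = 0" obtains x where "x \<noteq> 0" "A *v x = 0"
  using assms invertible_det_nz[of A] matrix_left_invertible_ker[of A]
  unfolding invertible_def by (metis matrix_left_right_inverse)

text \<open>
  A number that exceeds the operator norm is not an eigenvalue.
\<close>

lemma char_polynomial_nonzero: "char_polynomial A \<noteq> 0"
proof
  assume 0: "char_polynomial A = 0"
  obtain B where B: "B > 0" "\<And>x. norm (A *v x) \<le> B * norm x"
    using linear_bounded_pos[OF matrix_vector_mul_linear, of A] by blast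
  have "det (mat (B + 1) - A) = 0" using poly_char_polynomial[of A "B + 1"] 0 by simp
  then obtain x where x: "x \<noteq> 0" "(mat (B + 1) - A) *v x = 0" by (rule det_zero_kernel)
  have "mat (B + 1) *v x = (B + 1) *\<^sub>R x"
    by (simp add: vec_eq_iff matrix_vector_mult_def mat_def if_distrib[of "\<lambda>z. z * _"] cong: if_cong)
  then have "A *v x = (B + 1) *\<^sub>R x" using x(2) by (simp add: matrix_vector_mult_diff_rdistrib)
  then show False using B(1) B(2)[of x] x(1) by simp
qed

lemma finite_singular_shifts: "finite {t. det (A + mat t) = (0::real)}"
proof -
  have "det (mat t - (- A)) = det (A + mat t)" for t by (simp add: add.commute)
  then have "{t. det (A + mat t) = 0} = {t. poly (char_polynomial (- A)) t = 0}"
    by (simp add: poly_char_polynomial add.commute)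
  then show ?thesis using poly_roots_finite[OF char_polynomial_nonzero] by simp
qed

lemma stiefel_nonempty:
  assumes "CARD('k::finite) \<le> CARD('n::finite)"
  obtains Q where "Q \<in> (stiefel :: (real^'k^'n) set)"
proof -
  obtain f :: "'k \<Rightarrow> 'n" where f: "inj f"
    using assms inj_on_iff_card_le[of "UNIV::'k set" "UNIV::'n set"] by auto
  define Q :: "real^'k^'n" where "Q = (\<chi> i j. if i = f j then 1 else 0)"
  have "(transpose Q ** Q) $ i $ j = (mat 1 :: real^'k^'k) $ i $ j" for i j
    using f by (auto simp: matrix_matrix_mult_def transpose_def Q_def mat_def inj_def if_distrib[of "\<lambda>z. z * _"] cong: if_cong)
  then have "Q \<in> stiefel" by (simp add: stiefel_def vec_eq_iff)
  then show thesis by (rule that)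
qed

text \<open>
  Let \<open>Q\<close> have orthonormal columns. On the line \<open>X + t Q\<close> the matrix
  \<open>Q\<^sup>T (X + t Q) = Q\<^sup>T X + t 1\<close> is singular for finitely many \<open>t\<close> only. Averaging the translation invariant
  measure over \<open>t \<in> [0, 1]\<close> and exchanging the integrals shows that \<open>Q\<^sup>T X\<close> is invertible for almost every
  \<open>X\<close>, and then \<open>X\<close> has full rank.
\<close>

lemma not_full_rank_null:
  assumes "CARD('k::finite) \<le> CARD('n::finite)"
  shows "AE X in lborel. X \<in> (full_rank_mats :: (real^'k^'n) set)"
proof -
  obtain Q :: "real^'k^'n" where Q: "Q \<in> stiefel" using stiefel_nonempty[OF assms] by blast
  define N where "N = {X :: real^'k^'n. det (transpose Q ** X) = 0}"
  have "{X \<in> space borel. det (transpose Q ** X) = 0} \<in> sets borel" by measurable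
  then have [measurable]: "N \<in> sets borel" by (simp add: N_def)
  have fin: "finite {t. X + t *\<^sub>R Q \<in> N}" for X
  proof -
    have "transpose Q ** (X + t *\<^sub>R Q) = transpose Q ** X + mat t" for t
    proof -
      have "transpose Q ** (t *\<^sub>R Q) = t *\<^sub>R (transpose Q ** Q)"
        by (simp add: vec_eq_iff matrix_matrix_mult_def sum_distrib_left mult_ac)
      also have "\<dots> = mat t" using Q by (simp add: stiefel_def vec_eq_iff mat_def)
      finally show ?thesis by (simp add: matrix_add_ldistrib)
    qed
    then show ?thesis using finite_singular_shifts[of "transpose Q ** X"] by (simp add: N_def)
  qed
  have "emeasure lborel N = (\<integral>\<^sup>+t. indicator {0..1::real} t * emeasure lborel N \<partial>lborel)"
    by (simp add: nn_integral_multc)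
  also have "\<dots> = (\<integral>\<^sup>+t. (\<integral>\<^sup>+X. indicator {0..1::real} t * indicator N (X + t *\<^sub>R Q) \<partial>lborel) \<partial>lborel)"
  proof (intro nn_integral_cong)
    fix t :: real
    have "(\<integral>\<^sup>+X. indicator N (X + t *\<^sub>R Q) \<partial>lborel) = emeasure lborel N"
      by (subst nn_integral_lborel_shift) auto
    then show "indicator {0..1} t * emeasure lborel N = (\<integral>\<^sup>+X. indicator {0..1::real} t * indicator N (X + t *\<^sub>R Q) \<partial>lborel)"
      by (subst nn_integral_cmult) auto
  qed
  also have "\<dots> = (\<integral>\<^sup>+X. (\<integral>\<^sup>+t. indicator {0..1::real} t * indicator N (X + t *\<^sub>R Q) \<partial>lborel) \<partial>lborel)"
    by (rule lborel_pair.Fubini'[symmetric]) measurable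
  also have "\<dots> = (\<integral>\<^sup>+X. 0 \<partial>(lborel :: (real^'k^'n) measure))"
  proof (rule nn_integral_cong)
    fix X :: "real^'k^'n"
    have "{t. X + t *\<^sub>R Q \<in> N} \<in> null_sets lborel" using fin by (intro finite_imp_null_set_lborel)
    then have "AE t in lborel. t \<notin> {t. X + t *\<^sub>R Q \<in> N}" by (rule AE_not_in)
    then have "AE t in lborel. indicator {0..1::real} t * indicator N (X + t *\<^sub>R Q) = (0::ennreal)"
      by eventually_elim auto
    then show "(\<integral>\<^sup>+t. indicator {0..1::real} t * indicator N (X + t *\<^sub>R Q) \<partial>lborel) = 0"
      by (subst nn_integral_0_iff_AE) auto
  qed
  finally have "N \<in> null_sets lborel" by (simp add: null_sets_def)
  then have "AE X in lborel. X \<notin> N" by (rule AE_not_in)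
  then show ?thesis
  proof eventually_elim
    case (elim X)
    have "x = 0" if "X *v x = 0" for x
    proof (rule det_nonzero_mult_vec)
      show "det (transpose Q ** X) \<noteq> 0" using elim by (simp add: N_def)
      show "(transpose Q ** X) *v x = 0" using that by (simp flip: matrix_vector_mul_assoc)
    qed
    then show ?case using gram_pos_def by (auto simp: full_rank_mats_def)
  qed
qed

lemma stiefel_mult: "Q \<in> stiefel \<Longrightarrow> R \<in> stiefel \<Longrightarrow> Q ** R \<in> stiefel"
  using stiefel_gram'[of Q R] by (simp add: stiefel_def)

lemma full_rank_mult_left:
  assumes "orthogonal_matrix U" "X \<in> full_rank_mats"
  shows "U ** X \<in> full_rank_mats" "polar_pair (U ** X) = (U ** fst (polar_pair X), snd (polar_pair X))"
proof -
  have U: "U \<in> stiefel" using assms by (simp add: orthogonal_matrix_stiefel)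
  note X = polar_pair[OF assms(2)]
  have eq: "U ** X = (U ** fst (polar_pair X)) ** snd (polar_pair X)" using X(3) by (simp flip: matrix_mul_assoc)
  have UQ: "U ** fst (polar_pair X) \<in> stiefel" using U X(1) by (rule stiefel_mult)
  show "U ** X \<in> full_rank_mats" unfolding eq by (rule polar_in_full_rank[OF UQ X(2)])
  show "polar_pair (U ** X) = (U ** fst (polar_pair X), snd (polar_pair X))"
    unfolding eq by (rule polar_pair_eq[OF UQ X(2)])
qed

lemma full_rank_mult_right:
  assumes "orthogonal_matrix U" "X \<in> full_rank_mats"
  shows "X ** U \<in> full_rank_mats" "polar_pair (X ** U) = (fst (polar_pair X) ** U, transpose U ** snd (polar_pair X) ** U)"
proof -
  have U: "U \<in> stiefel" using assms by (simp add: orthogonal_matrix_stiefel)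
  note X = polar_pair[OF assms(2)]
  have "(fst (polar_pair X) ** U) ** (transpose U ** snd (polar_pair X) ** U)
      = fst (polar_pair X) ** (U ** transpose U) ** snd (polar_pair X) ** U" by (simp add: matrix_mul_assoc)
  then have eq: "X ** U = (fst (polar_pair X) ** U) ** (transpose U ** snd (polar_pair X) ** U)"
    using X(3) orthogonal_matrix_inverse[OF assms(1)] by (simp add: matrix_mul_rid)
  have QU: "fst (polar_pair X) ** U \<in> stiefel" using X(1) U by (rule stiefel_mult)
  have P: "transpose U ** snd (polar_pair X) ** U \<in> pos_def_mats"
    using pos_def_orthogonal_conj[OF _ X(2), of "transpose U"] assms(1) by simp
  show "X ** U \<in> full_rank_mats" unfolding eq by (rule polar_in_full_rank[OF QU P])
  show "polar_pair (X ** U) = (fst (polar_pair X) ** U, transpose U ** snd (polar_pair X) ** U)"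
    unfolding eq by (rule polar_pair_eq[OF QU P])
qed

abbreviation stiefel_borel_space :: "(real^'k^'n) measure" where
  "stiefel_borel_space \<equiv> restrict_space borel stiefel"

lemma measurable_stiefel_inclusion: "(\<lambda>Q. Q) \<in> borel_measurable stiefel_borel_space"
  by (intro measurable_restrict_space1 measurable_ident_sets) simp

lemma measurable_stiefel_mult:
  assumes "f \<in> M \<rightarrow>\<^sub>M stiefel_borel_space" "g \<in> M \<rightarrow>\<^sub>M stiefel_borel_space"
  shows "(\<lambda>x. (f x :: real^'k^'n) ** (g x :: real^'m^'k)) \<in> M \<rightarrow>\<^sub>M stiefel_borel_space"
proof (rule measurable_restrict_space2)
  have [measurable]: "f \<in> borel_measurable M" "g \<in> borel_measurable M"
    using assms by (simp_all add: measurable_restrict_space2_iff)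
  show "(\<lambda>x. f x ** g x) \<in> borel_measurable M" by measurable
  show "(\<lambda>x. f x ** g x) \<in> space M \<rightarrow> stiefel"
    using assms by (auto simp: measurable_restrict_space2_iff intro!: stiefel_mult)
qed

text \<open>
  The default \<open>mat 1\<close> keeps all values in the orthogonal group.
\<close>

definition orthogonal_factor :: "real^'n^'n \<Rightarrow> real^'n^'n" where
  "orthogonal_factor X = (if X \<in> full_rank_mats then fst (polar_pair X) else mat 1)"

lemma mat_1_stiefel: "mat 1 \<in> stiefel"
  by (simp add: stiefel_def transpose_mat)

lemma measurable_orthogonal_factor: "(orthogonal_factor :: real^'n^'n \<Rightarrow> _) \<in> borel \<rightarrow>\<^sub>M stiefel_borel_space"
proof (rule measurable_restrict_space2)
  show "(orthogonal_factor :: real^'n^'n \<Rightarrow> _) \<in> space borel \<rightarrow> stiefel"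
    by (auto simp: orthogonal_factor_def polar_pair mat_1_stiefel)
  have "(\<lambda>X::real^'n^'n. fst (polar_pair X)) \<in> borel_measurable borel"
    by (rule measurable_compose[OF polar_pair_measurable]) (auto intro!: borel_measurable_continuous_onI continuous_intros)
  note [measurable] = this
  have "(\<lambda>X::real^'n^'n. if X \<in> full_rank_mats then fst (polar_pair X) else mat 1) \<in> borel_measurable borel"
    by (rule measurable_If_set) auto
  then show "(orthogonal_factor :: real^'n^'n \<Rightarrow> _) \<in> borel_measurable borel"
    by (simp add: orthogonal_factor_def[abs_def])
qed

text \<open>
  Lebesgue measure and the unit ball of the Frobenius norm are invariant under multiplication by
  orthogonal matrices from either side, and the orthogonal polar factor commutes with both
  multiplications. So the polar factor of a uniformly distributed point of the ball is invariant on both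
  sides in law.
\<close>

definition haar_orthogonal :: "(real^'n^'n) measure" where
  "haar_orthogonal = distr (uniform_measure lborel (ball 0 1)) stiefel_borel_space orthogonal_factor"

lemma lborel_ball_finite_pos:
  "emeasure lborel (ball (0::'a::euclidean_space) 1) \<noteq> 0" "emeasure lborel (ball (0::'a::euclidean_space) 1) \<noteq> \<infinity>"
  using emeasure_lborel_open_pos[of "ball (0::'a) 1"] emeasure_bounded_finite[of "ball (0::'a) 1"] by auto

lemma sets_haar [measurable_cong, simp]: "sets haar_orthogonal = sets stiefel_borel_space"
  by (simp add: haar_orthogonal_def)

lemma space_haar [simp]: "space haar_orthogonal = stiefel"
  by (simp add: haar_orthogonal_def space_restrict_space)

lemma measurable_orthogonal_factor_uniform:
  "orthogonal_factor \<in> uniform_measure lborel S \<rightarrow>\<^sub>M stiefel_borel_space"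
proof -
  have "sets (uniform_measure lborel S) = sets borel" by simp
  from measurable_cong_sets[OF this refl] show ?thesis using measurable_orthogonal_factor by blast
qed

lemma prob_space_haar: "prob_space (haar_orthogonal :: (real^'n^'n) measure)"
  unfolding haar_orthogonal_def
  by (intro prob_space.prob_space_distr prob_space_uniform_measure lborel_ball_finite_pos)
    (rule measurable_orthogonal_factor_uniform)

lemma nn_integral_haar:
  fixes f :: "real^'n^'n \<Rightarrow> ennreal"
  assumes "f \<in> borel_measurable stiefel_borel_space"
  shows "(\<integral>\<^sup>+U. f U \<partial>haar_orthogonal) =
    (\<integral>\<^sup>+X. f (orthogonal_factor X) * indicator (ball 0 1) X \<partial>lborel) / emeasure lborel (ball (0::real^'n^'n) 1)"
proof -
  have m: "(\<lambda>X. f (orthogonal_factor X)) \<in> borel_measurable lborel"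
    using measurable_compose[OF measurable_orthogonal_factor assms] by simp
  show ?thesis unfolding haar_orthogonal_def
    by (subst nn_integral_distr)
      (simp_all add: nn_integral_uniform_measure[OF m] measurable_orthogonal_factor_uniform assms)
qed

lemma haar_invariant_map:
  fixes f :: "real^'n^'n \<Rightarrow> ennreal"
  assumes f: "f \<in> borel_measurable stiefel_borel_space"
    and T: "T \<in> stiefel_borel_space \<rightarrow>\<^sub>M stiefel_borel_space"
    and L: "scales lborel L 1" "\<And>X. norm (L X) = norm X"
      "\<And>X. X \<in> full_rank_mats \<Longrightarrow> orthogonal_factor (L X) = T (orthogonal_factor X)"
  shows "(\<integral>\<^sup>+U. f (T U) \<partial>haar_orthogonal) = (\<integral>\<^sup>+U. f U \<partial>haar_orthogonal)"
proof -
  let ?h = "\<lambda>X. f (orthogonal_factor X) * indicator (ball 0 1) X"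
  have "(\<lambda>X. f (orthogonal_factor X)) \<in> borel_measurable borel"
    by (rule measurable_compose[OF measurable_orthogonal_factor f])
  then have hm: "?h \<in> borel_measurable lborel"
    by (intro borel_measurable_times_ennreal borel_measurable_indicator) simp_all
  have fr: "AE X in lborel. X \<in> (full_rank_mats :: (real^'n^'n) set)"
    by (rule not_full_rank_null) simp
  have "(\<integral>\<^sup>+X. f (T (orthogonal_factor X)) * indicator (ball 0 1) X \<partial>lborel) = (\<integral>\<^sup>+X. ?h (L X) \<partial>lborel)"
    using fr by (intro nn_integral_cong_AE) (auto elim!: eventually_mono simp: L(2,3) indicator_def)
  also have "\<dots> = (\<integral>\<^sup>+X. ?h X \<partial>lborel)"
    using scalesD(3)[OF L(1) hm] by simp
  finally show ?thesis
    using nn_integral_haar[OF measurable_compose[OF T f]] nn_integral_haar[OF f] by simp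
qed

lemma haar_invariant:
  fixes f :: "real^'n^'n \<Rightarrow> ennreal"
  assumes f: "f \<in> borel_measurable stiefel_borel_space" and V: "orthogonal_matrix V"
  shows "(\<integral>\<^sup>+U. f (V ** U) \<partial>haar_orthogonal) = (\<integral>\<^sup>+U. f U \<partial>haar_orthogonal)"
    and "(\<integral>\<^sup>+U. f (U ** V) \<partial>haar_orthogonal) = (\<integral>\<^sup>+U. f U \<partial>haar_orthogonal)"
proof -
  have "V \<in> stiefel" using V by (simp add: orthogonal_matrix_stiefel)
  then have Vc: "(\<lambda>_. V) \<in> stiefel_borel_space \<rightarrow>\<^sub>M stiefel_borel_space"
    by (intro measurable_const) (simp add: space_restrict_space)
  have id: "(\<lambda>U::real^'n^'n. U) \<in> stiefel_borel_space \<rightarrow>\<^sub>M stiefel_borel_space" by (intro measurable_ident_sets) simp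
  show "(\<integral>\<^sup>+U. f (V ** U) \<partial>haar_orthogonal) = (\<integral>\<^sup>+U. f U \<partial>haar_orthogonal)"
    by (rule haar_invariant_map[OF f measurable_stiefel_mult[OF Vc id] scales_orthogonal_left[OF V]])
      (simp_all add: orthogonal_factor_def full_rank_mult_left[OF V] norm_orthogonal_mult_left[OF V])
  have "scales lborel (\<lambda>X::real^'n^'n. X ** V) 1"
    using V by (intro scales_isometry linear_matrix_mult_right norm_orthogonal_mult_right)
  then show "(\<integral>\<^sup>+U. f (U ** V) \<partial>haar_orthogonal) = (\<integral>\<^sup>+U. f U \<partial>haar_orthogonal)"
    by (rule haar_invariant_map[OF f measurable_stiefel_mult[OF id Vc]])
      (simp_all add: orthogonal_factor_def full_rank_mult_right[OF V] norm_orthogonal_mult_right[OF V])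
qed

text \<open>
  \<open>R Q\<^sup>T\<close> maps the range of \<open>Q\<close> isometrically onto the range of \<open>R\<close>. The orthogonal complements of the two
  ranges have the same dimension, and any isometry \<open>g\<close> between them completes the map to an orthogonal
  one.
\<close>

lemma stiefel_transitive:
  fixes Q R :: "real^'k^'n"
  assumes Q: "Q \<in> stiefel" and R: "R \<in> stiefel"
  obtains V where "orthogonal_matrix V" "V ** Q = R"
proof -
  let ?q = "\<lambda>x. Q *v x" and ?r = "\<lambda>x. R *v x"
  define S where "S = range ?q"
  define T where "T = range ?r"
  have S: "subspace S" and T: "subspace T"
    unfolding S_def T_def by (intro linear_subspace_image matrix_vector_mul_linear subspace_UNIV)+
  have QQ: "transpose Q ** Q = mat 1" and RR: "transpose R ** R = mat 1"
    using Q R by (auto simp: stiefel_def)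
  have ker: "x = 0" if "transpose X ** X = mat 1" "X *v x = 0" for X :: "real^'k^'n" and x
  proof -
    have "x = transpose X *v (X *v x)" using that(1) by (simp add: matrix_vector_mul_assoc)
    then show ?thesis using that(2) by simp
  qed
  have "dim S = CARD('k)" "dim T = CARD('k)" unfolding S_def T_def
    using dim_image_eq[of ?q UNIV] dim_image_eq[of ?r UNIV] ker[OF QQ] ker[OF RR]
    by (simp_all add: linear_injective_0 span_UNIV)
  moreover have "dim {y. \<forall>x\<in>S. orthogonal x y} + dim S = CARD('n)"
    "dim {y. \<forall>x\<in>T. orthogonal x y} + dim T = CARD('n)"
    using dim_subspace_orthogonal_to_vectors[OF S subspace_UNIV] dim_subspace_orthogonal_to_vectors[OF T subspace_UNIV]
    by simp_all
  ultimately have eq: "dim {y. \<forall>x\<in>S. orthogonal x y} = dim {y. \<forall>x\<in>T. orthogonal x y}" by simp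
  obtain g where g: "linear g" "g ` {y. \<forall>x\<in>S. orthogonal x y} = {y. \<forall>x\<in>T. orthogonal x y}"
    "\<forall>z\<in>{y. \<forall>x\<in>S. orthogonal x y}. norm (g z) = norm z"
  proof (rule isometry_subspaces[OF subspace_orthogonal_to_vectors subspace_orthogonal_to_vectors eq], goal_cases)
    case (1 f)
    show thesis by (rule 1(1)[OF 1(2,3)]) (use 1(4) in blast)
  qed
  define h where "h x = R *v (transpose Q *v x) + g (x - Q *v (transpose Q *v x))" for x
  have lin: "linear h" unfolding h_def using g(1)
    by (intro linearI) (simp_all add: matrix_vector_right_distrib linear_add linear_diff linear_cmul matrix_vector_mult_scaleR algebra_simps)
  have adj: "(Q *v a) \<bullet> y = a \<bullet> (transpose Q *v y)" for a y
    by (metis dot_lmul_matrix inner_commute transpose_matrix_vector)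
  have norm: "norm (h x) = norm x" for x
  proof -
    let ?a = "transpose Q *v x"
    let ?z = "x - Q *v ?a"
    have az: "transpose Q *v ?z = 0"
      using QQ by (simp add: matrix_vector_mult_diff_distrib matrix_vector_mul_assoc)
    then have z: "?z \<in> {y. \<forall>x\<in>S. orthogonal x y}"
      unfolding S_def orthogonal_def by (auto simp: adj)
    then have "g ?z \<in> {y. \<forall>x\<in>T. orthogonal x y}" using g(2) by blast
    then have o1: "orthogonal (R *v ?a) (g ?z)" by (auto simp: T_def)
    have o2: "orthogonal (Q *v ?a) ?z" using az by (simp add: orthogonal_def adj)
    have nR: "norm (X *v ?a) = norm ?a" if "transpose X ** X = mat 1" for X :: "real^'k^'n"
    proof -
      have "(X *v ?a) \<bullet> (X *v ?a) = ?a \<bullet> ((transpose X ** X) *v ?a)"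
        by (metis dot_lmul_matrix inner_commute matrix_vector_mul_assoc transpose_matrix_vector)
      then show ?thesis using that by (simp add: norm_eq_sqrt_inner)
    qed
    have "(norm (h x))\<^sup>2 = (norm (Q *v ?a))\<^sup>2 + (norm ?z)\<^sup>2"
      unfolding h_def using norm_add_Pythagorean[OF o1] bspec[OF g(3) z] nR[OF QQ] nR[OF RR] by simp
    also have "\<dots> = (norm x)\<^sup>2" using norm_add_Pythagorean[OF o2] by simp
    finally show ?thesis by (simp add: power2_eq_iff_nonneg)
  qed
  have "orthogonal_transformation h" using lin norm by (simp add: orthogonal_transformation)
  then have V: "orthogonal_matrix (matrix h)" using orthogonal_transformation_matrix by blast
  have "matrix h *v (Q *v x) = R *v x" for x
  proof -
    have "transpose Q *v (Q *v x) = x" using QQ by (simp add: matrix_vector_mul_assoc)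
    then show ?thesis using lin g(1) by (simp add: matrix_works h_def linear_0)
  qed
  then have "matrix h ** Q = R" by (simp add: matrix_eq flip: matrix_vector_mul_assoc)
  with V show thesis by (rule that)
qed

definition stiefel_measure :: "real^'k^'n \<Rightarrow> (real^'k^'n) measure" where
  "stiefel_measure Q = distr haar_orthogonal stiefel_borel_space (\<lambda>U. U ** Q)"

lemma nn_integral_stiefel_measure:
  fixes Q :: "real^'k^'n"
  assumes Q: "Q \<in> stiefel" and f: "f \<in> borel_measurable stiefel_borel_space"
  shows "(\<integral>\<^sup>+R. f R \<partial>stiefel_measure Q) = (\<integral>\<^sup>+U. f (U ** Q) \<partial>haar_orthogonal)"
  unfolding stiefel_measure_def
proof (rule nn_integral_distr)
  show "(\<lambda>U. U ** Q) \<in> haar_orthogonal \<rightarrow>\<^sub>M stiefel_borel_space"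
    using Q by (intro measurable_stiefel_mult measurable_const)
      (auto simp: space_restrict_space measurable_cong_sets[OF sets_haar refl])
qed (simp add: f)

lemma homogeneous_prob_stiefel_measure:
  fixes Q :: "real^'k^'n"
  assumes Q: "Q \<in> stiefel"
  shows "homogeneous_prob (stiefel_measure Q)"
  unfolding homogeneous_prob_def
proof (intro conjI allI impI)
  have mQ: "(\<lambda>U. U ** Q) \<in> haar_orthogonal \<rightarrow>\<^sub>M stiefel_borel_space"
    using Q by (intro measurable_stiefel_mult measurable_const)
      (auto simp: space_restrict_space measurable_cong_sets[OF sets_haar refl])
  show "prob_space (stiefel_measure Q)"
    unfolding stiefel_measure_def by (rule prob_space.prob_space_distr[OF prob_space_haar mQ])
  show s: "sets (stiefel_measure Q) = sets stiefel_borel_space" by (simp add: stiefel_measure_def)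
  fix U :: "real^'n^'n" assume U: "orthogonal_matrix U"
  have mU: "(\<lambda>Q::real^'k^'n. U ** Q) \<in> stiefel_borel_space \<rightarrow>\<^sub>M stiefel_borel_space"
    using U by (intro measurable_stiefel_mult measurable_const) (auto simp: space_restrict_space orthogonal_matrix_stiefel)
  show "distr (stiefel_measure Q) (stiefel_measure Q) (\<lambda>Q. U ** Q) = stiefel_measure Q"
  proof (rule measure_eqI)
    fix A assume "A \<in> sets (distr (stiefel_measure Q) (stiefel_measure Q) (\<lambda>Q. U ** Q))"
    then have A: "A \<in> sets stiefel_borel_space" by (simp add: s measurable_cong_sets[OF s refl])
    then have f: "(indicator A :: _ \<Rightarrow> ennreal) \<in> borel_measurable stiefel_borel_space" by simp
    have mU': "(\<lambda>Q. U ** Q) \<in> stiefel_measure Q \<rightarrow>\<^sub>M stiefel_measure Q"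
      using mU by (simp add: measurable_cong_sets[OF s s])
    have "emeasure (distr (stiefel_measure Q) (stiefel_measure Q) (\<lambda>Q. U ** Q)) A = (\<integral>\<^sup>+R. indicator A R \<partial>distr (stiefel_measure Q) (stiefel_measure Q) (\<lambda>Q. U ** Q))"
      using A sets_eq_imp_space_eq[OF s] by (simp add: measurable_cong_sets[OF s refl] s)
    also have "\<dots> = (\<integral>\<^sup>+R. indicator A (U ** R) \<partial>stiefel_measure Q)"
      using A by (intro nn_integral_distr[OF mU']) (simp add: s measurable_cong_sets[OF s refl])
    also have "\<dots> = (\<integral>\<^sup>+V. indicator A (U ** (V ** Q)) \<partial>haar_orthogonal)"
      by (rule nn_integral_stiefel_measure[OF Q measurable_compose[OF mU f]])
    also have "\<dots> = (\<integral>\<^sup>+V. indicator A (V ** Q) \<partial>haar_orthogonal)"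
      using haar_invariant(1)[OF measurable_compose[OF mQ[unfolded measurable_cong_sets[OF sets_haar refl]] f] U]
      by (simp add: matrix_mul_assoc)
    also have "\<dots> = (\<integral>\<^sup>+R. indicator A R \<partial>stiefel_measure Q)"
      by (rule nn_integral_stiefel_measure[OF Q f, symmetric])
    also have "\<dots> = emeasure (stiefel_measure Q) A" using A sets_eq_imp_space_eq[OF s] by (simp add: measurable_cong_sets[OF s refl] s)
    finally show "emeasure (distr (stiefel_measure Q) (stiefel_measure Q) (\<lambda>Q. U ** Q)) A = emeasure (stiefel_measure Q) A" .
  qed simp
qed

text \<open>
  Averaging the invariant measure \<open>\<mu>\<close> over the orthogonal group does not change it. After
  exchanging the integrals, the inner one is the mean of the indicator of \<open>A\<close> over the orbit of \<open>R\<close>,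
  which by transitivity and right invariance of Haar measure is the same for all \<open>R\<close>.
\<close>

lemma homogeneous_prob_unique:
  fixes \<mu> :: "(real^'k^'n) measure"
  assumes \<mu>: "homogeneous_prob \<mu>" and Q: "Q \<in> stiefel"
  shows "\<mu> = stiefel_measure Q"
proof (rule measure_eqI)
  have s: "sets \<mu> = sets stiefel_borel_space" using \<mu> by (simp add: homogeneous_prob_def)
  then show "sets \<mu> = sets (stiefel_measure Q)" by (simp add: stiefel_measure_def)
  have sp: "space \<mu> = stiefel" using sets_eq_imp_space_eq[OF s] by (simp add: space_restrict_space)
  interpret \<mu>: prob_space \<mu> using \<mu> by (simp add: homogeneous_prob_def)
  interpret H: prob_space "haar_orthogonal :: (real^'n^'n) measure" by (rule prob_space_haar)
  interpret pair_sigma_finite "haar_orthogonal :: (real^'n^'n) measure" \<mu> ..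
  fix A assume "A \<in> sets \<mu>"
  then have A: "A \<in> sets stiefel_borel_space" by (simp add: s measurable_cong_sets[OF s refl])
  then have f: "(indicator A :: _ \<Rightarrow> ennreal) \<in> borel_measurable stiefel_borel_space" by simp
  have "(\<integral>\<^sup>+R. indicator A (U ** R) \<partial>\<mu>) = emeasure \<mu> A" if "U \<in> stiefel" for U :: "real^'n^'n"
  proof -
    have U: "orthogonal_matrix U" using that by (simp add: orthogonal_matrix_stiefel)
    have mU: "(\<lambda>Q. U ** Q) \<in> \<mu> \<rightarrow>\<^sub>M \<mu>"
      unfolding measurable_cong_sets[OF s s] using that
      by (intro measurable_stiefel_mult measurable_const) (auto simp: space_restrict_space)
    have "(\<integral>\<^sup>+R. indicator A (U ** R) \<partial>\<mu>) = (\<integral>\<^sup>+R. indicator A R \<partial>distr \<mu> \<mu> (\<lambda>Q. U ** Q))"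
      using A by (intro nn_integral_distr[OF mU, symmetric]) (simp add: s measurable_cong_sets[OF s refl])
    also have "distr \<mu> \<mu> (\<lambda>Q. U ** Q) = \<mu>" using \<mu> U by (simp add: homogeneous_prob_def)
    finally show ?thesis using A sets_eq_imp_space_eq[OF s] by (simp add: measurable_cong_sets[OF s refl] s)
  qed
  then have "emeasure \<mu> A = (\<integral>\<^sup>+U. (\<integral>\<^sup>+R. indicator A (U ** R) \<partial>\<mu>) \<partial>haar_orthogonal)"
    by (subst nn_integral_cong[where v="\<lambda>_. emeasure \<mu> A"]) (auto simp: H.emeasure_space_1[simplified])
  also have "\<dots> = (\<integral>\<^sup>+R. (\<integral>\<^sup>+U. indicator A (U ** R) \<partial>haar_orthogonal) \<partial>\<mu>)"
  proof (rule Fubini'[symmetric])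
    have "(\<lambda>x. fst x ** snd x) \<in> haar_orthogonal \<Otimes>\<^sub>M \<mu> \<rightarrow>\<^sub>M stiefel_borel_space"
      by (intro measurable_stiefel_mult)
        (simp_all add: measurable_cong_sets[OF refl sets_haar[symmetric]] measurable_cong_sets[OF refl s[symmetric]])
    from measurable_compose[OF this f]
    show "(\<lambda>(U, R). indicator A (U ** R) :: ennreal) \<in> borel_measurable (haar_orthogonal \<Otimes>\<^sub>M \<mu>)"
      by (simp add: split_def)
  qed
  also have "\<dots> = (\<integral>\<^sup>+R. (\<integral>\<^sup>+U. indicator A (U ** Q) \<partial>haar_orthogonal) \<partial>\<mu>)"
  proof (rule nn_integral_cong)
    fix R assume "R \<in> space \<mu>"
    then obtain V where V: "orthogonal_matrix V" "V ** Q = R" using stiefel_transitive[OF Q] sp by blast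
    have mQ: "(\<lambda>U. U ** Q) \<in> (stiefel_borel_space :: (real^'n^'n) measure) \<rightarrow>\<^sub>M stiefel_borel_space"
      using Q by (intro measurable_stiefel_mult measurable_const) (auto simp: space_restrict_space)
    show "(\<integral>\<^sup>+U. indicator A (U ** R) \<partial>haar_orthogonal) = (\<integral>\<^sup>+U. indicator A (U ** Q) \<partial>haar_orthogonal)"
      using haar_invariant(2)[OF measurable_compose[OF mQ f] V(1)] V(2) by (simp flip: matrix_mul_assoc)
  qed
  also have "\<dots> = emeasure (stiefel_measure Q) A"
    using nn_integral_stiefel_measure[OF Q f] A by (simp add: \<mu>.emeasure_space_1 stiefel_measure_def)
  finally show "emeasure \<mu> A = emeasure (stiefel_measure Q) A" .
qed

lemma homogeneous_measure_eq:
  assumes "Q \<in> (stiefel :: (real^'k^'n) set)"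
  shows "homogeneous_measure = completion (stiefel_measure Q)"
proof -
  have "(THE \<mu>. homogeneous_prob \<mu>) = stiefel_measure Q"
    by (rule the_equality) (simp_all add: homogeneous_prob_stiefel_measure[OF assms] homogeneous_prob_unique[OF _ assms])
  then show ?thesis by (simp add: homogeneous_measure_def)
qed

section \<open>Lebesgue measure on symmetric matrices\<close>

text \<open>
  The positions \<open>(i, j)\<close> with \<open>i \<le> j\<close> as an index type, so that symmetric matrices are coordinatised by
  \<open>real^'k upper\<close>, where the change of variables theorem applies. The lexicographic order provides the class
  \<open>wellorder\<close>, which that theorem asks of its index type.
\<close>

typedef (overloaded) ('k::linorder) upper = "{(i::'k, j). i \<le> j}"
  by (auto intro: exI[of _ "(undefined, undefined)"])

instance upper :: ("{finite, linorder}") finite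
proof
  have "(UNIV :: 'a upper set) = Abs_upper ` {(i, j). i \<le> j}"
    using Rep_upper Rep_upper_inverse by (metis UNIV_eq_I image_eqI)
  then show "finite (UNIV :: 'a upper set)" by (metis finite finite_imageI)
qed

instantiation upper :: ("{finite, linorder}") linorder
begin

definition less_eq_upper :: "'a upper \<Rightarrow> 'a upper \<Rightarrow> bool" where
  "a \<le> b \<longleftrightarrow> fst (Rep_upper a) < fst (Rep_upper b) \<or>
     fst (Rep_upper a) = fst (Rep_upper b) \<and> snd (Rep_upper a) \<le> snd (Rep_upper b)"

definition less_upper :: "'a upper \<Rightarrow> 'a upper \<Rightarrow> bool" where
  "a < b \<longleftrightarrow> a \<le> b \<and> \<not> (b \<le> (a :: 'a upper))"

instance
  by standard (auto simp: less_eq_upper_def less_upper_def Rep_upper_inject[symmetric] prod_eq_iff)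

end

instance upper :: ("{finite, linorder}") wellorder
proof
  fix P :: "'a upper \<Rightarrow> bool" and a
  assume step: "\<And>x. (\<And>y. y < x \<Longrightarrow> P y) \<Longrightarrow> P x"
  show "P a"
  proof (induction "card {y. y < a}" arbitrary: a rule: less_induct)
    case less
    show ?case
    proof (rule step)
      fix y assume "y < a"
      then have "{z. z < y} \<subset> {z. z < a}" by auto
      then have "card {z. z < y} < card {z. z < a}" by (intro psubset_card_mono) auto
      then show "P y" by (rule less)
    qed
  qed
qed

definition sym_of_upper :: "real^('k::{finite,linorder}) upper \<Rightarrow> real^'k::{finite,linorder}^'k::{finite,linorder}" where
  "sym_of_upper v = (\<chi> i j. v $ Abs_upper (min i j, max i j))"

definition upper_of_sym :: "real^'k::{finite,linorder}^'k::{finite,linorder} \<Rightarrow> real^('k::{finite,linorder}) upper" where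
  "upper_of_sym S = (\<chi> m. S $ fst (Rep_upper m) $ snd (Rep_upper m))"

lemma Rep_upper_le: "fst (Rep_upper m) \<le> snd (Rep_upper m)"
  using Rep_upper[of m] by auto

lemma upper_of_sym_of_upper [simp]: "upper_of_sym (sym_of_upper v) = v"
  by (simp add: vec_eq_iff upper_of_sym_def sym_of_upper_def Rep_upper_le min_absorb1 max_absorb2 Rep_upper_inverse)

lemma sym_of_upper_of_sym: "transpose S = S \<Longrightarrow> sym_of_upper (upper_of_sym S) = S"
proof -
  assume "transpose S = S"
  then have s: "S $ i $ j = S $ j $ i" for i j by (metis transpose_def vec_lambda_beta)
  show ?thesis
  proof -
    have "sym_of_upper (upper_of_sym S) $ i $ j = S $ i $ j" for i j
      using s by (cases "i \<le> j") (auto simp: upper_of_sym_def sym_of_upper_def Abs_upper_inverse min_def max_def)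
    then show ?thesis by (simp add: vec_eq_iff)
  qed
qed

lemma transpose_sym_of_upper [simp]: "transpose (sym_of_upper v) = sym_of_upper v"
  by (simp add: vec_eq_iff transpose_def sym_of_upper_def min.commute max.commute)

lemma linear_sym_of_upper: "linear sym_of_upper"
  by (rule linearI) (simp_all add: vec_eq_iff sym_of_upper_def)

lemma linear_upper_of_sym: "linear upper_of_sym"
  by (rule linearI) (simp_all add: vec_eq_iff upper_of_sym_def)

lemma measurable_sym_of_upper [measurable]: "sym_of_upper \<in> borel_measurable borel"
  using linear_sym_of_upper by (auto intro!: borel_measurable_continuous_onI linear_continuous_on simp: linear_linear)

lemma Basis_vec_real: "(Basis :: (real^'m) set) = (\<lambda>i. axis i 1) ` UNIV"
  by (auto simp: Basis_vec_def Basis_real_def)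

lemma prod_Basis_vec: "(\<Prod>b\<in>Basis. f b) = (\<Prod>i\<in>UNIV. f (axis i 1 :: real^'m))"
  unfolding Basis_vec_real by (subst prod.reindex) (auto simp: inj_on_def axis_eq_axis)

lemma lborel_vec_PiM:
  fixes I :: "'i set" and r :: "'m::finite \<Rightarrow> 'i"
  assumes r: "bij_betw r UNIV I"
  shows "(lborel :: (real^'m) measure) = distr (\<Pi>\<^sub>M i\<in>I. lborel) borel (\<lambda>p. \<chi> m. p (r m))"
proof (rule lborel_eqI)
  have fin: "finite I" using bij_betw_finite[OF r] by simp
  interpret product_sigma_finite "\<lambda>_::'i. lborel :: real measure" by standard
  have rI: "r m \<in> I" for m using r by (auto simp: bij_betw_def)
  have [measurable]: "(\<lambda>p. (\<chi> m. p (r m)) :: real^'m) \<in> borel_measurable (\<Pi>\<^sub>M i\<in>I. lborel)"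
  proof (subst borel_measurable_euclidean_space, intro ballI)
    fix b :: "real^'m" assume "b \<in> Basis"
    then obtain m where "b = axis m 1" by (auto simp: Basis_vec_real)
    moreover have "(\<lambda>p. p (r m)) \<in> borel_measurable (\<Pi>\<^sub>M i\<in>I. (lborel :: real measure))"
      using measurable_component_singleton[OF rI, of m "\<lambda>_. lborel :: real measure"] by simp
    ultimately show "(\<lambda>p. (\<chi> m. p (r m)) \<bullet> b) \<in> borel_measurable (\<Pi>\<^sub>M i\<in>I. lborel)"
      by (simp add: inner_axis)
  qed
  fix l u :: "real^'m" assume le: "\<And>b. b \<in> Basis \<Longrightarrow> l \<bullet> b \<le> u \<bullet> b"
  have le': "l $ m \<le> u $ m" for m using le[of "axis m 1"] by (simp add: inner_axis Basis_vec_real)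
  let ?s = "the_inv_into UNIV r"
  have s: "?s (r m) = m" for m using r by (simp add: bij_betw_def the_inv_into_f_f)
  have "(\<lambda>p. \<chi> m. p (r m)) -` box l u \<inter> space (\<Pi>\<^sub>M i\<in>I. lborel) = (\<Pi>\<^sub>E i\<in>I. {l $ ?s i <..< u $ ?s i})"
    (is "?L = ?R")
  proof (rule set_eqI)
    fix p
    have I: "I = range r" using r by (simp add: bij_betw_def)
    show "p \<in> ?L \<longleftrightarrow> p \<in> ?R"
      by (auto simp: mem_box_cart space_PiM PiE_iff I s)
  qed
  then have "emeasure (distr (\<Pi>\<^sub>M i\<in>I. lborel) borel (\<lambda>p. \<chi> m. p (r m))) (box l u) = (\<Prod>i\<in>I. emeasure lborel {l $ ?s i <..< u $ ?s i})"
    using fin by (simp add: emeasure_distr emeasure_PiM)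
  also have "\<dots> = (\<Prod>m\<in>UNIV. emeasure lborel {l $ m <..< u $ m})"
    by (subst prod.reindex_bij_betw[OF r, symmetric]) (simp add: s)
  also have "\<dots> = ennreal (\<Prod>m\<in>UNIV. u $ m - l $ m)"
    using le' by (simp add: prod_ennreal)
  also have "(\<Prod>m\<in>UNIV. u $ m - l $ m) = (\<Prod>b\<in>Basis. (u - l) \<bullet> b)"
    by (simp add: prod_Basis_vec inner_axis)
  finally show "emeasure (distr (\<Pi>\<^sub>M i\<in>I. lborel) borel (\<lambda>p. \<chi> m. p (r m))) (box l u) = ennreal (\<Prod>b\<in>Basis. (u - l) \<bullet> b)" .
qed simp

definition sym_lborel :: "(real^'k::{finite,linorder}^'k::{finite,linorder}) measure" where
  "sym_lborel = distr lborel borel sym_of_upper"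

lemma Rep_Abs_min_max: "Rep_upper (Abs_upper (min i j, max i j)) = (min i j, max i (j::'k::linorder))"
  by (rule Abs_upper_inverse) (auto simp: min_def max_def)

lemma bij_Rep_upper: "bij_betw Rep_upper UNIV {(i::'k::linorder, j). i \<le> j}"
  by (rule bij_betwI[where g=Abs_upper]) (auto simp: Rep_upper_inverse Abs_upper_inverse, metis Rep_upper_le fst_conv snd_conv)

lemma sym_lebesgue_eq: "(sym_lebesgue :: (real^'k::{finite,linorder}^'k::{finite,linorder}) measure) = completion sym_lborel"
proof -
  let ?I = "{(i::'k, j). i \<le> j}"
  let ?t = "\<lambda>p :: 'k \<times> 'k \<Rightarrow> real. (\<chi> m. p (Rep_upper m)) :: real^('k::{finite,linorder}) upper"
  have r: "bij_betw Rep_upper UNIV ?I" by (rule bij_Rep_upper)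
  note l = lborel_vec_PiM[OF r]
  have tm: "?t \<in> (\<Pi>\<^sub>M ij\<in>?I. lborel) \<rightarrow>\<^sub>M borel"
  proof (subst borel_measurable_euclidean_space, intro ballI)
    fix b :: "real^('k::{finite,linorder}) upper" assume "b \<in> Basis"
    then obtain m where "b = axis m 1" by (auto simp: Basis_vec_real)
    moreover have "(\<lambda>p. p (Rep_upper m)) \<in> borel_measurable (\<Pi>\<^sub>M i\<in>?I. (lborel :: real measure))"
      using measurable_component_singleton[OF Rep_upper, of m "\<lambda>_. lborel :: real measure"] by simp
    ultimately show "(\<lambda>p. ?t p \<bullet> b) \<in> borel_measurable (\<Pi>\<^sub>M i\<in>?I. lborel)"
      by (simp add: inner_axis)
  qed
  have "sym_of_upper (?t p) = sym_mat_of p" for p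
    by (simp add: vec_eq_iff sym_of_upper_def sym_mat_of_def Rep_Abs_min_max)
  then have "sym_of_upper \<circ> ?t = sym_mat_of" by (auto simp: fun_eq_iff)
  then have "sym_lborel = distr (\<Pi>\<^sub>M ij\<in>?I. lborel) borel sym_mat_of"
    unfolding sym_lborel_def by (subst l) (simp add: distr_distr[OF measurable_sym_of_upper tm])
  then show ?thesis by (simp add: sym_lebesgue_def)
qed

lemma sets_sym_lborel [simp, measurable_cong]: "sets sym_lborel = sets borel"
  by (simp add: sym_lborel_def)

lemma space_sym_lborel [simp]: "space sym_lborel = UNIV"
  by (simp add: sym_lborel_def)

lemma nn_integral_sym_lborel:
  "h \<in> borel_measurable borel \<Longrightarrow> (\<integral>\<^sup>+S. h S \<partial>sym_lborel) = (\<integral>\<^sup>+v. h (sym_of_upper v) \<partial>lborel)"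
  unfolding sym_lborel_def by (subst nn_integral_distr) auto

lemma bounded_sym_of_upper_vimage:
  assumes "bounded B" shows "bounded (sym_of_upper -` B)"
proof -
  have "bounded (upper_of_sym ` B)"
    using assms linear_upper_of_sym by (intro bounded_linear_image) (auto simp: linear_linear)
  moreover have "sym_of_upper -` B \<subseteq> upper_of_sym ` B" by (auto simp: image_iff) (metis upper_of_sym_of_upper)
  ultimately show ?thesis by (rule bounded_subset)
qed

lemma emeasure_sym_lborel:
  "A \<in> sets borel \<Longrightarrow> emeasure sym_lborel A = emeasure lborel (sym_of_upper -` A)"
  unfolding sym_lborel_def by (subst emeasure_distr) auto

lemma emeasure_sym_lborel_bounded:
  assumes "bounded A" "A \<in> sets borel" shows "emeasure sym_lborel A < \<infinity>"
  unfolding emeasure_sym_lborel[OF assms(2)] by (rule emeasure_bounded_finite[OF bounded_sym_of_upper_vimage[OF assms(1)]])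

lemma emeasure_sym_lborel_open:
  assumes "open A" "S \<in> A" "transpose S = S" shows "emeasure sym_lborel A \<noteq> 0"
proof -
  have "open (sym_of_upper -` A)"
    using assms(1) linear_sym_of_upper by (intro open_vimage) (auto intro: linear_continuous_on simp: linear_linear)
  moreover have "upper_of_sym S \<in> sym_of_upper -` A" using assms by (simp add: sym_of_upper_of_sym)
  ultimately have "emeasure lborel (sym_of_upper -` A) \<noteq> 0" by (intro emeasure_lborel_open_pos) auto
  then show ?thesis using assms by (simp add: emeasure_sym_lborel)
qed

lemma sigma_finite_sym_lborel: "sigma_finite_measure sym_lborel"
proof
  show "\<exists>A::(real^'a::{finite,linorder}^'a::{finite,linorder}) set set. countable A \<and> A \<subseteq> sets sym_lborel \<and> \<Union> A = space sym_lborel \<and> (\<forall>a\<in>A. emeasure sym_lborel a \<noteq> \<infinity>)"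
  proof (intro exI[of _ "range (\<lambda>n::nat. cball 0 (real n))"] conjI)
    show "\<Union> (range (\<lambda>n::nat. cball (0::real^'a::{finite,linorder}^'a::{finite,linorder}) (real n))) = space sym_lborel"
      by (auto simp: real_arch_simple)
    show "\<forall>a\<in>range (\<lambda>n::nat. cball (0::real^'a::{finite,linorder}^'a::{finite,linorder}) (real n)). emeasure sym_lborel a \<noteq> \<infinity>"
      using emeasure_sym_lborel_bounded[of "cball (0::real^'a::{finite,linorder}^'a::{finite,linorder}) (real _)"] by (auto simp: less_top)
  qed auto
qed

lemma scales_sym_lborel:
  assumes T: "T \<in> borel_measurable borel" and eq: "\<And>v. T (sym_of_upper v) = sym_of_upper (L v)" and L: "scales lborel L c"
  shows "scales sym_lborel T c"
  unfolding scales_def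
proof (intro conjI ballI)
  show "T \<in> sym_lborel \<rightarrow>\<^sub>M sym_lborel" using T by (simp add: measurable_cong_sets[OF sets_sym_lborel sets_sym_lborel])
  show "0 < c" using L by (rule scalesD)
  fix h :: "real^'a::{finite,linorder}^'a::{finite,linorder} \<Rightarrow> ennreal" assume "h \<in> borel_measurable sym_lborel"
  then have h[measurable]: "h \<in> borel_measurable borel" by (simp add: measurable_cong_sets[OF sets_sym_lborel refl])
  have hT: "(\<lambda>x. h (T x)) \<in> borel_measurable borel" using T by measurable
  have "(\<lambda>v. h (sym_of_upper v)) \<in> borel_measurable lborel" by measurable
  from scalesD(3)[OF L this]
  show "ennreal c * (\<integral>\<^sup>+x. h (T x) \<partial>sym_lborel) = (\<integral>\<^sup>+x. h x \<partial>sym_lborel)"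
    by (simp add: nn_integral_sym_lborel[OF hT] nn_integral_sym_lborel[OF h] eq)
qed

lemma scales_diagonal_vec:
  fixes c :: "real^'m"
  assumes c: "\<And>i. 0 < c $ i"
  shows "scales lborel (\<lambda>v::real^'m. \<chi> i. c $ i * v $ i) (\<Prod>i\<in>UNIV. c $ i)"
proof -
  have T: "(\<Sum>b\<in>Basis. ((c \<bullet> b) * (v \<bullet> b)) *\<^sub>R b) = (\<chi> i. c $ i * v $ i)" for v :: "real^'m"
  proof -
    have "(\<Sum>b\<in>Basis. ((c \<bullet> b) * (v \<bullet> b)) *\<^sub>R b) = (\<Sum>i\<in>UNIV. (c $ i * v $ i) *\<^sub>R axis i 1)"
      unfolding Basis_vec_real by (subst sum.reindex) (auto simp: inj_on_def axis_eq_axis inner_axis)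
    also have "\<dots> = (\<chi> i. c $ i * v $ i)"
      by (simp add: vec_eq_iff axis_def if_distrib[of "(*) _"] cong: if_cong)
    finally show ?thesis by simp
  qed
  have "0 < c \<bullet> b" if "b \<in> Basis" for b using c that by (auto simp: Basis_vec_real inner_axis)
  from scales_diagonal[of "\<lambda>b. c \<bullet> b", OF this] show ?thesis
    by (simp only: T prod_Basis_vec inner_axis) simp
qed

lemma prod_upper: "(\<Prod>m\<in>UNIV. f (Rep_upper m)) = (\<Prod>p\<in>{(i::'k::{finite,linorder}, j). i \<le> j}. f p)"
  by (rule prod.reindex_bij_betw[OF bij_Rep_upper])

text \<open>
  Among the pairs \<open>i \<le> j\<close> every index occurs \<open>k + 1\<close> times: once with each other index and twice in its
  diagonal pair.
\<close>

lemma prod_upper_mult: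
  fixes d :: "'k::{finite,linorder} \<Rightarrow> real"
  shows "(\<Prod>(i, j)\<in>{(i, j). i \<le> j}. d i * d j) = (\<Prod>i\<in>UNIV. d i) ^ (CARD('k) + 1)"
proof -
  let ?U = "{(i::'k, j). i \<le> j}" and ?D = "{(i::'k, j). i < j}"
  have "(\<Prod>(i, j)\<in>?U. d j) = (\<Prod>(i, j)\<in>{(i, j). j \<le> i}. d i)"
    by (rule prod.reindex_bij_witness[of _ prod.swap prod.swap]) auto
  also have "{(i::'k, j). j \<le> i} = {(i, j). j < i} \<union> (\<lambda>i. (i, i)) ` UNIV" by auto
  also have "(\<Prod>(i, j)\<in>\<dots>. d i) = (\<Prod>(i, j)\<in>{(i::'k, j). j < i}. d i) * (\<Prod>(i, j)\<in>(\<lambda>i. (i, i)) ` UNIV. d i)"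
    by (intro prod.union_disjoint) auto
  also have "(\<Prod>(i, j)\<in>(\<lambda>i. (i, i)) ` UNIV. d i) = (\<Prod>i\<in>UNIV. d i)"
    by (subst prod.reindex) (auto simp: inj_on_def)
  finally have 1: "(\<Prod>(i, j)\<in>?U. d j) = (\<Prod>(i, j)\<in>{(i, j). j < i}. d i) * (\<Prod>i\<in>UNIV. d i)" .
  have "(\<Prod>(i, j)\<in>?U. d i * d j) = (\<Prod>(i, j)\<in>?U. d i) * (\<Prod>(i, j)\<in>?U. d j)"
    by (simp add: split_def prod.distrib)
  also have "\<dots> = ((\<Prod>(i, j)\<in>?U. d i) * (\<Prod>(i, j)\<in>{(i, j). j < i}. d i)) * (\<Prod>i\<in>UNIV. d i)"
    by (simp add: 1)
  also have "(\<Prod>(i, j)\<in>?U. d i) * (\<Prod>(i, j)\<in>{(i, j). j < i}. d i) = (\<Prod>(i, j)\<in>?U \<union> {(i, j). j < i}. d i)"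
    by (intro prod.union_disjoint[symmetric]) auto
  also have "?U \<union> {(i, j). j < i} = UNIV \<times> UNIV" by auto
  also have "(\<Prod>(i, j::'k)\<in>UNIV \<times> UNIV. d i) = (\<Prod>i\<in>UNIV. \<Prod>j\<in>(UNIV::'k set). d i)"
    by (rule prod.cartesian_product[symmetric])
  also have "\<dots> = (\<Prod>i\<in>UNIV. d i) ^ CARD('k)" by (simp add: prod_power_distrib)
  finally show ?thesis by simp
qed

lemma congruence_cancel:
  fixes A B :: "real^'n^'n"
  assumes "A ** B = mat 1"
  shows "transpose B ** (transpose A ** S ** A) ** B = S"
proof -
  have "transpose B ** transpose A = mat 1" using assms by (metis matrix_transpose_mul transpose_mat)
  moreover have "transpose B ** (transpose A ** S ** A) ** B = (transpose B ** transpose A) ** S ** (A ** B)"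
    by (simp add: matrix_mul_assoc)
  ultimately show ?thesis using assms by (simp add: matrix_mul_lid matrix_mul_rid)
qed

lemma scales_conj_exists:
  fixes A :: "real^'k::{finite,linorder}^'k::{finite,linorder}"
  assumes "det A \<noteq> 0"
  obtains c where "scales sym_lborel (\<lambda>S. transpose A ** S ** A) c"
proof -
  obtain B where B: "A ** B = mat 1" using matrix_inverse_exists[OF assms] by blast
  define L where "L v = upper_of_sym (transpose A ** sym_of_upper v ** A)" for v
  have eq: "transpose A ** sym_of_upper v ** A = sym_of_upper (L v)" for v
    unfolding L_def by (simp add: sym_of_upper_of_sym transpose_conj_symmetric)
  have "linear (\<lambda>v. (\<lambda>X. X ** A) ((\<lambda>X. transpose A ** X) (sym_of_upper v)))"
    by (intro linear_compose[OF _ linear_matrix_mult_right, unfolded comp_def]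
        linear_compose[OF _ linear_matrix_mult_left, unfolded comp_def] linear_sym_of_upper)
  then have lin: "linear L" unfolding L_def using linear_compose[OF _ linear_upper_of_sym] by (auto simp: comp_def)
  have "inj L"
  proof (rule injI)
    fix v w assume "L v = L w"
    then have "transpose A ** sym_of_upper v ** A = transpose A ** sym_of_upper w ** A" by (simp add: eq)
    then have "sym_of_upper v = sym_of_upper w" using congruence_cancel[OF B] by metis
    then show "v = w" by (metis upper_of_sym_of_upper)
  qed
  with lin obtain c where "scales lborel L c" using scales_linear_exists by blast
  then have "scales sym_lborel (\<lambda>S. transpose A ** S ** A) c"
    by (intro scales_sym_lborel[where L=L, OF _ eq]) measurable
  then show thesis by (rule that)
qed

text \<open>
  Conjugation preserves the unit ball of the Frobenius norm. In upper triangular coordinates it is not an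
  isometry, since the Frobenius norm counts off-diagonal entries twice; hence the detour over an
  invariant set.
\<close>

lemma scales_conj_orthogonal:
  fixes U :: "real^'k::{finite,linorder}^'k::{finite,linorder}"
  assumes U: "orthogonal_matrix U"
  shows "scales sym_lborel (\<lambda>S. transpose U ** S ** U) 1"
proof -
  obtain c where c: "scales sym_lborel (\<lambda>S. transpose U ** S ** U) c"
    using scales_conj_exists det_nonzero_orthogonal[OF U] by blast
  have "c = 1"
  proof (rule scales_invariant_set[OF c, of "ball 0 1"])
    show "emeasure sym_lborel (ball (0::real^'k::{finite,linorder}^'k::{finite,linorder}) 1) \<noteq> 0"
      by (rule emeasure_sym_lborel_open[of _ 0]) (auto simp: transpose_def vec_eq_iff)
    show "emeasure sym_lborel (ball (0::real^'k::{finite,linorder}^'k::{finite,linorder}) 1) \<noteq> \<infinity>"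
      using emeasure_sym_lborel_bounded[of "ball (0::real^'k::{finite,linorder}^'k::{finite,linorder}) 1"] by auto
  qed (use U in \<open>auto simp: norm_orthogonal_mult_left norm_orthogonal_mult_right\<close>)
  with c show ?thesis by simp
qed

lemma scales_conj_diagm:
  fixes d :: "real^'k::{finite,linorder}"
  assumes d: "\<And>i. 0 < d $ i"
  shows "scales sym_lborel (\<lambda>S. transpose (diagm d) ** S ** diagm d) ((\<Prod>i\<in>UNIV. d $ i) ^ (CARD('k) + 1))"
proof -
  define c :: "real^('k::{finite,linorder}) upper" where "c = (\<chi> m. d $ fst (Rep_upper m) * d $ snd (Rep_upper m))"
  have eq: "transpose (diagm d) ** sym_of_upper v ** diagm d = sym_of_upper (\<chi> m. c $ m * v $ m)" for v
  proof -
    have "(transpose (diagm d) ** sym_of_upper v ** diagm d) $ i $ j = d $ i * sym_of_upper v $ i $ j * d $ j" for i j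
      by (simp add: matrix_matrix_mult_def transpose_diagm) (simp add: diagm_def if_distrib[of "(*) _"] if_distrib[of "\<lambda>z. z * _"] cong: if_cong)
    then show ?thesis
      by (auto simp: vec_eq_iff sym_of_upper_def c_def Abs_upper_inverse min_def max_def)
  qed
  have "(\<Prod>i\<in>UNIV. c $ i) = (\<Prod>i\<in>UNIV. d $ i) ^ (CARD('k) + 1)"
    using prod_upper[of "\<lambda>(i, j). d $ i * d $ j"] prod_upper_mult[of "\<lambda>i. d $ i"] by (simp add: c_def split_def)
  moreover have "scales lborel (\<lambda>v::real^('k::{finite,linorder}) upper. \<chi> i. c $ i * v $ i) (\<Prod>i\<in>UNIV. c $ i)"
    using d by (intro scales_diagonal_vec) (simp add: c_def)
  ultimately show ?thesis by (intro scales_sym_lborel[where L="\<lambda>v. \<chi> m. c $ m * v $ m", OF _ eq]) simp_all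
qed

lemma scales_conj:
  fixes A :: "real^'k::{finite,linorder}^'k::{finite,linorder}"
  assumes "det A \<noteq> 0"
  shows "scales sym_lborel (\<lambda>S. transpose A ** S ** A) (\<bar>det A\<bar> ^ (CARD('k) + 1))"
proof -
  obtain U V d where U: "orthogonal_matrix U" "orthogonal_matrix V" "A = U ** diagm d ** V"
    "\<And>i. 0 < d $ i" "\<bar>det A\<bar> = (\<Prod>i\<in>UNIV. d $ i)"
    using singular_value_decomposition[OF assms] by blast
  show ?thesis
    using scales_compose[OF scales_conj_orthogonal[OF U(2)] scales_compose[OF scales_conj_diagm[OF U(4)] scales_conj_orthogonal[OF U(1)]]] U(5)
    by (simp add: U(3) matrix_mul_assoc matrix_transpose_mul)
qed

section \<open>The distribution of the Gram matrix\<close>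

text \<open>
  Haar measure of \<open>GL(k)\<close>. Singular matrices get the weight \<open>inverse 0 = 0\<close>.
\<close>

definition gl_haar :: "(real^'k^'k) measure" where
  "gl_haar = density lborel (\<lambda>A. ennreal (inverse (\<bar>det A\<bar> ^ CARD('k))))"

lemma sets_gl_haar [simp, measurable_cong]: "sets gl_haar = sets borel"
  by (simp add: gl_haar_def)

lemma nn_integral_gl_haar:
  fixes f :: "real^'k^'k \<Rightarrow> ennreal"
  assumes [measurable]: "f \<in> borel_measurable borel"
  shows "(\<integral>\<^sup>+A. f A \<partial>gl_haar) = (\<integral>\<^sup>+A. ennreal (inverse (\<bar>det A\<bar> ^ CARD('k))) * f A \<partial>lborel)"
  unfolding gl_haar_def by (subst nn_integral_density) auto

lemma sigma_finite_gl_haar: "sigma_finite_measure (gl_haar :: (real^'k^'k) measure)"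
  unfolding gl_haar_def
  by (subst sigma_finite_measure.sigma_finite_iff_density_finite[OF sigma_finite_lborel]) auto

lemma AE_gl_haar_det: "AE A in gl_haar. det A \<noteq> 0"
  unfolding gl_haar_def by (subst AE_density) auto

lemma gl_haar_invariant_map:
  fixes f :: "real^'k^'k \<Rightarrow> ennreal"
  assumes f[measurable]: "f \<in> borel_measurable borel" and b: "b \<noteq> 0"
    and L: "scales lborel L (\<bar>b\<bar> ^ CARD('k))" "\<And>A. det (L A) = b * det A"
  shows "(\<integral>\<^sup>+A. f (L A) \<partial>gl_haar) = (\<integral>\<^sup>+A. f A \<partial>gl_haar)"
proof -
  let ?w = "\<lambda>A::real^'k^'k. ennreal (inverse (\<bar>det A\<bar> ^ CARD('k)))"
  have [measurable]: "L \<in> borel_measurable borel" using scalesD(1)[OF L(1)] by simp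
  have w: "?w A = ennreal (\<bar>b\<bar> ^ CARD('k)) * ?w (L A)" for A
    using b by (simp add: L(2) abs_mult ennreal_mult[symmetric] power_mult_distrib field_simps)
  have "(\<integral>\<^sup>+A. f (L A) \<partial>gl_haar) = (\<integral>\<^sup>+A. ?w A * f (L A) \<partial>lborel)"
    by (rule nn_integral_gl_haar) measurable
  also have "\<dots> = (\<integral>\<^sup>+A. ennreal (\<bar>b\<bar> ^ CARD('k)) * (?w (L A) * f (L A)) \<partial>lborel)"
    by (rule nn_integral_cong, subst w, rule mult.assoc)
  also have "\<dots> = ennreal (\<bar>b\<bar> ^ CARD('k)) * (\<integral>\<^sup>+A. ?w (L A) * f (L A) \<partial>lborel)"
    by (rule nn_integral_cmult) simp
  also have "\<dots> = (\<integral>\<^sup>+A. ?w A * f A \<partial>lborel)" by (rule scalesD(3)[OF L(1)]) simp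
  finally show ?thesis by (simp add: nn_integral_gl_haar)
qed

lemma gl_haar_invariant:
  fixes f :: "real^'k^'k \<Rightarrow> ennreal" and B :: "real^'k^'k"
  assumes f: "f \<in> borel_measurable borel" and B: "det B \<noteq> 0"
  shows "(\<integral>\<^sup>+A. f (B ** A) \<partial>gl_haar) = (\<integral>\<^sup>+A. f A \<partial>gl_haar)"
    and "(\<integral>\<^sup>+A. f (A ** B) \<partial>gl_haar) = (\<integral>\<^sup>+A. f A \<partial>gl_haar)"
  by (rule gl_haar_invariant_map[OF f B scales_mult_left[OF B]], simp add: det_mul)
    (rule gl_haar_invariant_map[OF f B scales_mult_right[OF B]], simp add: det_mul)

text \<open>
  The action \<open>S \<mapsto> A\<^sup>T S A\<close> is transitive on the positive definite cone: \<open>S = B\<^sup>T B\<close> for \<open>B = S\<^sup>1\<^sup>/\<^sup>2\<close>. Then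
  \<open>A\<^sup>T S A = (B A)\<^sup>T (B A)\<close>, and left invariance removes \<open>B\<close> from the integral over \<open>A\<close>. For the inverse action
  \<open>B A\<^sup>-\<^sup>1\<close> is the inverse of \<open>A B\<^sup>-\<^sup>1\<close>, and right invariance removes \<open>B\<close>. The first factor on either side
  depends on \<open>f\<close> and \<open>h\<close> only, not on \<open>M\<close>.
\<close>

lemma gl_invariant_integrals_proportional:
  fixes \<pi> :: "'s \<Rightarrow> real^'k^'k" and act :: "real^'k^'k \<Rightarrow> 's \<Rightarrow> 's"
  assumes sf: "sigma_finite_measure M"
    and \<pi>[measurable]: "\<pi> \<in> borel_measurable M"
    and act: "\<And>A s. \<pi> (act A s) = transpose A ** \<pi> s ** A"
    and inv: "\<And>A h. det A \<noteq> 0 \<Longrightarrow> h \<in> borel_measurable M \<Longrightarrow> (\<integral>\<^sup>+s. h (act A s) \<partial>M) = (\<integral>\<^sup>+s. h s \<partial>M)"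
    and pd: "AE s in M. \<pi> s \<in> pos_def_mats"
    and [measurable]: "f \<in> borel_measurable borel" "h \<in> borel_measurable borel"
  shows "(\<integral>\<^sup>+A. f (transpose A ** A) \<partial>gl_haar) * (\<integral>\<^sup>+s. h (\<pi> s) \<partial>M) =
    (\<integral>\<^sup>+A. h (transpose (matrix_inverse A) ** matrix_inverse A) \<partial>gl_haar) * (\<integral>\<^sup>+s. f (\<pi> s) \<partial>M)"
proof (rule invariant_integrals_proportional[where T=act and T'="\<lambda>A. act (matrix_inverse A)"])
  show "AE A in gl_haar. (\<integral>\<^sup>+s. f (\<pi> (act A s)) * h (\<pi> s) \<partial>M) = (\<integral>\<^sup>+s. f (\<pi> s) * h (\<pi> (act (matrix_inverse A) s)) \<partial>M)"
    using AE_gl_haar_det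
  proof eventually_elim
    case (elim A)
    note I = congruence_cancel[OF matrix_inverse(1)[OF elim]]
    have "(\<integral>\<^sup>+s. f (\<pi> (act A s)) * h (\<pi> (act (matrix_inverse A) (act A s))) \<partial>M) = (\<integral>\<^sup>+s. f (\<pi> s) * h (\<pi> (act (matrix_inverse A) s)) \<partial>M)"
      by (rule inv[OF elim]) (simp add: act)
    then show ?case by (simp add: act I)
  qed
  show "AE s in M. (\<integral>\<^sup>+A. f (\<pi> (act A s)) \<partial>gl_haar) = (\<integral>\<^sup>+A. f (transpose A ** A) \<partial>gl_haar)"
    using pd
  proof eventually_elim
    case (elim s)
    define B where "B = pos_def_sqrt (\<pi> s)"
    have B: "B \<in> pos_def_mats" "B ** B = \<pi> s" using pos_def_sqrt[OF elim] by (auto simp: B_def)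
    have dB: "det B \<noteq> 0" using pos_def_det_pos[OF B(1)] by simp
    have tB: "transpose B = B" using B(1) by (simp add: pos_def_mats_def)
    have "(\<integral>\<^sup>+A. f (\<pi> (act A s)) \<partial>gl_haar) = (\<integral>\<^sup>+A. f (transpose (B ** A) ** (B ** A)) \<partial>gl_haar)"
      by (simp add: act B(2)[symmetric] matrix_transpose_mul tB matrix_mul_assoc)
    also have "\<dots> = (\<integral>\<^sup>+A. f (transpose A ** A) \<partial>gl_haar)"
      by (rule gl_haar_invariant(1)[of "\<lambda>A. f (transpose A ** A)", OF _ dB]) simp
    finally show ?case .
  qed
  show "AE s in M. (\<integral>\<^sup>+A. h (\<pi> (act (matrix_inverse A) s)) \<partial>gl_haar) = (\<integral>\<^sup>+A. h (transpose (matrix_inverse A) ** matrix_inverse A) \<partial>gl_haar)"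
    using pd
  proof eventually_elim
    case (elim s)
    define B where "B = pos_def_sqrt (\<pi> s)"
    have B: "B \<in> pos_def_mats" "B ** B = \<pi> s" using pos_def_sqrt[OF elim] by (auto simp: B_def)
    have dB: "det B \<noteq> 0" using pos_def_det_pos[OF B(1)] by simp
    have tB: "transpose B = B" using B(1) by (simp add: pos_def_mats_def)
    define C where "C = matrix_inverse B"
    have C: "B ** C = mat 1" "C ** B = mat 1" using matrix_inverse[OF dB] by (auto simp: C_def)
    have dC: "det C \<noteq> 0" using C(1) by (metis det_I det_mul mult_zero_right zero_neq_one)
    have inv_AC: "matrix_inverse (A ** C) = B ** matrix_inverse A" if "det A \<noteq> 0" for A
    proof (rule right_inverse_unique)
      show "(A ** C) ** matrix_inverse (A ** C) = mat 1" using that dC by (intro matrix_inverse) (simp add: det_mul)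
      have "(A ** C) ** (B ** matrix_inverse A) = A ** (C ** B) ** matrix_inverse A" by (simp add: matrix_mul_assoc)
      then show "(A ** C) ** (B ** matrix_inverse A) = mat 1"
        using matrix_inverse[OF that] C by (simp add: matrix_mul_rid)
    qed
    have "(\<integral>\<^sup>+A. h (\<pi> (act (matrix_inverse A) s)) \<partial>gl_haar) = (\<integral>\<^sup>+A. h (transpose (matrix_inverse (A ** C)) ** matrix_inverse (A ** C)) \<partial>gl_haar)"
    proof (rule nn_integral_cong_AE)
      show "AE A in gl_haar. h (\<pi> (act (matrix_inverse A) s)) = h (transpose (matrix_inverse (A ** C)) ** matrix_inverse (A ** C))"
        using AE_gl_haar_det
      proof eventually_elim
        case (elim A)
        then show ?case by (simp add: inv_AC act B(2)[symmetric] matrix_transpose_mul tB matrix_mul_assoc)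
      qed
    qed
    also have "\<dots> = (\<integral>\<^sup>+A. h (transpose (matrix_inverse A) ** matrix_inverse A) \<partial>gl_haar)"
      by (rule gl_haar_invariant(2)[of "\<lambda>A. h (transpose (matrix_inverse A) ** matrix_inverse A)", OF _ dC]) simp
    finally show ?case .
  qed
qed (simp_all add: act sf sigma_finite_gl_haar)

text \<open>
  The weight \<open>det S\<close> to the power \<open>- q / 2\<close> turns a measure that \<open>S \<mapsto> A\<^sup>T S A\<close> scales by \<open>\<bar>det A\<bar>\<^sup>q\<close> into an
  invariant one.
\<close>

definition gram_weight :: "nat \<Rightarrow> real^'k^'k \<Rightarrow> real" where
  "gram_weight q S = indicator pos_def_mats S * det S powr (- real q / 2)"

lemma gram_weight_measurable [measurable]: "gram_weight q \<in> borel_measurable borel"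
  unfolding gram_weight_def[abs_def] by measurable

lemma gram_weight_nonneg: "0 \<le> gram_weight q S"
  by (simp add: gram_weight_def)

lemma pos_def_conj_iff:
  fixes A :: "real^'k^'k"
  assumes "det A \<noteq> 0"
  shows "transpose A ** S ** A \<in> pos_def_mats \<longleftrightarrow> S \<in> pos_def_mats"
proof
  obtain B where B: "A ** B = mat 1" using matrix_inverse_exists[OF assms] by blast
  have dB: "det B \<noteq> 0" using B by (metis det_I det_mul mult_zero_right zero_neq_one)
  show "S \<in> pos_def_mats" if "transpose A ** S ** A \<in> pos_def_mats"
    using pos_def_conj[OF that, of B, OF det_nonzero_mult_vec[OF dB]] congruence_cancel[OF B] by simp
  show "transpose A ** S ** A \<in> pos_def_mats" if "S \<in> pos_def_mats"
    using pos_def_conj[OF that, of A, OF det_nonzero_mult_vec[OF assms]] by simp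
qed

lemma gram_weight_conj:
  fixes A :: "real^'k^'k"
  assumes "det A \<noteq> 0"
  shows "\<bar>det A\<bar> ^ q * gram_weight q (transpose A ** S ** A) = gram_weight q S"
proof (cases "S \<in> pos_def_mats")
  case True
  have "det (transpose A ** S ** A) = \<bar>det A\<bar>\<^sup>2 * det S" by (simp add: det_mul power2_eq_square)
  moreover have "(\<bar>det A\<bar>\<^sup>2 * det S) powr (- real q / 2) = (\<bar>det A\<bar>\<^sup>2) powr (- real q / 2) * det S powr (- real q / 2)"
    by (rule powr_mult)
  moreover have "(\<bar>det A\<bar>\<^sup>2) powr (- real q / 2) = inverse (\<bar>det A\<bar> ^ q)"
  proof -
    have d: "0 < \<bar>det A\<bar>" using assms by simp
    have "(\<bar>det A\<bar>\<^sup>2) powr (- real q / 2) = \<bar>det A\<bar> powr (real 2 * (- real q / 2))"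
      by (simp only: powr_realpow[OF d, symmetric] powr_powr)
    also have "\<dots> = inverse (\<bar>det A\<bar> powr (real q))" by (simp add: powr_minus)
    finally show ?thesis using assms by (simp add: powr_realpow)
  qed
  ultimately show ?thesis using True assms by (simp add: gram_weight_def pos_def_conj_iff[OF assms])
qed (simp add: gram_weight_def pos_def_conj_iff[OF assms])

definition weighted :: "nat \<Rightarrow> ('s \<Rightarrow> real^'k^'k) \<Rightarrow> 's measure \<Rightarrow> 's measure" where
  "weighted q \<pi> N = density N (\<lambda>s. ennreal (gram_weight q (\<pi> s)))"

lemma nn_integral_weighted:
  assumes [measurable]: "\<pi> \<in> borel_measurable N" "h \<in> borel_measurable N"
  shows "(\<integral>\<^sup>+s. h s \<partial>weighted q \<pi> N) = (\<integral>\<^sup>+s. ennreal (gram_weight q (\<pi> s)) * h s \<partial>N)"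
  unfolding weighted_def by (subst nn_integral_density) auto

lemma weighted_invariant:
  assumes [measurable]: "\<pi> \<in> borel_measurable N" and h[measurable]: "h \<in> borel_measurable N"
    and act: "\<And>s. \<pi> (act A s) = transpose A ** \<pi> s ** A" and sc: "scales N (act A) (\<bar>det A\<bar> ^ q)"
    and A: "det A \<noteq> 0"
  shows "(\<integral>\<^sup>+s. h (act A s) \<partial>weighted q \<pi> N) = (\<integral>\<^sup>+s. h s \<partial>weighted q \<pi> N)"
proof -
  note [measurable] = scalesD(1)[OF sc]
  let ?h = "\<lambda>s. ennreal (gram_weight q (\<pi> s)) * h s"
  have "(\<integral>\<^sup>+s. h (act A s) \<partial>weighted q \<pi> N) = (\<integral>\<^sup>+s. ennreal (gram_weight q (\<pi> s)) * h (act A s) \<partial>N)"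
    by (rule nn_integral_weighted) measurable
  also have "\<dots> = (\<integral>\<^sup>+s. ennreal (\<bar>det A\<bar> ^ q) * ?h (act A s) \<partial>N)"
    by (simp add: act gram_weight_conj[OF A, symmetric, of q "\<pi> _"] ennreal_mult gram_weight_nonneg mult.assoc)
  also have "\<dots> = ennreal (\<bar>det A\<bar> ^ q) * (\<integral>\<^sup>+s. ?h (act A s) \<partial>N)"
    by (rule nn_integral_cmult) measurable
  also have "\<dots> = (\<integral>\<^sup>+s. ?h s \<partial>N)"
    by (rule scalesD(3)[OF sc]) measurable
  also have "\<dots> = (\<integral>\<^sup>+s. h s \<partial>weighted q \<pi> N)"
    by (rule nn_integral_weighted[symmetric]) measurable
  finally show ?thesis .
qed

lemma weighted_proportional:
  fixes \<pi> :: "'s \<Rightarrow> real^'k^'k" and act :: "real^'k^'k \<Rightarrow> 's \<Rightarrow> 's"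
  assumes sf: "sigma_finite_measure N"
    and \<pi>[measurable]: "\<pi> \<in> borel_measurable N"
    and act: "\<And>A s. \<pi> (act A s) = transpose A ** \<pi> s ** A"
    and sc: "\<And>A. det A \<noteq> 0 \<Longrightarrow> scales N (act A) (\<bar>det A\<bar> ^ q)"
    and f[measurable]: "f \<in> borel_measurable borel" and h[measurable]: "h \<in> borel_measurable borel"
  shows "(\<integral>\<^sup>+A. f (transpose A ** A) \<partial>gl_haar) * (\<integral>\<^sup>+s. ennreal (gram_weight q (\<pi> s)) * h (\<pi> s) \<partial>N) =
    (\<integral>\<^sup>+A. h (transpose (matrix_inverse A) ** matrix_inverse A) \<partial>gl_haar) * (\<integral>\<^sup>+s. ennreal (gram_weight q (\<pi> s)) * f (\<pi> s) \<partial>N)"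
proof -
  have sets: "sets (weighted q \<pi> N) = sets N" by (simp add: weighted_def)
  have m: "borel_measurable (weighted q \<pi> N) = borel_measurable N"
    by (rule measurable_cong_sets[OF sets refl])
  have "(\<integral>\<^sup>+A. f (transpose A ** A) \<partial>gl_haar) * (\<integral>\<^sup>+s. h (\<pi> s) \<partial>weighted q \<pi> N) =
    (\<integral>\<^sup>+A. h (transpose (matrix_inverse A) ** matrix_inverse A) \<partial>gl_haar) * (\<integral>\<^sup>+s. f (\<pi> s) \<partial>weighted q \<pi> N)"
  proof (rule gl_invariant_integrals_proportional[where act=act, OF _ _ act _ _ f h])
    show "sigma_finite_measure (weighted q \<pi> N)" unfolding weighted_def
      by (subst sigma_finite_measure.sigma_finite_iff_density_finite[OF sf]) auto
    show "\<pi> \<in> borel_measurable (weighted q \<pi> N)" by (simp add: m)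
    show "AE s in weighted q \<pi> N. \<pi> s \<in> pos_def_mats"
      unfolding weighted_def by (subst AE_density) (auto simp: gram_weight_def split: split_indicator)
    show "(\<integral>\<^sup>+s. h (act A s) \<partial>weighted q \<pi> N) = (\<integral>\<^sup>+s. h s \<partial>weighted q \<pi> N)"
      if "det A \<noteq> 0" "h \<in> borel_measurable (weighted q \<pi> N)" for A h
      using that m by (intro weighted_invariant act sc \<pi>) auto
  qed
  then show ?thesis by (simp add: nn_integral_weighted)
qed

subsection \<open>A test set near the identity\<close>

lemma norm_matrix_vector_le: "norm ((A::real^'k^'n) *v x) \<le> norm A * norm x"
proof -
  have "norm (A *v x) = L2_set (\<lambda>i. \<bar>A $ i \<bullet> x\<bar>) UNIV"
    by (simp add: norm_vec_def matrix_vector_mult_def inner_vec_def)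
  also have "\<dots> \<le> L2_set (\<lambda>i. norm (A $ i) * norm x) UNIV"
    by (intro L2_set_mono Cauchy_Schwarz_ineq2 abs_ge_zero)
  also have "\<dots> = norm A * norm x" by (simp add: norm_vec_def L2_set_left_distrib)
  finally show ?thesis .
qed

text \<open>
  A ball around the identity serves as common test set for the measures that are to be compared: \<open>det\<close> is
  bounded away from \<open>0\<close> and from infinity on it, so all weights are bounded, and its symmetric elements
  are positive definite.
\<close>

lemma near_identity:
  obtains r where "0 < r"
    "\<And>S::real^'k^'k. S \<in> ball (mat 1) r \<Longrightarrow> 1/2 < det S \<and> det S < 2"
    "\<And>S::real^'k^'k. S \<in> ball (mat 1) r \<Longrightarrow> transpose S = S \<Longrightarrow> S \<in> pos_def_mats"
proof -
  have "isCont (det :: real^'k^'k \<Rightarrow> real) (mat 1)"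
    using continuous_on_det[of UNIV "\<lambda>S::real^'k^'k. S"] by (simp add: continuous_on_eq_continuous_at continuous_on_id)
  then obtain d where d: "0 < d" "\<And>S::real^'k^'k. dist S (mat 1) < d \<Longrightarrow> dist (det S) (det (mat 1 :: real^'k^'k)) < 1/2"
    unfolding continuous_at_eps_delta by (metis half_gt_zero zero_less_one)
  show thesis
  proof (rule that)
    show "0 < min d (1/2)" using d by simp
    fix S :: "real^'k^'k" assume S: "S \<in> ball (mat 1) (min d (1/2))"
    have "\<bar>det S - 1\<bar> < 1/2" using d(2)[of S] S by (simp add: dist_real_def dist_commute)
    then show "1/2 < det S \<and> det S < 2" unfolding abs_less_iff by simp
    assume sym: "transpose S = S"
    have "0 < x \<bullet> (S *v x)" if x: "x \<noteq> 0" for x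
    proof -
      have "norm (S - mat 1) < 1/2" using S by (simp add: dist_norm norm_minus_commute)
      have "\<bar>x \<bullet> ((S - mat 1) *v x)\<bar> \<le> norm x * (norm (S - mat 1) * norm x)"
        by (meson Cauchy_Schwarz_ineq2 mult_left_mono norm_ge_zero norm_matrix_vector_le order_trans)
      also have "\<dots> \<le> norm x * (1/2 * norm x)"
        using \<open>norm (S - mat 1) < 1/2\<close> by (intro mult_left_mono mult_right_mono) auto
      also have "\<dots> < x \<bullet> x" using x by (simp add: dot_square_norm power2_eq_square)
      finally show ?thesis by (simp add: matrix_vector_mult_diff_rdistrib inner_diff_right abs_less_iff)
    qed
    then show "S \<in> pos_def_mats" using sym by (simp add: pos_def_mats_def)
  qed
qed

lemma nn_integral_sandwich_finite_pos:
  fixes w :: "'s \<Rightarrow> real"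
  assumes [measurable]: "w \<in> borel_measurable N" and E: "E \<in> sets N" "emeasure N E \<noteq> 0" "emeasure N E \<noteq> \<infinity>"
    and c: "0 < a" "\<And>s. s \<in> E \<Longrightarrow> a \<le> w s" "\<And>s. s \<in> E \<Longrightarrow> w s \<le> b"
  shows "(\<integral>\<^sup>+s. ennreal (w s) * indicator E s \<partial>N) \<noteq> 0" "(\<integral>\<^sup>+s. ennreal (w s) * indicator E s \<partial>N) \<noteq> \<infinity>"
proof -
  have "(\<integral>\<^sup>+s. ennreal a * indicator E s \<partial>N) \<le> (\<integral>\<^sup>+s. ennreal (w s) * indicator E s \<partial>N)"
    using c by (intro nn_integral_mono) (auto split: split_indicator intro!: ennreal_leI)
  moreover have "(\<integral>\<^sup>+s. ennreal a * indicator E s \<partial>N) \<noteq> 0"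
    using E c(1) by (simp add: nn_integral_cmult_indicator)
  ultimately show "(\<integral>\<^sup>+s. ennreal (w s) * indicator E s \<partial>N) \<noteq> 0" by auto
  have "(\<integral>\<^sup>+s. ennreal (w s) * indicator E s \<partial>N) \<le> (\<integral>\<^sup>+s. ennreal b * indicator E s \<partial>N)"
    using c by (intro nn_integral_mono) (auto split: split_indicator intro!: ennreal_leI)
  also have "\<dots> < \<infinity>" using E by (simp add: nn_integral_cmult_indicator ennreal_mult_less_top less_top)
  finally show "(\<integral>\<^sup>+s. ennreal (w s) * indicator E s \<partial>N) \<noteq> \<infinity>" by simp
qed

lemma gram_ball:
  assumes "Q \<in> (stiefel :: (real^'k^'n) set)" "0 < r"
  defines "E \<equiv> {X :: real^'k^'n. transpose X ** X \<in> ball (mat 1) r}"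
  shows "E \<in> sets lborel" "emeasure lborel E \<noteq> 0" "emeasure lborel E \<noteq> \<infinity>"
proof -
  have "E = (\<lambda>X. transpose X ** X) -` ball (mat 1) r" by (auto simp: E_def)
  then have o: "open E" by (auto intro!: open_vimage continuous_intros)
  then show "E \<in> sets lborel" by simp
  have "Q \<in> E" using assms by (simp add: E_def stiefel_def)
  with o show "emeasure lborel E \<noteq> 0" by (intro emeasure_lborel_open_pos) auto
  have "bounded E"
  proof (rule boundedI)
    fix X assume X: "X \<in> E"
    let ?S = "transpose X ** X"
    have "norm (?S - mat 1) < r" using X by (simp add: E_def dist_norm norm_minus_commute)
    then have S: "norm ?S \<le> norm (mat 1 :: real^'k^'k) + r" using norm_triangle_ineq[of "?S - mat 1" "mat 1"] by simp
    have "(norm X)\<^sup>2 = (\<Sum>i\<in>UNIV. ?S $ i $ i)" by (simp add: norm_matrix_sq trace_def)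
    also have "\<dots> \<le> (\<Sum>i\<in>(UNIV::'k set). norm ?S)"
    proof (rule sum_mono)
      fix i
      have "?S $ i $ i \<le> norm (?S $ i)" using component_le_norm_cart[of "?S $ i" i] by simp
      also have "\<dots> \<le> norm ?S" by (rule Finite_Cartesian_Product.norm_nth_le)
      finally show "?S $ i $ i \<le> norm ?S" .
    qed
    also have "\<dots> \<le> CARD('k) * (norm (mat 1 :: real^'k^'k) + r)" using S by (simp add: mult_left_mono)
    finally have "(norm X)\<^sup>2 \<le> CARD('k) * (norm (mat 1 :: real^'k^'k) + r)" .
    then show "norm X \<le> sqrt (CARD('k) * (norm (mat 1 :: real^'k^'k) + r))" by (rule real_le_rsqrt)
  qed
  then show "emeasure lborel E \<noteq> \<infinity>" using emeasure_bounded_finite[of E] by auto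
qed

lemma powr_neg_half_bounds:
  assumes "1/2 < x" "x < (2::real)"
  shows "2 powr (- real q / 2) \<le> x powr (- real q / 2)" "x powr (- real q / 2) \<le> (1/2) powr (- real q / 2)"
  using assms by (auto intro!: powr_mono2')

text \<open>
  Both the law of \<open>X\<^sup>T X\<close> with weight \<open>det\<close> to the power \<open>- n / 2\<close> and \<open>dS\<close> with weight \<open>det\<close> to the power
  \<open>- (k + 1) / 2\<close> are invariant under \<open>GL(k)\<close>, so \<open>weighted_proportional\<close> applies to both with the same \<open>f\<close>
  and \<open>h\<close>. Elimination of the common factors leaves the constant \<open>Wf / Vf\<close>, the quotient of the masses of
  the test ball.
\<close>

theorem gram_distribution:
  assumes "CARD('k::{finite,linorder}) \<le> CARD('n::finite)"
  obtains C :: real where "0 < C"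
    "\<And>g. g \<in> borel_measurable borel \<Longrightarrow>
      (\<integral>\<^sup>+X. g (transpose X ** (X :: real^'k::{finite,linorder}^'n)) \<partial>lborel) =
      ennreal C * (\<integral>\<^sup>+S. ennreal (indicator pos_def_mats S * det S powr ((real CARD('n) - real CARD('k) - 1) / 2)) * g S \<partial>sym_lborel)"
proof -
  let ?n = "CARD('n)" and ?k = "CARD('k)"
  let ?\<pi> = "\<lambda>X. transpose X ** (X :: real^'k::{finite,linorder}^'n)"
  obtain Q where Q: "Q \<in> (stiefel :: (real^'k::{finite,linorder}^'n) set)" using stiefel_nonempty[OF assms] by blast
  obtain r where r: "0 < r" "\<And>S::real^'k::{finite,linorder}^'k::{finite,linorder}. S \<in> ball (mat 1) r \<Longrightarrow> 1/2 < det S \<and> det S < 2"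
    "\<And>S::real^'k::{finite,linorder}^'k::{finite,linorder}. S \<in> ball (mat 1) r \<Longrightarrow> transpose S = S \<Longrightarrow> S \<in> pos_def_mats"
    using near_identity by blast
  let ?B = "ball (mat 1) r :: (real^'k::{finite,linorder}^'k::{finite,linorder}) set"
  let ?f = "indicator ?B :: _ \<Rightarrow> ennreal"
  let ?w = "\<lambda>q S. ennreal (gram_weight q S)"
  have [measurable]: "?B \<in> sets borel" by simp
  have pdB: "S \<in> pos_def_mats" if "S \<in> ?B" "transpose S = S" for S using that r by blast
  have bounds: "2 powr (- real q / 2) \<le> gram_weight q S" "gram_weight q S \<le> (1/2) powr (- real q / 2)"
    if "S \<in> ?B" "transpose S = S" for q S
    using that r(2)[of S] pdB[OF that] powr_neg_half_bounds[of "det S" q] by (auto simp: gram_weight_def)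
  have W: "(\<integral>\<^sup>+X. ?w ?n (?\<pi> X) * ?f (?\<pi> X) \<partial>lborel) \<noteq> 0" "(\<integral>\<^sup>+X. ?w ?n (?\<pi> X) * ?f (?\<pi> X) \<partial>lborel) \<noteq> \<infinity>"
  proof -
    have i: "?f (?\<pi> X) = indicator {X. ?\<pi> X \<in> ?B} X" for X by (simp add: indicator_def)
    have s: "transpose (?\<pi> X) = ?\<pi> X" for X by (simp add: matrix_transpose_mul)
    have b: "2 powr (- real ?n / 2) \<le> gram_weight ?n (?\<pi> X)" "gram_weight ?n (?\<pi> X) \<le> (1/2) powr (- real ?n / 2)"
      if "X \<in> {X. ?\<pi> X \<in> ?B}" for X
      using that by (intro bounds s; simp)+
    have m: "(\<lambda>X. gram_weight ?n (?\<pi> X)) \<in> borel_measurable lborel" by measurable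
    have a: "0 < (2::real) powr (- real ?n / 2)" by simp
    show "(\<integral>\<^sup>+X. ?w ?n (?\<pi> X) * ?f (?\<pi> X) \<partial>lborel) \<noteq> 0" "(\<integral>\<^sup>+X. ?w ?n (?\<pi> X) * ?f (?\<pi> X) \<partial>lborel) \<noteq> \<infinity>"
      unfolding i by (rule nn_integral_sandwich_finite_pos[OF m gram_ball[OF Q r(1)] a b]; assumption)+
  qed
  have V: "(\<integral>\<^sup>+S. ?w (?k + 1) S * ?f S \<partial>sym_lborel) \<noteq> 0" "(\<integral>\<^sup>+S. ?w (?k + 1) S * ?f S \<partial>sym_lborel) \<noteq> \<infinity>"
  proof -
    let ?E = "sym_of_upper -` ?B"
    have E: "?E \<in> sets lborel" using measurable_sets[OF measurable_sym_of_upper, of ?B] by simp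
    have "emeasure lborel ?E \<noteq> 0"
      using emeasure_sym_lborel_open[of ?B "mat 1"] r(1) by (simp add: emeasure_sym_lborel transpose_mat)
    moreover have "emeasure lborel ?E \<noteq> \<infinity>"
      using emeasure_sym_lborel_bounded[of ?B] by (simp add: emeasure_sym_lborel)
    moreover have i: "?f (sym_of_upper v) = indicator ?E v" for v by (simp add: indicator_def)
    moreover have b: "2 powr (- real (?k + 1) / 2) \<le> gram_weight (?k + 1) (sym_of_upper v)"
      "gram_weight (?k + 1) (sym_of_upper v) \<le> (1/2) powr (- real (?k + 1) / 2)" if "v \<in> ?E" for v
      using that by (intro bounds transpose_sym_of_upper; simp)+
    moreover have m: "(\<lambda>v. gram_weight (?k + 1) (sym_of_upper v)) \<in> borel_measurable lborel" by measurable
    moreover have a: "0 < (2::real) powr (- real (?k + 1) / 2)" by simp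
    ultimately have "(\<integral>\<^sup>+v. ?w (?k + 1) (sym_of_upper v) * ?f (sym_of_upper v) \<partial>lborel) \<noteq> 0"
       "(\<integral>\<^sup>+v. ?w (?k + 1) (sym_of_upper v) * ?f (sym_of_upper v) \<partial>lborel) \<noteq> \<infinity>"
      unfolding i using nn_integral_sandwich_finite_pos[OF m E _ _ a b] by blast+
    then show "(\<integral>\<^sup>+S. ?w (?k + 1) S * ?f S \<partial>sym_lborel) \<noteq> 0" "(\<integral>\<^sup>+S. ?w (?k + 1) S * ?f S \<partial>sym_lborel) \<noteq> \<infinity>"
      by (subst nn_integral_sym_lborel; simp)+
  qed
  have G: "(\<integral>\<^sup>+A. ?f (transpose A ** A) \<partial>gl_haar) \<noteq> 0" "(\<integral>\<^sup>+A. ?f (transpose A ** A) \<partial>gl_haar) \<noteq> \<infinity>"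
  proof -
    let ?E = "{A. transpose A ** A \<in> ?B}"
    have i: "?f (transpose A ** A) = indicator ?E A" for A by (simp add: indicator_def)
    have b: "(1/2) ^ ?k \<le> inverse (\<bar>det A\<bar> ^ ?k)" "inverse (\<bar>det A\<bar> ^ ?k) \<le> 2 ^ ?k" if "A \<in> ?E" for A
    proof -
      have d: "1/2 < (det A)\<^sup>2" "(det A)\<^sup>2 < 2" using that r(2)[of "transpose A ** A"] by (auto simp: det_mul power2_eq_square)
      have "\<bar>det A\<bar> \<le> 2" by (rule power2_le_imp_le) (use d(2) in simp_all)
      moreover have "1/2 \<le> \<bar>det A\<bar>" by (rule power2_le_imp_le) (use d(1) in \<open>simp_all add: power_divide\<close>)
      ultimately have "1/2 \<le> inverse \<bar>det A\<bar>" "inverse \<bar>det A\<bar> \<le> 2" by (auto simp: field_simps)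
      then show "(1/2) ^ ?k \<le> inverse (\<bar>det A\<bar> ^ ?k)" "inverse (\<bar>det A\<bar> ^ ?k) \<le> 2 ^ ?k"
        unfolding power_inverse[symmetric] by (auto intro!: power_mono)
    qed
    have m: "(\<lambda>A::real^'k::{finite,linorder}^'k::{finite,linorder}. inverse (\<bar>det A\<bar> ^ ?k)) \<in> borel_measurable lborel" by measurable
    have a: "0 < (1/2::real) ^ ?k" by simp
    have "(\<integral>\<^sup>+A. ennreal (inverse (\<bar>det A\<bar> ^ ?k)) * indicator ?E A \<partial>lborel) \<noteq> 0" "(\<integral>\<^sup>+A. ennreal (inverse (\<bar>det A\<bar> ^ ?k)) * indicator ?E A \<partial>lborel) \<noteq> \<infinity>"
      by (rule nn_integral_sandwich_finite_pos[OF m gram_ball[OF mat_1_stiefel r(1)] a b]; assumption)+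
    then show "(\<integral>\<^sup>+A. ?f (transpose A ** A) \<partial>gl_haar) \<noteq> 0" "(\<integral>\<^sup>+A. ?f (transpose A ** A) \<partial>gl_haar) \<noteq> \<infinity>"
      by (subst nn_integral_gl_haar; simp add: i del: mem_ball)+
  qed
  define Wf where "Wf = enn2real (\<integral>\<^sup>+X. ?w ?n (?\<pi> X) * ?f (?\<pi> X) \<partial>lborel)"
  define Vf where "Vf = enn2real (\<integral>\<^sup>+S. ?w (?k + 1) S * ?f S \<partial>sym_lborel)"
  have WVf: "(\<integral>\<^sup>+X. ?w ?n (?\<pi> X) * ?f (?\<pi> X) \<partial>lborel) = ennreal Wf" "(\<integral>\<^sup>+S. ?w (?k + 1) S * ?f S \<partial>sym_lborel) = ennreal Vf"
    using W V by (auto simp: Wf_def Vf_def less_top)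
  have pos: "0 < Wf" "0 < Vf" using W V by (auto simp: Wf_def Vf_def enn2real_positive_iff less_top zero_less_iff_neq_zero)
  show thesis
  proof (rule that)
    show "0 < Wf / Vf" using pos by simp
    fix g :: "real^'k::{finite,linorder}^'k::{finite,linorder} \<Rightarrow> ennreal"
    assume [measurable]: "g \<in> borel_measurable borel"
    \<comment> \<open>this factor cancels the weight on the side of the matrices X\<close>
    define h where "h S = ennreal (det S powr (real ?n / 2)) * g S" for S
    have [measurable]: "h \<in> borel_measurable borel" unfolding h_def[abs_def] by measurable
    have 1: "(\<integral>\<^sup>+A. ?f (transpose A ** A) \<partial>gl_haar) * (\<integral>\<^sup>+X. ?w ?n (?\<pi> X) * h (?\<pi> X) \<partial>lborel) =
      (\<integral>\<^sup>+A. h (transpose (matrix_inverse A) ** matrix_inverse A) \<partial>gl_haar) * ennreal Wf"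
      unfolding WVf(1)[symmetric]
      by (rule weighted_proportional[where act="\<lambda>A X. X ** A"])
        (auto simp: sigma_finite_lborel matrix_transpose_mul matrix_mul_assoc scales_mult_right)
    have 2: "(\<integral>\<^sup>+A. ?f (transpose A ** A) \<partial>gl_haar) * (\<integral>\<^sup>+S. ?w (?k + 1) S * h S \<partial>sym_lborel) =
      (\<integral>\<^sup>+A. h (transpose (matrix_inverse A) ** matrix_inverse A) \<partial>gl_haar) * ennreal Vf"
      unfolding WVf(2)[symmetric]
      by (rule weighted_proportional[where act="\<lambda>A S. transpose A ** S ** A" and \<pi>="\<lambda>S. S"])
        (use scales_conj in \<open>simp_all add: sigma_finite_sym_lborel\<close>)
    have "(\<integral>\<^sup>+A. ?f (transpose A ** A) \<partial>gl_haar) * ((\<integral>\<^sup>+X. ?w ?n (?\<pi> X) * h (?\<pi> X) \<partial>lborel) * ennreal Vf) =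
      (\<integral>\<^sup>+A. ?f (transpose A ** A) \<partial>gl_haar) * (ennreal Wf * (\<integral>\<^sup>+S. ?w (?k + 1) S * h S \<partial>sym_lborel))"
      unfolding mult.assoc[symmetric] 1 using 2 by (simp add: mult_ac)
    then have 3: "(\<integral>\<^sup>+X. ?w ?n (?\<pi> X) * h (?\<pi> X) \<partial>lborel) * ennreal Vf = ennreal Wf * (\<integral>\<^sup>+S. ?w (?k + 1) S * h S \<partial>sym_lborel)"
      using G by (subst (asm) ennreal_mult_cancel_left) auto
    have "(\<integral>\<^sup>+X. ?w ?n (?\<pi> X) * h (?\<pi> X) \<partial>lborel) = (\<integral>\<^sup>+X. g (?\<pi> X) \<partial>lborel)"
    proof (rule nn_integral_cong_AE)
      show "AE X in lborel. ?w ?n (?\<pi> X) * h (?\<pi> X) = g (?\<pi> X)"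
        using not_full_rank_null[OF assms]
      proof eventually_elim
        case (elim X)
        then have pd: "?\<pi> X \<in> pos_def_mats" by (simp add: full_rank_mats_def)
        have "gram_weight ?n (?\<pi> X) * det (?\<pi> X) powr (real ?n / 2) = 1"
          using pd pos_def_det_pos[OF pd] by (simp add: gram_weight_def powr_add[symmetric])
        then show ?case by (simp add: h_def mult.assoc[symmetric] ennreal_mult[symmetric] gram_weight_nonneg)
      qed
    qed
    moreover have "?w (?k + 1) S * h S = ennreal (indicator pos_def_mats S * det S powr ((real ?n - real ?k - 1) / 2)) * g S" for S
    proof (cases "S \<in> pos_def_mats")
      case True
      have "gram_weight (?k + 1) S * det S powr (real ?n / 2) = det S powr ((real ?n - real ?k - 1) / 2)"
        using True by (simp add: gram_weight_def powr_add[symmetric] field_simps)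
      then show ?thesis using True by (simp add: h_def mult.assoc[symmetric] ennreal_mult[symmetric] gram_weight_nonneg)
    qed (simp add: gram_weight_def)
    ultimately have "(\<integral>\<^sup>+X. g (?\<pi> X) \<partial>lborel) * ennreal Vf = ennreal Wf *
       (\<integral>\<^sup>+S. ennreal (indicator pos_def_mats S * det S powr ((real ?n - real ?k - 1) / 2)) * g S \<partial>sym_lborel)"
      using 3 by simp
    then have "(\<integral>\<^sup>+X. g (?\<pi> X) \<partial>lborel) * ennreal Vf * ennreal (1 / Vf) = ennreal (1 / Vf) * (ennreal Wf *
       (\<integral>\<^sup>+S. ennreal (indicator pos_def_mats S * det S powr ((real ?n - real ?k - 1) / 2)) * g S \<partial>sym_lborel))"
      by (simp add: mult.commute)
    then show "(\<integral>\<^sup>+X. g (?\<pi> X) \<partial>lborel) = ennreal (Wf / Vf) *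
       (\<integral>\<^sup>+S. ennreal (indicator pos_def_mats S * det S powr ((real ?n - real ?k - 1) / 2)) * g S \<partial>sym_lborel)"
      using pos by (simp add: mult.assoc[symmetric] ennreal_mult[symmetric]) (simp add: mult.assoc ennreal_mult[symmetric])
  qed
qed

section \<open>The change of variables from a positive definite matrix to its square\<close>

text \<open>
  The product over \<open>i \<le> j\<close> refers to the order of the index set, but its square is expressed by products that
  do not. This allows the passage from eigenvalues indexed by \<open>'k\<close> to the sorted list of eigenvalues.
\<close>

lemma triangular_prod_square:
  fixes s :: "'i::linorder \<Rightarrow> 'i \<Rightarrow> real"
  assumes fin: "finite A" and sym: "\<And>i j. s i j = s j i"
  shows "(\<Prod>(i, j)\<in>{(i, j). i \<in> A \<and> j \<in> A \<and> i \<le> j}. s i j)\<^sup>2 = (\<Prod>i\<in>A. \<Prod>j\<in>A. s i j) * (\<Prod>i\<in>A. s i i)"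
proof -
  let ?U = "{(i, j). i \<in> A \<and> j \<in> A \<and> i \<le> j}" and ?D = "{(i, j). i \<in> A \<and> j \<in> A \<and> j < i}"
  let ?s = "\<lambda>(i, j). s i j"
  have finU: "finite ?U" "finite ?D"
    using fin by (auto intro: finite_subset[OF _ finite_cartesian_product[OF fin fin]])
  have "prod ?s ?U = prod ?s {(i, j). i \<in> A \<and> j \<in> A \<and> j \<le> i}"
    by (rule prod.reindex_bij_witness[of _ prod.swap prod.swap]) (auto simp: sym)
  also have "{(i, j). i \<in> A \<and> j \<in> A \<and> j \<le> i} = ?D \<union> (\<lambda>i. (i, i)) ` A" by auto
  also have "prod ?s \<dots> = prod ?s ?D * prod ?s ((\<lambda>i. (i, i)) ` A)"
    using fin finU by (intro prod.union_disjoint) auto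
  also have "prod ?s ((\<lambda>i. (i, i)) ` A) = (\<Prod>i\<in>A. s i i)"
    by (subst prod.reindex) (auto simp: inj_on_def)
  finally have "(prod ?s ?U)\<^sup>2 = (prod ?s ?U * prod ?s ?D) * (\<Prod>i\<in>A. s i i)"
    by (simp add: power2_eq_square)
  also have "prod ?s ?U * prod ?s ?D = prod ?s (?U \<union> ?D)"
    using finU by (intro prod.union_disjoint[symmetric]) auto
  also have "?U \<union> ?D = A \<times> A" by auto
  also have "prod ?s (A \<times> A) = (\<Prod>i\<in>A. \<Prod>j\<in>A. s i j)" by (rule prod.cartesian_product[symmetric])
  finally show ?thesis .
qed

lemma prod_list_index: "(\<Prod>i<length xs. f (xs ! i)) = prod_mset (image_mset f (mset xs))"
  by (induction xs rule: rev_induct) (simp_all add: nth_append mult.commute)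

lemma triangular_prod_list:
  fixes d :: "'k::{finite,linorder} \<Rightarrow> real"
  assumes m: "mset xs = image_mset d (mset_set UNIV)" and pos: "\<And>i. 0 < d i"
  shows "(\<Prod>(i, j)\<in>{(i, j). i \<le> j}. d i + d j) = 2 ^ CARD('k) * (\<Prod>i\<in>UNIV. d i) * (\<Prod>j<CARD('k). \<Prod>i<j. xs ! i + xs ! j)"
proof -
  let ?n = "CARD('k)"
  have len: "length xs = ?n" using arg_cong[OF m, of size] by simp
  have tr: "(\<Prod>i<?n. f (xs ! i)) = (\<Prod>i\<in>UNIV. f (d i))" for f :: "real \<Rightarrow> real"
    using prod_list_index[of f xs] by (simp add: len m prod_unfold_prod_mset image_mset.compositionality comp_def)
  have "0 < x" if "x \<in># mset xs" for x using that pos unfolding m by auto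
  then have xpos: "0 < xs ! i" if "i < ?n" for i using that len by auto
  let ?T = "\<Prod>(i, j)\<in>{(i, j). i \<in> {..<?n} \<and> j \<in> {..<?n} \<and> i \<le> j}. xs ! i + xs ! j"
  let ?S = "\<Prod>(i, j)\<in>{(i::'k, j). i \<le> j}. d i + d j"
  have "?T\<^sup>2 = (\<Prod>i<?n. \<Prod>j<?n. xs ! i + xs ! j) * (\<Prod>i<?n. xs ! i + xs ! i)"
    by (rule triangular_prod_square) (auto simp: add.commute)
  also have "\<dots> = (\<Prod>i\<in>UNIV. \<Prod>j\<in>UNIV. d i + d j) * (\<Prod>i\<in>UNIV. d i + d i)"
    by (simp only: tr[of "\<lambda>y. xs ! _ + y"] tr[of "\<lambda>x. \<Prod>j\<in>UNIV. x + d j"] tr[of "\<lambda>x. x + x"])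
  also have "\<dots> = ?S\<^sup>2"
    using triangular_prod_square[of "UNIV :: 'k set" "\<lambda>i j. d i + d j"] by (simp add: add.commute)
  finally have "?T\<^sup>2 = ?S\<^sup>2" .
  moreover have "0 \<le> ?T" using xpos by (intro prod_nonneg) (auto intro!: add_nonneg_nonneg simp: less_imp_le)
  moreover have "0 \<le> ?S" using pos by (intro prod_nonneg) (auto intro!: add_nonneg_nonneg simp: less_imp_le)
  ultimately have "?S = ?T" by (simp add: power2_eq_iff_nonneg)
  also have "{(i, j). i \<in> {..<?n} \<and> j \<in> {..<?n} \<and> i \<le> j} = prod.swap ` (SIGMA j:{..<?n}. {..j})"
    by (auto simp: image_iff)
  also have "(\<Prod>(i, j)\<in>prod.swap ` (SIGMA j:{..<?n}. {..j}). xs ! i + xs ! j) = (\<Prod>(j, i)\<in>(SIGMA j:{..<?n}. {..j}). xs ! i + xs ! j)"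
    by (subst prod.reindex) (auto intro!: prod.cong)
  also have "\<dots> = (\<Prod>j<?n. \<Prod>i\<le>j. xs ! i + xs ! j)"
    by (rule prod.Sigma[symmetric]) auto
  also have "\<dots> = (\<Prod>j<?n. 2 * xs ! j * (\<Prod>i<j. xs ! i + xs ! j))"
    by (intro prod.cong refl) (simp add: lessThan_Suc_atMost[symmetric])
  also have "\<dots> = 2 ^ ?n * (\<Prod>j<?n. xs ! j) * (\<Prod>j<?n. \<Prod>i<j. xs ! i + xs ! j)"
    by (simp add: prod.distrib)
  also have "(\<Prod>j<?n. xs ! j) = (\<Prod>i\<in>UNIV. d i)" by (rule tr)
  finally show ?thesis .
qed

lemma char_polynomial_spectral:
  assumes U: "orthogonal_matrix (U::real^'k^'k)"
  shows "char_polynomial (U ** diagm d ** transpose U) = (\<Prod>i\<in>UNIV. [:- (d $ i), 1:])"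
proof (subst poly_eq_poly_eq_iff[symmetric], rule ext)
  fix t :: real
  have "mat t = U ** mat t ** transpose U"
  proof -
    have "mat t = t *\<^sub>R (mat 1 :: real^'k^'k)" by (simp add: vec_eq_iff mat_def)
    moreover have "U ** (t *\<^sub>R mat 1) = t *\<^sub>R U" by (simp add: vec_eq_iff matrix_matrix_mult_def mat_def if_distrib[of "(*) _"] cong: if_cong)
    moreover have "(t *\<^sub>R U) ** transpose U = t *\<^sub>R (U ** transpose U)"
      by (simp add: vec_eq_iff matrix_matrix_mult_def sum_distrib_left mult.assoc)
    ultimately show ?thesis using orthogonal_matrix_inverse[OF U] by simp
  qed
  then have "mat t - U ** diagm d ** transpose U = U ** (mat t - diagm d) ** transpose U"
    by (simp add: matrix_diff_ldistrib matrix_diff_rdistrib)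
  also have "mat t - diagm d = diagm (\<chi> i. t - d $ i)" by (simp add: vec_eq_iff mat_def diagm_def)
  finally show "poly (char_polynomial (U ** diagm d ** transpose U)) t = poly (\<Prod>i\<in>UNIV. [:- (d $ i), 1:]) t"
    by (simp add: poly_char_polynomial det_orthogonal_conj[OF U] det_diagm poly_prod)
qed

lemma mset_eigenvalue_list:
  assumes U: "orthogonal_matrix (U::real^'k^'k)"
  shows "mset (eigenvalue_list (U ** diagm d ** transpose U)) = image_mset (\<lambda>i. d $ i) (mset_set UNIV)"
proof -
  have "proots (\<Prod>i\<in>UNIV. [:- (d $ i), 1:]) = (\<Sum>i\<in>UNIV. {#d $ i#})"
    by (subst proots_prod) auto
  also have "\<dots> = image_mset (\<lambda>i. d $ i) (mset_set UNIV)"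
    by (simp add: sum_unfold_sum_mset image_mset_const_eq sum_mset.distrib)
  finally show ?thesis by (simp add: eigenvalue_list_def char_polynomial_spectral[OF U])
qed

text \<open>
  The derivative \<open>H \<mapsto> P H + H P\<close> of squaring, in upper triangular coordinates.
\<close>

definition square_deriv :: "real^'k::{finite,linorder}^'k::{finite,linorder} \<Rightarrow> real^('k::{finite,linorder}) upper \<Rightarrow> real^('k::{finite,linorder}) upper" where
  "square_deriv P h = upper_of_sym (P ** sym_of_upper h + sym_of_upper h ** P)"

definition square_jacobian :: "real^'k::{finite,linorder}^'k::{finite,linorder} \<Rightarrow> real" where
  "square_jacobian P = \<bar>det (matrix (square_deriv P))\<bar>"

definition conj_upper :: "real^'k::{finite,linorder}^'k::{finite,linorder} \<Rightarrow> real^('k::{finite,linorder}) upper \<Rightarrow> real^('k::{finite,linorder}) upper" where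
  "conj_upper U h = upper_of_sym (transpose U ** sym_of_upper h ** U)"

lemma linear_conj_upper: "linear (conj_upper U)"
proof -
  have "linear (\<lambda>v. (\<lambda>X. X ** U) ((\<lambda>X. transpose U ** X) (sym_of_upper v)))"
    by (intro linear_compose[OF _ linear_matrix_mult_right, unfolded comp_def]
        linear_compose[OF _ linear_matrix_mult_left, unfolded comp_def] linear_sym_of_upper)
  then show ?thesis unfolding conj_upper_def using linear_compose[OF _ linear_upper_of_sym] by (auto simp: comp_def)
qed

lemma sym_of_upper_conj_upper: "sym_of_upper (conj_upper U h) = transpose U ** sym_of_upper h ** U"
  by (simp add: conj_upper_def sym_of_upper_of_sym transpose_conj_symmetric)

lemma linear_square_deriv: "linear (square_deriv P)"
proof -
  have "linear (\<lambda>v. (\<lambda>X. P ** X) (sym_of_upper v))" "linear (\<lambda>v. (\<lambda>X. X ** P) (sym_of_upper v))"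
    by (intro linear_compose[OF _ linear_matrix_mult_right, unfolded comp_def]
        linear_compose[OF _ linear_matrix_mult_left, unfolded comp_def] linear_sym_of_upper)+
  then have "linear (\<lambda>v. P ** sym_of_upper v + sym_of_upper v ** P)" by (intro linear_compose_add) auto
  then show ?thesis unfolding square_deriv_def using linear_compose[OF _ linear_upper_of_sym] by (auto simp: comp_def)
qed

lemma matrix_add_rdistrib: "(B + C) ** A = B ** A + (C::real^'k^'n) ** A"
  by (simp add: vec_eq_iff matrix_matrix_mult_def ring_distribs sum.distrib)

text \<open>
  Conjugation by \<open>U\<close> transforms the derivative at \<open>P\<close> into the derivative at \<open>diagm d\<close>, which multiplies the
  coordinate \<open>(i, j)\<close> by \<open>d $ i + d $ j\<close>. The determinants of the conjugations by \<open>U\<close> and by its inverse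
  cancel.
\<close>

lemma square_jacobian_spectral:
  fixes U :: "real^'k::{finite,linorder}^'k::{finite,linorder}"
  assumes U: "orthogonal_matrix U" and d: "\<And>i. 0 < d $ i"
  shows "square_jacobian (U ** diagm d ** transpose U) = (\<Prod>(i, j)\<in>{(i, j). i \<le> j}. d $ i + d $ j)"
proof -
  let ?P = "U ** diagm d ** transpose U" and ?V = "transpose U"
  have VU: "?V ** U = mat 1" "U ** ?V = mat 1" using orthogonal_matrix_inverse[OF U] by auto
  have "square_deriv ?P h = conj_upper ?V (square_deriv (diagm d) (conj_upper U h))" for h
  proof -
    let ?H = "sym_of_upper h"
    have s: "transpose (diagm d ** (?V ** ?H ** U) + ?V ** ?H ** U ** diagm d) = diagm d ** (?V ** ?H ** U) + ?V ** ?H ** U ** diagm d"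
    proof -
      have "transpose (A + B) = transpose A + transpose (B::real^'k::{finite,linorder}^'k::{finite,linorder})" for A B by (simp add: transpose_def vec_eq_iff)
      then show ?thesis by (simp add: matrix_transpose_mul matrix_mul_assoc)
    qed
    have e1: "U ** (diagm d ** (?V ** ?H ** U)) ** ?V = ?P ** ?H"
    proof -
      have "U ** (diagm d ** (?V ** ?H ** U)) ** ?V = ?P ** ?H ** (U ** ?V)" by (simp add: matrix_mul_assoc)
      then show ?thesis by (simp add: VU matrix_mul_rid)
    qed
    have e2: "U ** (?V ** ?H ** U ** diagm d) ** ?V = ?H ** ?P"
    proof -
      have "U ** (?V ** ?H ** U ** diagm d) ** ?V = (U ** ?V) ** ?H ** ?P" by (simp add: matrix_mul_assoc)
      then show ?thesis by (simp add: VU matrix_mul_lid)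
    qed
    have "conj_upper ?V (square_deriv (diagm d) (conj_upper U h)) =
      upper_of_sym (U ** (diagm d ** (?V ** ?H ** U) + ?V ** ?H ** U ** diagm d) ** ?V)"
      unfolding conj_upper_def[of ?V] square_deriv_def sym_of_upper_conj_upper sym_of_upper_of_sym[OF s] by simp
    also have "\<dots> = upper_of_sym (?P ** ?H + ?H ** ?P)"
      by (simp only: matrix_add_ldistrib matrix_add_rdistrib e1 e2)
    finally show ?thesis by (simp add: square_deriv_def)
  qed
  then have "square_deriv ?P = conj_upper ?V \<circ> (square_deriv (diagm d) \<circ> conj_upper U)" by (auto simp: fun_eq_iff)
  then have m: "matrix (square_deriv ?P) = matrix (conj_upper ?V) ** (matrix (square_deriv (diagm d)) ** matrix (conj_upper U))"
    by (simp add: matrix_compose linear_conj_upper linear_square_deriv linear_compose)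
  have "conj_upper ?V \<circ> conj_upper U = id"
  proof (rule ext)
    fix h
    have "U ** (?V ** sym_of_upper h ** U) ** ?V = (U ** ?V) ** sym_of_upper h ** (U ** ?V)" by (simp add: matrix_mul_assoc)
    then show "(conj_upper ?V \<circ> conj_upper U) h = id h"
      by (simp add: conj_upper_def[of ?V] sym_of_upper_conj_upper VU matrix_mul_rid)
  qed
  then have "matrix (conj_upper ?V) ** matrix (conj_upper U) = mat 1"
    by (metis linear_conj_upper matrix_compose matrix_id_mat_1)
  then have c: "det (matrix (conj_upper ?V)) * det (matrix (conj_upper U)) = 1" by (metis det_I det_mul)
  define e :: "real^'k upper" where "e = (\<chi> m. d $ fst (Rep_upper m) + d $ snd (Rep_upper m))"
  have "square_deriv (diagm d) h = (\<chi> m. e $ m * h $ m)" for h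
  proof -
    have "(diagm d ** S + S ** diagm d) $ i $ j = (d $ i + d $ j) * S $ i $ j" for S :: "real^'k::{finite,linorder}^'k::{finite,linorder}" and i j
      by (simp add: matrix_matrix_mult_def diagm_def if_distrib[of "(*) _"] if_distrib[of "\<lambda>z. z * _"] algebra_simps cong: if_cong)
    then show ?thesis
      using upper_of_sym_of_upper[of h]
      by (simp add: vec_eq_iff square_deriv_def upper_of_sym_def e_def)
  qed
  then have "matrix (square_deriv (diagm d)) = diagm e"
    by (simp add: vec_eq_iff matrix_def diagm_def axis_def)
  then have "det (matrix (square_deriv (diagm d))) = (\<Prod>(i, j)\<in>{(i, j). i \<le> j}. d $ i + d $ j)"
    using prod_upper[of "\<lambda>(i, j). d $ i + d $ j"] by (simp add: det_diagm e_def split_def)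
  moreover have "0 \<le> (\<Prod>(i, j)\<in>{(i, j). i \<le> j}. d $ i + d $ j)"
    using d by (intro prod_nonneg) (auto intro!: add_nonneg_nonneg simp: less_imp_le)
  ultimately have "square_jacobian ?P = \<bar>(det (matrix (conj_upper ?V)) * det (matrix (conj_upper U))) * (\<Prod>(i, j)\<in>{(i, j). i \<le> j}. d $ i + d $ j)\<bar>"
    unfolding square_jacobian_def m by (simp add: det_mul mult_ac)
  then show ?thesis using c \<open>0 \<le> (\<Prod>(i, j)\<in>{(i, j). i \<le> j}. d $ i + d $ j)\<close> by simp
qed

definition eigenvalue_factor :: "real^'k^'k \<Rightarrow> real" where
  "eigenvalue_factor P = (\<Prod>j<CARD('k). \<Prod>i<j. eigenvalue_list P ! i + eigenvalue_list P ! j)"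

lemma square_jacobian_eq:
  assumes "P \<in> pos_def_mats"
  shows "square_jacobian P = 2 ^ CARD('k::{finite,linorder}) * det P * eigenvalue_factor (P::real^'k::{finite,linorder}^'k::{finite,linorder})"
    and "0 < eigenvalue_factor P"
proof -
  obtain U d where U: "orthogonal_matrix U" "P = U ** diagm d ** transpose U" "\<And>i. 0 < d $ i"
    using pos_def_spectral[OF assms] by blast
  have dP: "det P = (\<Prod>i\<in>UNIV. d $ i)" by (simp add: U(2) det_orthogonal_conj[OF U(1)] det_diagm)
  show 1: "square_jacobian P = 2 ^ CARD('k) * det P * eigenvalue_factor P"
    unfolding dP eigenvalue_factor_def unfolding U(2) square_jacobian_spectral[OF U(1,3)]
    by (rule triangular_prod_list[OF mset_eigenvalue_list[OF U(1)] U(3)])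
  have "0 < square_jacobian P"
    unfolding U(2) square_jacobian_spectral[OF U(1,3)] using U(3) by (intro prod_pos) (auto intro!: add_pos_pos)
  then show "0 < eigenvalue_factor P"
    unfolding 1 using pos_def_det_pos[OF assms] by (elim zero_less_mult_pos) simp
qed

lemma continuous_square_jacobian: "continuous_on UNIV square_jacobian"
  unfolding square_jacobian_def[abs_def] square_deriv_def[abs_def] matrix_def upper_of_sym_def
  by (auto intro!: continuous_intros)

lemma square_jacobian_measurable [measurable]: "square_jacobian \<in> borel_measurable borel"
  by (intro borel_measurable_continuous_onI continuous_square_jacobian)

text \<open>
  Squaring is a bijection of the positive definite cone. The change of variables theorem computes the volume
  of the image of a bounded set as an integral of the Jacobian, so the two measures \<open>?M1\<close> and \<open>?M2\<close> agree on
  boxes, hence on all Borel sets, and the integrals agree for all nonnegative Borel functions.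
\<close>

lemma square_change_of_variables:
  fixes g :: "real^'k::{finite,linorder}^'k::{finite,linorder} \<Rightarrow> ennreal"
  assumes [measurable]: "g \<in> borel_measurable borel"
  shows "(\<integral>\<^sup>+S. indicator pos_def_mats S * g S \<partial>sym_lborel) =
    (\<integral>\<^sup>+P. indicator pos_def_mats P * ennreal (square_jacobian P) * g (P ** P) \<partial>sym_lborel)"
proof -
  define \<Omega> where "\<Omega> = sym_of_upper -` (pos_def_mats :: (real^'k::{finite,linorder}^'k::{finite,linorder}) set)"
  have \<Omega>[measurable]: "\<Omega> \<in> sets borel" using measurable_sets[OF measurable_sym_of_upper pos_def_borel] by (simp add: \<Omega>_def)
  define \<gamma> :: "real^('k::{finite,linorder}) upper \<Rightarrow> real^('k::{finite,linorder}) upper"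
    where "\<gamma> v = upper_of_sym (sym_of_upper v ** sym_of_upper v)" for v
  define J where "J v = square_jacobian (sym_of_upper v)" for v :: "real^('k::{finite,linorder}) upper"
  have [measurable]: "J \<in> borel_measurable borel" unfolding J_def by measurable
  have J0: "0 \<le> J v" for v by (simp add: J_def square_jacobian_def)
  have s\<gamma>: "sym_of_upper (\<gamma> v) = sym_of_upper v ** sym_of_upper v" for v
    unfolding \<gamma>_def by (rule sym_of_upper_of_sym) (simp add: matrix_transpose_mul)
  have bl: "bounded_bilinear ((**) :: real^'k::{finite,linorder}^'k::{finite,linorder} \<Rightarrow> real^'k::{finite,linorder}^'k::{finite,linorder} \<Rightarrow> _)"
    unfolding bilinear_conv_bounded_bilinear[symmetric] bilinear_def
    by (simp add: linear_matrix_mult_left linear_matrix_mult_right)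
  have ds: "(sym_of_upper has_derivative sym_of_upper) (at v within S)" for v S
    using linear_sym_of_upper by (intro bounded_linear_imp_has_derivative) (simp add: linear_linear)
  have du: "(upper_of_sym has_derivative upper_of_sym) (at w within S)" for w S
    using linear_upper_of_sym by (intro bounded_linear_imp_has_derivative) (simp add: linear_linear)
  have der: "(\<gamma> has_derivative square_deriv (sym_of_upper v)) (at v within S)" for v S
    unfolding \<gamma>_def square_deriv_def
    by (rule has_derivative_compose[OF bounded_bilinear.FDERIV[OF bl ds ds] du])
  have m\<gamma>[measurable]: "\<gamma> \<in> borel_measurable borel"
    using der by (intro borel_measurable_continuous_onI has_derivative_continuous_on) auto
  have inj: "inj_on \<gamma> \<Omega>"
  proof (rule inj_onI)
    fix v w assume vw: "v \<in> \<Omega>" "w \<in> \<Omega>" "\<gamma> v = \<gamma> w"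
    then have sq: "sym_of_upper v ** sym_of_upper v = sym_of_upper w ** sym_of_upper w" using s\<gamma>[of v] s\<gamma>[of w] vw(3) by simp
    have pd: "sym_of_upper v \<in> pos_def_mats" "sym_of_upper w \<in> pos_def_mats" using vw by (simp_all add: \<Omega>_def)
    have "sym_of_upper v = sym_of_upper w" by (rule pos_def_square_inj[OF pd sq])
    from arg_cong[OF this, of upper_of_sym] show "v = w" by simp
  qed
  have \<gamma>\<Omega>: "\<gamma> v \<in> \<Omega>" if "v \<in> \<Omega>" for v
    using that by (simp add: \<Omega>_def s\<gamma> pos_def_square)
  have onto: "\<exists>v\<in>\<Omega>. \<gamma> v = w" if w: "w \<in> \<Omega>" for w
  proof -
    have pd: "sym_of_upper w \<in> pos_def_mats" using w by (simp add: \<Omega>_def)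
    let ?P = "pos_def_sqrt (sym_of_upper w)"
    have P: "?P \<in> pos_def_mats" "?P ** ?P = sym_of_upper w" using pos_def_sqrt[OF pd] by auto
    have sP: "sym_of_upper (upper_of_sym ?P) = ?P"
      using P(1) by (intro sym_of_upper_of_sym) (simp add: pos_def_mats_def)
    have "upper_of_sym ?P \<in> \<Omega>" "\<gamma> (upper_of_sym ?P) = w" using P by (auto simp: \<Omega>_def sP \<gamma>_def)
    then show ?thesis by blast
  qed
  let ?M1 = "density lborel (indicator \<Omega>)"
  let ?M2 = "distr (density lborel (\<lambda>v. indicator \<Omega> v * ennreal (J v))) borel \<gamma>"
  have eq: "emeasure ?M1 B = emeasure ?M2 B" if B: "bounded B" "B \<in> sets borel" for B
  proof -
    define S where "S = \<Omega> \<inter> \<gamma> -` B"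
    have "\<gamma> -` B \<in> sets borel" using measurable_sets[OF m\<gamma> B(2)] by simp
    then have S: "S \<in> sets borel" unfolding S_def by (intro sets.Int \<Omega>)
    have img: "\<gamma> ` S = \<Omega> \<inter> B"
    proof (intro set_eqI iffI)
      fix w assume "w \<in> \<gamma> ` S"
      then show "w \<in> \<Omega> \<inter> B" using \<gamma>\<Omega> by (auto simp: S_def)
    next
      fix w assume w: "w \<in> \<Omega> \<inter> B"
      then obtain v where "v \<in> \<Omega>" "\<gamma> v = w" using onto by blast
      then show "w \<in> \<gamma> ` S" using w by (auto simp: S_def)
    qed
    have lm: "\<Omega> \<inter> B \<in> lmeasurable"
      using B by (intro bounded_set_imp_lmeasurable) (auto intro: bounded_subset)
    have hi: "((\<lambda>v. \<bar>det (matrix (square_deriv (sym_of_upper v)))\<bar>) has_integral measure lebesgue (\<gamma> ` S)) S"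
    proof (rule has_measure_differentiable_image[THEN iffD1])
      show "S \<in> sets lebesgue" using S by simp
      show "inj_on \<gamma> S" by (rule inj_on_subset[OF inj]) (simp add: S_def)
      show "\<gamma> ` S \<in> lmeasurable \<and> measure lebesgue (\<gamma> ` S) = measure lebesgue (\<gamma> ` S)"
        unfolding img using lm by simp
    qed (rule der)
    have "emeasure ?M2 B = (\<integral>\<^sup>+v. indicator \<Omega> v * ennreal (J v) * indicator B (\<gamma> v) \<partial>lborel)"
      using B(2) measurable_sets[OF m\<gamma> B(2)]
      by (simp add: emeasure_distr emeasure_density) (intro nn_integral_cong, auto simp: indicator_def)
    also have "\<dots> = (\<integral>\<^sup>+v. ennreal (indicator S v * J v) \<partial>lborel)"
      by (intro nn_integral_cong) (auto simp: indicator_def S_def)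
    also have "\<dots> = ennreal (measure lebesgue (\<gamma> ` S))"
      using hi[folded square_jacobian_def J_def] J0 by (intro nn_integral_has_integral_lebesgue) auto
    also have "\<dots> = emeasure lborel (\<Omega> \<inter> B)"
      using lm B(2) unfolding img by (subst emeasure_eq_measure2[symmetric]) auto
    also have "\<dots> = emeasure ?M1 B"
      using B(2) by (simp add: emeasure_density indicator_inter_arith[symmetric])
    finally show ?thesis ..
  qed
  have M: "?M1 = ?M2"
  proof (rule measure_eqI_generator_eq)
    let ?E = "range (\<lambda>(a, b). box a b :: (real^('k::{finite,linorder}) upper) set)"
    show "Int_stable ?E" by (auto simp: Int_stable_def box_Int_box)
    show "?E \<subseteq> Pow UNIV" "sets ?M1 = sigma_sets UNIV ?E" "sets ?M2 = sigma_sets UNIV ?E"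
      by (simp_all add: borel_eq_box)
    let ?A = "\<lambda>n::nat. box (- (real n *\<^sub>R One)) (real n *\<^sub>R One) :: (real^('k::{finite,linorder}) upper) set"
    show "range ?A \<subseteq> ?E" "(\<Union>i. ?A i) = UNIV" unfolding UN_box_eq_UNIV by auto
    show "emeasure ?M1 X = emeasure ?M2 X" if "X \<in> ?E" for X using that by (intro eq) (auto simp: bounded_box)
    fix i
    have "emeasure ?M1 (?A i) = emeasure lborel (\<Omega> \<inter> ?A i)"
      by (simp add: emeasure_density indicator_inter_arith[symmetric])
    also have "\<dots> \<le> emeasure lborel (?A i)" by (intro emeasure_mono) auto
    also have "\<dots> < \<infinity>" by (rule emeasure_bounded_finite) (rule bounded_box)
    finally show "emeasure ?M1 (?A i) \<noteq> \<infinity>" by simp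
  qed
  have "(\<integral>\<^sup>+S. indicator pos_def_mats S * g S \<partial>sym_lborel) = (\<integral>\<^sup>+v. indicator \<Omega> v * g (sym_of_upper v) \<partial>lborel)"
    by (subst nn_integral_sym_lborel) (auto simp: \<Omega>_def indicator_def)
  also have "\<dots> = (\<integral>\<^sup>+v. g (sym_of_upper v) \<partial>?M1)"
    by (subst nn_integral_density) auto
  also have "\<dots> = (\<integral>\<^sup>+v. g (sym_of_upper v) \<partial>?M2)" by (simp only: M)
  also have "\<dots> = (\<integral>\<^sup>+v. indicator \<Omega> v * ennreal (J v) * g (sym_of_upper (\<gamma> v)) \<partial>lborel)"
    by (simp add: nn_integral_distr nn_integral_density)
  also have "\<dots> = (\<integral>\<^sup>+P. indicator pos_def_mats P * ennreal (square_jacobian P) * g (P ** P) \<partial>sym_lborel)"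
    by (subst nn_integral_sym_lborel) (auto simp: \<Omega>_def indicator_def s\<gamma> J_def intro!: nn_integral_cong)
  finally show ?thesis .
qed

section \<open>Polar coordinates for Lebesgue measure\<close>

text \<open>
  Averaging \<open>\<phi> (U X)\<close> over the orthogonal group leaves the integral over \<open>X\<close> unchanged. If \<open>X = R P\<close> is the
  polar decomposition, the average of \<open>\<phi> (U R P)\<close> is an integral over \<open>stiefel_measure R\<close>, which by
  uniqueness does not depend on \<open>R\<close>.
\<close>

lemma nn_integral_polar_average:
  fixes \<phi> :: "real^'k^'n \<Rightarrow> ennreal"
  assumes kn: "CARD('k) \<le> CARD('n)" and Q: "Q \<in> (stiefel :: (real^'k^'n) set)"
    and [measurable]: "\<phi> \<in> borel_measurable borel"
  shows "(\<integral>\<^sup>+X. \<phi> X \<partial>lborel) = (\<integral>\<^sup>+X. (\<integral>\<^sup>+R. \<phi> (R ** pos_def_sqrt (transpose X ** X)) \<partial>stiefel_measure Q) \<partial>(lborel :: (real^'k^'n) measure))"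
proof -
  interpret H: prob_space "haar_orthogonal :: (real^'n^'n) measure" by (rule prob_space_haar)
  interpret pair_sigma_finite "haar_orthogonal :: (real^'n^'n) measure" "lborel :: (real^'k^'n) measure" ..
  have [measurable]: "(\<lambda>U. U) \<in> borel_measurable (haar_orthogonal :: (real^'n^'n) measure)"
    using measurable_stiefel_inclusion by (simp add: measurable_cong_sets[OF sets_haar refl])
  have "(\<integral>\<^sup>+X. \<phi> (U ** X) \<partial>lborel) = (\<integral>\<^sup>+X. \<phi> X \<partial>lborel)" if "U \<in> stiefel" for U :: "real^'n^'n"
    using scalesD(3)[OF scales_orthogonal_left, of U \<phi>] that by (simp add: orthogonal_matrix_stiefel)
  then have "(\<integral>\<^sup>+X. \<phi> X \<partial>lborel) = (\<integral>\<^sup>+U. (\<integral>\<^sup>+X. \<phi> (U ** X) \<partial>lborel) \<partial>(haar_orthogonal :: (real^'n^'n) measure))"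
    by (subst nn_integral_cong[where v="\<lambda>_. \<integral>\<^sup>+X. \<phi> X \<partial>lborel"]) (auto simp: H.emeasure_space_1[simplified])
  also have "\<dots> = (\<integral>\<^sup>+X. (\<integral>\<^sup>+U. \<phi> (U ** X) \<partial>(haar_orthogonal :: (real^'n^'n) measure)) \<partial>lborel)"
  proof (rule Fubini'[symmetric])
    have "(\<lambda>p. fst p) \<in> borel_measurable ((haar_orthogonal :: (real^'n^'n) measure) \<Otimes>\<^sub>M (lborel :: (real^'k^'n) measure))"
      by measurable
    then show "(\<lambda>(U, X). \<phi> (U ** X)) \<in> borel_measurable ((haar_orthogonal :: (real^'n^'n) measure) \<Otimes>\<^sub>M lborel)"
      unfolding split_def by measurable
  qed
  also have "\<dots> = (\<integral>\<^sup>+X. (\<integral>\<^sup>+R. \<phi> (R ** pos_def_sqrt (transpose X ** X)) \<partial>stiefel_measure Q) \<partial>(lborel :: (real^'k^'n) measure))"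
  proof (rule nn_integral_cong_AE)
    show "AE X in lborel. (\<integral>\<^sup>+U. \<phi> (U ** X) \<partial>(haar_orthogonal :: (real^'n^'n) measure)) =
      (\<integral>\<^sup>+R. \<phi> (R ** pos_def_sqrt (transpose X ** X)) \<partial>stiefel_measure Q)"
      using not_full_rank_null[OF kn]
    proof eventually_elim
      case (elim X)
      let ?R = "fst (polar_pair X)" and ?P = "snd (polar_pair X)"
      note X = polar_pair[OF elim]
      have s: "transpose ?P = ?P" using X(2) by (simp add: pos_def_mats_def)
      have sq: "pos_def_sqrt (transpose X ** X) = ?P"
        using stiefel_gram[OF X(1) s] X(3) pos_def_sqrt_eq[OF X(2)] by simp
      have "stiefel_measure ?R = stiefel_measure Q"
        by (rule homogeneous_prob_unique[OF homogeneous_prob_stiefel_measure[OF X(1)] Q])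
      moreover have "(\<integral>\<^sup>+R. \<phi> (R ** ?P) \<partial>stiefel_measure ?R) = (\<integral>\<^sup>+U. \<phi> ((U ** ?R) ** ?P) \<partial>haar_orthogonal)"
        by (rule nn_integral_stiefel_measure[OF X(1)]) (intro measurable_compose[OF measurable_stiefel_inclusion], measurable)
      ultimately show ?case using X(3) by (simp add: sq flip: matrix_mul_assoc)
    qed
  qed
  finally show ?thesis .
qed

definition polar_density :: "nat \<Rightarrow> real^'k::{finite,linorder}^'k::{finite,linorder} \<Rightarrow> real" where
  "polar_density n P = indicator pos_def_mats P * (det P ^ (n - CARD('k)) * eigenvalue_factor P)"

lemma polar_density_nonneg: "0 \<le> polar_density n P"
proof (cases "P \<in> pos_def_mats")
  case True
  then show ?thesis using pos_def_det_pos[OF True] square_jacobian_eq(2)[OF True] by (simp add: polar_density_def)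
qed (simp add: polar_density_def)

lemma polar_density_measurable [measurable]:
  "(polar_density n :: real^'k::{finite,linorder}^'k::{finite,linorder} \<Rightarrow> real) \<in> borel_measurable borel"
proof (rule borel_measurable_eqI)
  show "(\<lambda>P::real^'k::{finite,linorder}^'k::{finite,linorder}. indicator pos_def_mats P * (det P ^ (n - CARD('k)) * (square_jacobian P / (2 ^ CARD('k) * det P)))) \<in> borel_measurable borel"
    by measurable
  fix P :: "real^'k::{finite,linorder}^'k::{finite,linorder}"
  show "polar_density n P = indicator pos_def_mats P * (det P ^ (n - CARD('k)) * (square_jacobian P / (2 ^ CARD('k) * det P)))"
  proof (cases "P \<in> pos_def_mats")
    case True
    then show ?thesis using pos_def_det_pos[OF True] by (simp add: polar_density_def square_jacobian_eq(1)[OF True])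
  qed (simp add: polar_density_def)
qed

lemma sets_stiefel_measure [simp]: "sets (stiefel_measure Q) = sets stiefel_borel_space"
  by (simp add: stiefel_measure_def)

lemma prob_space_stiefel_measure: "Q \<in> stiefel \<Longrightarrow> prob_space (stiefel_measure Q)"
  using homogeneous_prob_stiefel_measure by (auto simp: homogeneous_prob_def)

lemma measurable_stiefel_measure:
  assumes "f \<in> borel_measurable borel" shows "f \<in> borel_measurable (stiefel_measure Q)"
  using measurable_compose[OF measurable_stiefel_inclusion assms]
  by (simp add: measurable_cong_sets[OF sets_stiefel_measure refl])

lemma measurable_polar_product:
  "(\<lambda>p. snd p ** fst p) \<in> borel_measurable ((borel :: (real^'k^'k) measure) \<Otimes>\<^sub>M (stiefel_measure Q :: (real^'k^'n) measure))"
proof -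
  have [measurable]: "(\<lambda>R. R) \<in> borel_measurable (stiefel_measure Q)"
    by (rule measurable_stiefel_measure) simp
  have "(\<lambda>p. snd p) \<in> borel_measurable ((borel :: (real^'k^'k) measure) \<Otimes>\<^sub>M (stiefel_measure Q :: (real^'k^'n) measure))"
    by measurable
  then show ?thesis by measurable
qed

text \<open>
  \<open>gram_distribution\<close> is applied to the function of \<open>S\<close> that results from the averaging, and \<open>S = P\<^sup>2\<close> is
  substituted. The power \<open>det (P\<^sup>2)\<close> to the \<open>(n - k - 1) / 2\<close> and the factor \<open>det P\<close> of the Jacobian
  combine to \<open>det P ^ (n - k)\<close>.
\<close>

theorem nn_integral_polar:
  assumes kn: "CARD('k::{finite,linorder}) \<le> CARD('n::finite)" and Q: "Q \<in> (stiefel :: (real^'k::{finite,linorder}^'n) set)"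
  obtains D :: real where "0 < D"
    "\<And>\<phi> :: real^'k::{finite,linorder}^'n \<Rightarrow> ennreal. \<phi> \<in> borel_measurable borel \<Longrightarrow>
      (\<integral>\<^sup>+X. \<phi> X \<partial>lborel) = (\<integral>\<^sup>+P. ennreal (D * polar_density CARD('n) P) * (\<integral>\<^sup>+R. \<phi> (R ** P) \<partial>stiefel_measure Q) \<partial>sym_lborel)"
proof -
  let ?n = "CARD('n)" and ?k = "CARD('k)"
  define q where "q = (real ?n - real ?k - 1) / 2"
  obtain C where C: "0 < C"
    "\<And>g. g \<in> borel_measurable borel \<Longrightarrow>
      (\<integral>\<^sup>+X. g (transpose X ** (X :: real^'k::{finite,linorder}^'n)) \<partial>lborel) =
      ennreal C * (\<integral>\<^sup>+S. ennreal (indicator pos_def_mats S * det S powr q) * g S \<partial>sym_lborel)"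
    using gram_distribution[OF kn] unfolding q_def by blast
  interpret mu: prob_space "stiefel_measure Q" by (rule prob_space_stiefel_measure[OF Q])
  show thesis
  proof (rule that)
    show "0 < C * 2 ^ ?k" using C(1) by simp
    fix \<phi> :: "real^'k::{finite,linorder}^'n \<Rightarrow> ennreal"
    assume \<phi>[measurable]: "\<phi> \<in> borel_measurable borel"
    define G where "G P = (\<integral>\<^sup>+R. \<phi> (R ** P) \<partial>stiefel_measure Q)" for P
    have [measurable]: "G \<in> borel_measurable borel" unfolding G_def[abs_def]
    proof (rule mu.borel_measurable_nn_integral)
      show "(\<lambda>(P, R). \<phi> (R ** P)) \<in> borel_measurable (borel \<Otimes>\<^sub>M stiefel_measure Q)"
        using measurable_compose[OF measurable_polar_product \<phi>] by (simp add: split_def)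
    qed
    have "(\<integral>\<^sup>+X. \<phi> X \<partial>lborel) = (\<integral>\<^sup>+X. G (pos_def_sqrt (transpose X ** X)) \<partial>(lborel :: (real^'k::{finite,linorder}^'n) measure))"
      unfolding G_def by (rule nn_integral_polar_average[OF kn Q \<phi>])
    also have "\<dots> = ennreal C * (\<integral>\<^sup>+S. ennreal (indicator pos_def_mats S * det S powr q) * G (pos_def_sqrt S) \<partial>sym_lborel)"
      by (rule C(2)) measurable
    also have "\<dots> = ennreal C * (\<integral>\<^sup>+S. indicator pos_def_mats S * (ennreal (det S powr q) * G (pos_def_sqrt S)) \<partial>sym_lborel)"
      by (rule arg_cong[where f="\<lambda>x. ennreal C * x"], rule nn_integral_cong) (simp add: indicator_def)
    also have "\<dots> = ennreal C * (\<integral>\<^sup>+P. indicator pos_def_mats P * ennreal (square_jacobian P) * (ennreal (det (P ** P) powr q) * G (pos_def_sqrt (P ** P))) \<partial>sym_lborel)"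
      by (subst square_change_of_variables) measurable
    also have "\<dots> = ennreal C * (\<integral>\<^sup>+P. ennreal (2 ^ ?k * polar_density ?n P) * G P \<partial>sym_lborel)"
    proof (rule arg_cong[where f="\<lambda>x. ennreal C * x"], rule nn_integral_cong)
      fix P :: "real^'k::{finite,linorder}^'k::{finite,linorder}"
      show "indicator pos_def_mats P * ennreal (square_jacobian P) * (ennreal (det (P ** P) powr q) * G (pos_def_sqrt (P ** P)))
        = ennreal (2 ^ ?k * polar_density ?n P) * G P"
      proof (cases "P \<in> pos_def_mats")
        case True
        have d: "0 < det P" by (rule pos_def_det_pos[OF True])
        have "det (P ** P) powr q * det P = det P powr (real ?n - real ?k - 1) * det P powr 1"
          using d by (simp add: det_mul powr_mult powr_add[symmetric] q_def)
        also have "\<dots> = det P powr (real (?n - ?k))" using kn by (simp only: powr_add[symmetric]) (simp add: of_nat_diff)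
        also have "\<dots> = det P ^ (?n - ?k)" using d by (simp add: powr_realpow)
        finally have e: "det (P ** P) powr q * det P = det P ^ (?n - ?k)" .
        have "square_jacobian P * det (P ** P) powr q = 2 ^ ?k * eigenvalue_factor P * (det (P ** P) powr q * det P)"
          unfolding square_jacobian_eq(1)[OF True] by (simp only: mult_ac)
        also have "\<dots> = 2 ^ ?k * polar_density ?n P"
          unfolding e using True by (simp add: polar_density_def)
        finally have "square_jacobian P * det (P ** P) powr q = 2 ^ ?k * polar_density ?n P" .
        then have "ennreal (square_jacobian P) * ennreal (det (P ** P) powr q) = ennreal (2 ^ ?k * polar_density ?n P)"
          by (subst ennreal_mult[symmetric]) (simp_all add: square_jacobian_def)
        then show ?thesis using True by (simp add: pos_def_sqrt_eq mult.assoc[symmetric])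
      qed (simp add: polar_density_def)
    qed
    also have "\<dots> = (\<integral>\<^sup>+P. ennreal C * (ennreal (2 ^ ?k * polar_density ?n P) * G P) \<partial>sym_lborel)"
      by (rule nn_integral_cmult[symmetric]) (simp add: measurable_cong_sets[OF sets_sym_lborel refl])
    also have "\<dots> = (\<integral>\<^sup>+P. ennreal (C * 2 ^ ?k * polar_density ?n P) * G P \<partial>sym_lborel)"
      using C(1) by (simp add: ennreal_mult' mult.assoc less_imp_le)
    finally show "(\<integral>\<^sup>+X. \<phi> X \<partial>lborel) = (\<integral>\<^sup>+P. ennreal (C * 2 ^ ?k * polar_density ?n P) * (\<integral>\<^sup>+R. \<phi> (R ** P) \<partial>stiefel_measure Q) \<partial>sym_lborel)"
      by (simp add: G_def)
  qed
qed

definition polar_radial_measure :: "real \<Rightarrow> nat \<Rightarrow> (real^'k::{finite,linorder}^'k::{finite,linorder}) measure" where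
  "polar_radial_measure D n = density sym_lborel (\<lambda>P. ennreal (D * polar_density n P))"

lemma sets_polar_radial [simp, measurable_cong]: "sets (polar_radial_measure D n) = sets borel"
  by (simp add: polar_radial_measure_def)

lemma sigma_finite_polar_radial: "sigma_finite_measure (polar_radial_measure D n)"
  unfolding polar_radial_measure_def
  by (subst sigma_finite_measure.sigma_finite_iff_density_finite[OF sigma_finite_sym_lborel])
    (simp_all add: measurable_cong_sets[OF sets_sym_lborel refl])

theorem lborel_polar:
  assumes kn: "CARD('k::{finite,linorder}) \<le> CARD('n::finite)" and Q: "Q \<in> (stiefel :: (real^'k::{finite,linorder}^'n) set)"
  obtains D :: real where "0 < D"
    "lborel = distr (polar_radial_measure D CARD('n) \<Otimes>\<^sub>M stiefel_measure Q) borel (\<lambda>p. snd p ** fst p)"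
proof -
  obtain D :: real where D: "0 < D"
    "\<And>\<phi> :: real^'k::{finite,linorder}^'n \<Rightarrow> ennreal. \<phi> \<in> borel_measurable borel \<Longrightarrow>
      (\<integral>\<^sup>+X. \<phi> X \<partial>lborel) = (\<integral>\<^sup>+P. ennreal (D * polar_density CARD('n) P) * (\<integral>\<^sup>+R. \<phi> (R ** P) \<partial>stiefel_measure Q) \<partial>sym_lborel)"
    using nn_integral_polar[OF kn Q] by blast
  interpret mu: prob_space "stiefel_measure Q" by (rule prob_space_stiefel_measure[OF Q])
  let ?R = "polar_radial_measure D CARD('n) :: (real^'k::{finite,linorder}^'k::{finite,linorder}) measure"
  have prod: "(\<lambda>p. snd p ** fst p) \<in> borel_measurable (?R \<Otimes>\<^sub>M stiefel_measure Q)"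
    using measurable_polar_product by (simp add: measurable_cong_sets[OF sets_pair_measure_cong[OF sets_polar_radial refl] refl])
  have "lborel = distr (?R \<Otimes>\<^sub>M stiefel_measure Q) borel (\<lambda>p. snd p ** fst p)"
  proof (rule measure_eqI)
    fix A :: "(real^'k::{finite,linorder}^'n) set" assume "A \<in> sets lborel"
    then have A[measurable]: "A \<in> sets borel" by simp
    have f: "(\<lambda>p. indicator A (snd p ** fst p) :: ennreal) \<in> borel_measurable (?R \<Otimes>\<^sub>M stiefel_measure Q)"
      by (rule measurable_compose[OF prod]) simp
    have g: "(\<lambda>P. \<integral>\<^sup>+R. indicator A (R ** P) \<partial>stiefel_measure Q) \<in> borel_measurable sym_lborel"
      using mu.borel_measurable_nn_integral_fst[OF f] by (simp add: measurable_cong_sets[OF sets_polar_radial refl] measurable_cong_sets[OF sets_sym_lborel refl])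
    have "emeasure (distr (?R \<Otimes>\<^sub>M stiefel_measure Q) borel (\<lambda>p. snd p ** fst p)) A = (\<integral>\<^sup>+p. indicator A (snd p ** fst p) \<partial>(?R \<Otimes>\<^sub>M stiefel_measure Q))"
      using A nn_integral_distr[OF prod, of "indicator A"] by simp
    also have "\<dots> = (\<integral>\<^sup>+P. (\<integral>\<^sup>+R. indicator A (R ** P) \<partial>stiefel_measure Q) \<partial>?R)"
      using mu.nn_integral_fst[OF f] by simp
    also have "\<dots> = (\<integral>\<^sup>+P. ennreal (D * polar_density CARD('n) P) * (\<integral>\<^sup>+R. indicator A (R ** P) \<partial>stiefel_measure Q) \<partial>sym_lborel)"
      unfolding polar_radial_measure_def by (rule nn_integral_density) (use g in \<open>simp_all add: measurable_cong_sets[OF sets_sym_lborel refl]\<close>)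
    also have "\<dots> = (\<integral>\<^sup>+X. indicator A X \<partial>lborel)" by (rule D(2)[symmetric]) simp
    finally show "emeasure lborel A = emeasure (distr (?R \<Otimes>\<^sub>M stiefel_measure Q) borel (\<lambda>p. snd p ** fst p)) A" by simp
  qed simp
  with D(1) show thesis by (rule that)
qed

section \<open>Integrands measurable up to null sets\<close>

text \<open>
  Two functions that agree almost everywhere have preimages that differ by a subset of a null set, and the
  completion contains all of these.
\<close>

lemma measurable_completion_AE:
  assumes f: "f \<in> M \<rightarrow>\<^sub>M N" and g: "\<And>x. x \<in> space M \<Longrightarrow> g x \<in> space N" and eq: "AE x in M. f x = g x"
  shows "g \<in> completion M \<rightarrow>\<^sub>M N"
proof (rule measurableI)
  fix A assume A: "A \<in> sets N"
  have f': "f -` A \<inter> space M \<in> sets (completion M)" using f A by (auto dest: measurable_sets)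
  have "AE x in completion M. x \<in> f -` A \<inter> space M \<longleftrightarrow> x \<in> g -` A \<inter> space M"
    using eq by (intro AE_completion) (auto elim!: eventually_mono)
  from completion.in_sets_AE[OF this f']
  show "g -` A \<inter> space (completion M) \<in> sets (completion M)" by simp
qed (simp add: g)

theorem theorem2p4:
  assumes "CARD('k::{finite,linorder}) \<le> CARD('n::finite)"
  shows "\<exists>D::real. \<forall>\<phi> :: real^'k::{finite,linorder}^'n \<Rightarrow> real.
    let F = (\<lambda>(P::real^'k::{finite,linorder}^'k::{finite,linorder}) (Q::real^'k::{finite,linorder}^'n).
               \<phi> (Q ** P) * D * det P ^ (CARD('n) - CARD('k)) *
               (\<Prod>j<CARD('k). \<Prod>i<j. (eigenvalue_list P ! i + eigenvalue_list P ! j)))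
    in (\<phi> \<in> borel_measurable lebesgue \<and> (\<forall>X. 0 \<le> \<phi> X) \<longrightarrow>
          (AE P in sym_lebesgue. P \<in> pos_def_mats \<longrightarrow>
             F P \<in> borel_measurable homogeneous_measure) \<and>
          (\<lambda>P. (\<integral>\<^sup>+Q. ennreal (F P Q) \<partial>homogeneous_measure) * indicator pos_def_mats P)
             \<in> borel_measurable sym_lebesgue \<and>
          (\<integral>\<^sup>+X. ennreal (\<phi> X) \<partial>lebesgue) =
            (\<integral>\<^sup>+P\<in>pos_def_mats. (\<integral>\<^sup>+Q. ennreal (F P Q) \<partial>homogeneous_measure) \<partial>sym_lebesgue)) \<and>
       (integrable lebesgue \<phi> \<longrightarrow>
          (AE P in sym_lebesgue. P \<in> pos_def_mats \<longrightarrow>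
             integrable homogeneous_measure (F P)) \<and>
          set_integrable sym_lebesgue pos_def_mats
             (\<lambda>P. LINT Q|homogeneous_measure. F P Q) \<and>
          (LINT X|lebesgue. \<phi> X) =
            (LINT P:pos_def_mats|sym_lebesgue. (LINT Q|homogeneous_measure. F P Q)))"
proof -
  let ?n = "CARD('n)" and ?k = "CARD('k)"
  obtain Q0 where Q0: "Q0 \<in> (stiefel :: (real^'k::{finite,linorder}^'n) set)"
    using stiefel_nonempty[OF assms] by blast
  define \<mu> where "\<mu> = stiefel_measure Q0"
  obtain D :: real where D: "0 < D"
    and lb: "lborel = distr (polar_radial_measure D ?n \<Otimes>\<^sub>M \<mu>) borel (\<lambda>p. snd p ** fst p)"
    unfolding \<mu>_def using lborel_polar[OF assms Q0] by blast
  define R :: "(real^'k::{finite,linorder}^'k::{finite,linorder}) measure" where "R = polar_radial_measure D ?n"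
  have hom: "homogeneous_measure = completion \<mu>" unfolding \<mu>_def by (rule homogeneous_measure_eq[OF Q0])
  interpret mu: prob_space \<mu> unfolding \<mu>_def by (rule prob_space_stiefel_measure[OF Q0])
  interpret R: sigma_finite_measure R unfolding R_def by (rule sigma_finite_polar_radial)
  interpret pair_sigma_finite R \<mu> ..
  have setsR: "sets R = sets borel" by (simp add: R_def)
  have prod: "(\<lambda>p. snd p ** fst p) \<in> borel_measurable (R \<Otimes>\<^sub>M \<mu>)"
    unfolding \<mu>_def using measurable_polar_product
    by (simp add: measurable_cong_sets[OF sets_pair_measure_cong[OF setsR refl] refl])
  define w :: "real^'k::{finite,linorder}^'k::{finite,linorder} \<Rightarrow> real" where "w P = D * polar_density ?n P" for P
  have w0: "0 \<le> w P" for P using D polar_density_nonneg[of ?n P] by (simp add: w_def)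
  have w_meas[measurable]: "w \<in> borel_measurable borel" unfolding w_def[abs_def] by measurable
  have R_density: "R = density sym_lborel (\<lambda>P. ennreal (w P))" by (simp add: R_def polar_radial_measure_def w_def)
  have bmR: "borel_measurable R = borel_measurable sym_lborel" by (rule measurable_cong_sets) (simp_all add: setsR)
  have w_sym: "w \<in> borel_measurable sym_lborel" by (simp add: measurable_cong_sets[OF sets_sym_lborel refl])
  have w_pos: "0 < w P" if "P \<in> pos_def_mats" for P
    using that D pos_def_det_pos[OF that] square_jacobian_eq(2)[OF that] by (simp add: w_def polar_density_def)
  have w_out: "w P = 0" if "P \<notin> pos_def_mats" for P using that by (simp add: w_def polar_density_def)
  have F_eq: "x * D * det P ^ (?n - ?k) * (\<Prod>j<?k. \<Prod>i<j. (eigenvalue_list P ! i + eigenvalue_list P ! j)) = x * w P"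
    if "P \<in> pos_def_mats" for P x
    using that by (simp add: w_def polar_density_def eigenvalue_factor_def)
  show ?thesis
  proof (intro exI[of _ D] allI, goal_cases)
    case (1 \<phi>)
    define F where "F P Q = \<phi> (Q ** P) * D * det P ^ (?n - ?k) *
               (\<Prod>j<?k. \<Prod>i<j. (eigenvalue_list P ! i + eigenvalue_list P ! j))" for P Q
    have F_w: "F P Q = \<phi> (Q ** P) * w P" if "P \<in> pos_def_mats" for P Q
      unfolding F_def by (rule F_eq[OF that])
    \<comment> \<open>the null set where the two functions differ pulls back to a null set of the product, and on the cone the density w is positive\<close>
    have good: "\<exists>\<psi>. \<psi> \<in> borel_measurable borel \<and> (AE X in lborel. \<phi> X = \<psi> X) \<and>
      (AE P in sym_lborel. P \<in> pos_def_mats \<longrightarrow> (AE Q in \<mu>. \<phi> (Q ** P) = \<psi> (Q ** P)))"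
      if \<phi>: "\<phi> \<in> borel_measurable lebesgue"
    proof -
      obtain \<psi> where \<psi>: "\<psi> \<in> borel_measurable lborel" "AE X in lborel. \<phi> X = \<psi> X"
        using completion_ex_borel_measurable_real[OF \<phi>] by blast
      have "AE X in distr (R \<Otimes>\<^sub>M \<mu>) borel (\<lambda>p. snd p ** fst p). \<phi> X = \<psi> X"
        using \<psi>(2) lb unfolding R_def by metis
      then have "AE p in R \<Otimes>\<^sub>M \<mu>. \<phi> (snd p ** fst p) = \<psi> (snd p ** fst p)" by (rule AE_distrD[OF prod])
      from AE_pair[OF this] have "AE P in R. AE Q in \<mu>. \<phi> (Q ** P) = \<psi> (Q ** P)" by simp
      then have "AE P in sym_lborel. 0 < ennreal (w P) \<longrightarrow> (AE Q in \<mu>. \<phi> (Q ** P) = \<psi> (Q ** P))"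
        unfolding R_density using w_sym by (subst (asm) AE_density) simp_all
      then have "AE P in sym_lborel. P \<in> pos_def_mats \<longrightarrow> (AE Q in \<mu>. \<phi> (Q ** P) = \<psi> (Q ** P))"
        by eventually_elim (use w_pos in auto)
      with \<psi> show ?thesis by auto
    qed
    show ?case
      unfolding F_def[symmetric, abs_def] Let_def
    proof (intro conjI impI; (elim conjE)?)
      assume \<phi>: "\<phi> \<in> borel_measurable lebesgue"
      obtain \<psi> where \<psi>[measurable]: "\<psi> \<in> borel_measurable borel" and ae: "AE X in lborel. \<phi> X = \<psi> X"
        and aeP: "AE P in sym_lborel. P \<in> pos_def_mats \<longrightarrow> (AE Q in \<mu>. \<phi> (Q ** P) = \<psi> (Q ** P))"
        using good[OF \<phi>] by blast
      have \<psi>P: "(\<lambda>Q. \<psi> (Q ** P) * w P) \<in> borel_measurable \<mu>" for P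
        unfolding \<mu>_def by (rule measurable_stiefel_measure) measurable
      have \<psi>2: "(\<lambda>p. ennreal (\<psi> (snd p ** fst p))) \<in> borel_measurable (R \<Otimes>\<^sub>M \<mu>)"
        by (rule measurable_compose[OF prod]) simp
      let ?G = "\<lambda>P. \<integral>\<^sup>+Q. ennreal (\<psi> (Q ** P)) \<partial>\<mu>"
      have G: "?G \<in> borel_measurable sym_lborel" using mu.borel_measurable_nn_integral_fst[OF \<psi>2] by (simp add: bmR)
      show "AE P in sym_lebesgue. P \<in> pos_def_mats \<longrightarrow> F P \<in> borel_measurable homogeneous_measure"
        unfolding sym_lebesgue_eq hom
      proof (rule AE_completion, use aeP in eventually_elim, rule impI)
        fix P assume *: "P \<in> pos_def_mats \<longrightarrow> (AE Q in \<mu>. \<phi> (Q ** P) = \<psi> (Q ** P))" and P: "P \<in> pos_def_mats"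
        then have "AE Q in \<mu>. \<phi> (Q ** P) = \<psi> (Q ** P)" by simp
        then have "AE Q in \<mu>. \<psi> (Q ** P) * w P = F P Q" by eventually_elim (simp add: F_w[OF P])
        then show "F P \<in> borel_measurable (completion \<mu>)" by (intro measurable_completion_AE[OF \<psi>P]) auto
      qed
      have eq: "AE P in sym_lborel. ennreal (w P) * ?G P = (\<integral>\<^sup>+Q. ennreal (F P Q) \<partial>homogeneous_measure) * indicator pos_def_mats P"
        using aeP
      proof eventually_elim
        case (elim P)
        show ?case
        proof (cases "P \<in> pos_def_mats")
          case True
          have "(\<integral>\<^sup>+Q. ennreal (F P Q) \<partial>\<mu>) = (\<integral>\<^sup>+Q. ennreal (w P) * ennreal (\<psi> (Q ** P)) \<partial>\<mu>)"
            using elim True by (intro nn_integral_cong_AE) (auto simp: F_w[OF True] ennreal_mult' w0 mult.commute)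
          also have "\<dots> = ennreal (w P) * ?G P"
            by (rule nn_integral_cmult) (unfold \<mu>_def, rule measurable_stiefel_measure, measurable)
          finally show ?thesis using True by (simp add: hom nn_integral_completion)
        qed (simp add: w_out)
      qed
      show "(\<lambda>P. (\<integral>\<^sup>+Q. ennreal (F P Q) \<partial>homogeneous_measure) * indicator pos_def_mats P) \<in> borel_measurable sym_lebesgue"
        unfolding sym_lebesgue_eq
      proof (rule measurable_completion_AE[OF _ _ eq])
        show "(\<lambda>P. ennreal (w P) * ?G P) \<in> borel_measurable sym_lborel" using G w_sym by simp
      qed simp
      have "(\<integral>\<^sup>+X. ennreal (\<phi> X) \<partial>lebesgue) = (\<integral>\<^sup>+X. ennreal (\<psi> X) \<partial>lborel)"
        unfolding nn_integral_completion using ae by (intro nn_integral_cong_AE) auto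
      also have "\<dots> = (\<integral>\<^sup>+p. ennreal (\<psi> (snd p ** fst p)) \<partial>(R \<Otimes>\<^sub>M \<mu>))"
        unfolding lb R_def[symmetric] by (rule nn_integral_distr[OF prod]) simp
      also have "\<dots> = (\<integral>\<^sup>+P. ?G P \<partial>R)" using mu.nn_integral_fst[OF \<psi>2] by simp
      also have "\<dots> = (\<integral>\<^sup>+P. ennreal (w P) * ?G P \<partial>sym_lborel)"
        unfolding R_density using w_sym G by (intro nn_integral_density) simp_all
      also have "\<dots> = (\<integral>\<^sup>+P\<in>pos_def_mats. (\<integral>\<^sup>+Q. ennreal (F P Q) \<partial>homogeneous_measure) \<partial>sym_lebesgue)"
        unfolding sym_lebesgue_eq nn_integral_completion by (rule nn_integral_cong_AE[OF eq])
      finally show "(\<integral>\<^sup>+X. ennreal (\<phi> X) \<partial>lebesgue) = (\<integral>\<^sup>+P\<in>pos_def_mats. (\<integral>\<^sup>+Q. ennreal (F P Q) \<partial>homogeneous_measure) \<partial>sym_lebesgue)" .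
    next
      assume int: "integrable lebesgue \<phi>"
      then have \<phi>: "\<phi> \<in> borel_measurable lebesgue" by simp
      obtain \<psi> where \<psi>[measurable]: "\<psi> \<in> borel_measurable borel" and ae: "AE X in lborel. \<phi> X = \<psi> X"
        and aeP: "AE P in sym_lborel. P \<in> pos_def_mats \<longrightarrow> (AE Q in \<mu>. \<phi> (Q ** P) = \<psi> (Q ** P))"
        using good[OF \<phi>] by blast
      have \<psi>l: "\<psi> \<in> borel_measurable lebesgue" by (rule measurable_completion) simp
      have ael: "AE X in lebesgue. \<phi> X = \<psi> X" using ae by (rule AE_completion)
      have "integrable lebesgue \<psi>" using integrable_cong_AE[OF \<phi> \<psi>l ael] int by simp
      then have "integrable lborel \<psi>" by (simp add: integrable_completion)
      then have i2: "integrable (R \<Otimes>\<^sub>M \<mu>) (\<lambda>p. \<psi> (snd p ** fst p))"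
        unfolding lb R_def[symmetric] by (subst (asm) integrable_distr_eq[OF prod]) simp_all
      have \<psi>P: "(\<lambda>Q. \<psi> (Q ** P) * w P) \<in> borel_measurable \<mu>" for P
        unfolding \<mu>_def by (rule measurable_stiefel_measure) measurable
      let ?G = "\<lambda>P. LINT Q|\<mu>. \<psi> (Q ** P)"
      have iG: "integrable R ?G" using integrable_fst'[OF i2] by simp
      have G: "?G \<in> borel_measurable sym_lborel" using borel_measurable_integrable[OF iG] by (simp add: bmR)
      have iwG: "integrable sym_lborel (\<lambda>P. w P * ?G P)"
        using iG G w_sym w0 unfolding R_density by (subst (asm) integrable_density) simp_all
      have "AE P in R. integrable \<mu> (\<lambda>Q. \<psi> (Q ** P))" using AE_integrable_fst'[OF i2] by simp
      then have "AE P in sym_lborel. 0 < ennreal (w P) \<longrightarrow> integrable \<mu> (\<lambda>Q. \<psi> (Q ** P))"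
        unfolding R_density using w_sym by (subst (asm) AE_density) simp_all
      with aeP have good: "AE P in sym_lborel. P \<in> pos_def_mats \<longrightarrow>
        integrable (completion \<mu>) (F P) \<and> (LINT Q|completion \<mu>. F P Q) = w P * ?G P"
      proof (eventually_elim, intro impI)
        fix P assume *: "P \<in> pos_def_mats \<longrightarrow> (AE Q in \<mu>. \<phi> (Q ** P) = \<psi> (Q ** P))"
          and **: "0 < ennreal (w P) \<longrightarrow> integrable \<mu> (\<lambda>Q. \<psi> (Q ** P))" and P: "P \<in> pos_def_mats"
        from * P have "AE Q in \<mu>. \<phi> (Q ** P) = \<psi> (Q ** P)" by simp
        then have eq: "AE Q in \<mu>. \<psi> (Q ** P) * w P = F P Q" by eventually_elim (simp add: F_w[OF P])
        then have Fm: "F P \<in> borel_measurable (completion \<mu>)" by (intro measurable_completion_AE[OF \<psi>P]) auto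
        have cm: "(\<lambda>Q. \<psi> (Q ** P) * w P) \<in> borel_measurable (completion \<mu>)" by (rule measurable_completion[OF \<psi>P])
        note eqc = AE_completion[OF eq]
        have "integrable \<mu> (\<lambda>Q. \<psi> (Q ** P) * w P)" using ** w_pos[OF P] by simp
        then have "integrable (completion \<mu>) (\<lambda>Q. \<psi> (Q ** P) * w P)" using integrable_completion[OF \<psi>P] by simp
        then have "integrable (completion \<mu>) (F P)" using integrable_cong_AE[OF cm Fm eqc] by simp
        moreover have "(LINT Q|completion \<mu>. F P Q) = (LINT Q|completion \<mu>. \<psi> (Q ** P) * w P)"
          by (rule integral_cong_AE[OF cm Fm eqc, symmetric])
        moreover have "\<dots> = w P * ?G P" using integral_completion[OF \<psi>P] by simp
        ultimately show "integrable (completion \<mu>) (F P) \<and> (LINT Q|completion \<mu>. F P Q) = w P * ?G P" by simp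
      qed
      show "AE P in sym_lebesgue. P \<in> pos_def_mats \<longrightarrow> integrable homogeneous_measure (F P)"
        unfolding sym_lebesgue_eq hom using good by (intro AE_completion) (auto elim!: eventually_mono)
      let ?H = "\<lambda>P. indicator pos_def_mats P *\<^sub>R (LINT Q|homogeneous_measure. F P Q)"
      have eq: "AE P in sym_lborel. w P * ?G P = ?H P"
        using good by eventually_elim (auto simp: hom w_out split: split_indicator)
      have Hm: "?H \<in> borel_measurable (completion sym_lborel)"
        using G w_sym by (intro measurable_completion_AE[OF _ _ eq]) simp_all
      have wG: "(\<lambda>P. w P * ?G P) \<in> borel_measurable sym_lborel" using iwG by simp
      note wGc = measurable_completion[OF wG] and eqc = AE_completion[OF eq]
      show "set_integrable sym_lebesgue pos_def_mats (\<lambda>P. LINT Q|homogeneous_measure. F P Q)"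
        unfolding set_integrable_def sym_lebesgue_eq
        using integrable_cong_AE[OF wGc Hm eqc] iwG integrable_completion[OF wG] by simp
      have "(LINT X|lebesgue. \<phi> X) = (LINT X|lborel. \<psi> X)"
        using integral_cong_AE[OF \<phi> \<psi>l ael] integral_completion[of \<psi> lborel] by simp
      also have "\<dots> = integral\<^sup>L (R \<Otimes>\<^sub>M \<mu>) (\<lambda>p. \<psi> (snd p ** fst p))"
        unfolding lb R_def[symmetric] by (rule integral_distr[OF prod]) simp
      also have "\<dots> = (LINT P|R. ?G P)" using integral_fst'[OF i2] by simp
      also have "\<dots> = (LINT P|sym_lborel. w P * ?G P)"
        unfolding R_density using w_sym G w0 by (subst integral_density) simp_all
      also have "\<dots> = (LINT P|completion sym_lborel. ?H P)"
        using integral_cong_AE[OF wGc Hm eqc] integral_completion[OF wG] by simp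
      finally show "(LINT X|lebesgue. \<phi> X) = (LINT P:pos_def_mats|sym_lebesgue. (LINT Q|homogeneous_measure. F P Q))"
        by (simp add: set_lebesgue_integral_def sym_lebesgue_eq)
    qed
  qed
qed

end
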